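(* Let $\mathbb{K}$ be a field of characteristic zero, $u$ an indeterminate, and $n,d\ge1$ integers. The set $\mathsf{C}_n\subset\mathcal{RY}_{d,n}(u)$ is linearly independent over $\mathbb{K}(u)$. Consequently, $$\dim_{\mathbb{K}(u)}\bigl(\mathcal{RY}_{d,n}(u)\bigr)=|\mathsf{C}_n|=\sum_{r=0}^n d^r\binom{n}{r}^{2}r!.$$ In particular, the tensor representation $\rho:\mathcal{RY}_{d,n}(u)\to\mathrm{End}_{\mathbb{K}(u)}\bigl(\mathcal{U}^{\otimes n}\bigr)$ is faithful whenever $d\ge n$.
   Context: **The algebra.** $\mathcal{RY}_{d,n}(u)$ (the Rook Yokonuma--Hecke algebra) is the $\mathbb{K}(u)$-algebra presented by generators $\mathsf{T}_1,\dots,\mathsf{T}_{n-1}$, $\mathsf{F}_1,\dots,\mathsf{F}_n$, $\mathsf{N}$ and relations (indices ranging over all values for which the expressions make sense): - $\mathsf{T}_i\mathsf{T}_j\mathsf{T}_i=\mathsf{T}_j\mathsf{T}_i\mathsf{T}_j$ if $|i-j|=1$; $\mathsf{T}_i\mathsf{T}_j=\mathsf{T}_j\mathsf{T}_i$ if $|i-j|>1$; - $\mathsf{F}_i^d=1$; $\mathsf{F}_i\mathsf{F}_j=\mathsf{F}_j\mathsf{F}_i$; - $\mathsf{T}_i^2=u+(u-1)\mathsf{F}_i^{\frac{d^2-d}{2}}\mathsf{E}_i\mathsf{T}_i$; $\mathsf{T}_i\mathsf{F}_j=\mathsf{F}_{js_i}\mathsf{T}_i$, where $js_i$ is the image of $j$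 under the transposition $s_i=(i,i+1)$; - $\mathsf{F}_i\mathsf{N}=\mathsf{N}\mathsf{F}_{i+1}$ for $i<n$; $\mathsf{N}\mathsf{F}_1=\mathsf{F}_n\mathsf{N}=\mathsf{N}$; - $\mathsf{N}^{i+1}\mathsf{T}_i=u\mathsf{N}^{i+1}$ and $\mathsf{T}_i\mathsf{N}^{n-i+1}=u\mathsf{N}^{n-i+1}$; - $\mathsf{T}_i\mathsf{N}=\mathsf{N}\mathsf{T}_{i+1}$; $\mathsf{N}\mathsf{T}_1\cdots\mathsf{T}_{n-1}\mathsf{N}=u^{n-1}\mathsf{N}$; where $\mathsf{E}_i=\frac1d\sum_{k=0}^{d-1}\mathsf{F}_i^k\mathsf{F}_{i+1}^{-k}$. **The set $\mathsf{C}_n$.** For $1\le j\le k\le n$: $\mathsf{T}_{k,j}=1$ if $k=j$ and $\mathsf{T}_{k,j}=\mathsf{T}_{k-1}\mathsf{T}_{k-2}\cdots\mathsf{T}_j$ otherwise. For $\mathbf{m}=(m_1,\dots,m_r)\in(\mathbb{Z}/d\mathbb{Z})^r$: $\mathsf{F}_{\mathbf{m}}=\mathsf{F}_1^{m_1}\cdots\mathsf{F}_r^{m_r}$. For $\omega$ in the symmetric group $\mathcal{S}_r$ on $\{1,\dots,r\}$ ($r\le n$) with reduced expression $s_{i_1}\cdots s_{i_l}$: $\mathsf{T}_\omega=\mathsf{T}_{i_1}\cdots\mathsf{T}_{i_l}$ (independent of the choice of reduced expression). For $A=\{a_1<\cdots<a_k\}\subseteq\{1,\dots,n\}$: $\mathsf{T}_A=\mathsf{T}_{a_1,1}\cdots\mathsf{T}_{a_k,k}$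 and $\overline{\mathsf{T}}_A=\mathsf{T}_{n-k+1,a_1}\cdots\mathsf{T}_{n,a_k}$. Put $\mathsf{C}_{n,0}=\{\mathsf{N}^n\}$; for $1\le r\le n$, $\mathsf{C}_{n,r}$ is the family of elements $\mathsf{T}_A\mathsf{F}_{\mathbf{m}}\mathsf{T}_\omega\mathsf{N}^{n-r}\overline{\mathsf{T}}_B$ indexed by all $A,B\subseteq\{1,\dots,n\}$ with $|A|=|B|=r$, $\mathbf{m}\in(\mathbb{Z}/d\mathbb{Z})^r$ and $\omega\in\mathcal{S}_r$; and $\mathsf{C}_n=\bigsqcup_{r=0}^n\mathsf{C}_{n,r}$. **The tensor representation $\rho$.** Let $\mathbb{S}=\mathbb{K}(u^{1/2})$, let $V$ be the free $\mathbb{S}$-module with basis $\{v_i^s\mid 1\le i\le n,\ 1\le s\le d\}$, and let $\mathcal{U}=\mathbb{S}\oplus V$, where $v_0$ denotes the identity of $\mathbb{S}$, so that $\{v_0\}\cup\{v_i^s\}$ is an $\mathbb{S}$-basis of $\mathcal{U}$. Let $\xi$ be a primitive $d$th root of unity. Define $\mathbf{F}\in\mathrm{End}_{\mathbb{S}}(\mathcal{U})$ by $\mathbf{F}(v_i^s)=\xi^sv_i^s$, $\mathbf{F}(v_0)=v_0$, and define $\mathbf{T}\in\mathrm{End}_{\mathbb{S}}(\mathcal{U}^{\otimes2})$, with $\epsilon_s=(-1)^{(d-1)s}$, by - $\mathbf{T}(v_i^s\otimes v_j^t)=u^{1/2}\,v_j^t\otimes v_i^s$ if $s\ne t$; - $\mathbf{T}(v_i^s\otimes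 v_i^s)=\epsilon_su\,v_i^s\otimes v_i^s$; - $\mathbf{T}(v_i^s\otimes v_j^s)=\epsilon_su^{1/2}\,v_j^s\otimes v_i^s$ if $i>j$; - $\mathbf{T}(v_i^s\otimes v_j^s)=\epsilon_s(u-1)\,v_i^s\otimes v_j^s+\epsilon_su^{1/2}\,v_j^s\otimes v_i^s$ if $i<j$; - $\mathbf{T}(v_0\otimes v_0)=u\,v_0\otimes v_0$; - $\mathbf{T}(x\otimes y)=u^{1/2}\,y\otimes x$ if one of $x,y$ is $v_0$ and the other lies in $V$. Let $\mathbf{F}_i$ be $\mathbf{F}$ acting on the $i$th factor of $\mathcal{U}^{\otimes n}$, and $\mathbf{T}_i$ be $\mathbf{T}$ acting on the $i$th and $(i+1)$st factors. Let $\mathbf{N}$ be the operator on $\mathcal{U}^{\otimes n}$ given on tensors $x=x_1\otimes\cdots\otimes x_n$ of basis vectors by $\mathbf{N}(x)=u^{\varepsilon(x)/2}\,x_2\otimes\cdots\otimes x_n\otimes x_1^0$, where $\varepsilon(x)=|\{k\mid x_k\in V\}|$, $x_1^0=v_0$ if $x_1=v_0$, and $x_1^0=0$ if $x_1\in V$. The tensor representation $\rho$ of $\mathcal{RY}_{d,n}(u)$ on $\mathcal{U}^{\otimes n}$ is given by $\mathsf{F}_i\mapsto\mathbf{F}_i$, $\mathsf{T}_i\mapsto\mathbf{T}_i$, $\mathsf{N}\mapsto\mathbf{N}$.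
   Formalization: For n≥2 the printed T breaks the quadratic relation on v_0⊗v_j^d, so ρ is not a representation; existence and faithfulness are proved for T corrected to T(v_0⊗v_j^d)=(u-1)v_0⊗v_j^d+u^{1/2}v_j^d⊗v_0. With the printed T, faithfulness has content only for n=1. *)

theory Defs
  imports
    "HOL-Library.Poly_Mapping"
    "HOL-Library.FuncSet"
    "HOL-Computational_Algebra.Polynomial"
    "HOL-Computational_Algebra.Fraction_Field"
    "HOL-Combinatorics.Permutations"
    "HOL-Algebra.QuotRing"
    "Jordan_Normal_Form.VS_Connect"
begin

section \<open>Free algebras\<close>

text \<open>
  With concatenation as addition of words, the convolution product of
  \<^typ>\<open>'x list \<Rightarrow>\<^sub>0 'a\<close> is the product of the free algebra on \<^typ>\<open>'x\<close>, that is, of the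
  tensor algebra of the free module on \<^typ>\<open>'x\<close>; \<^term>\<open>Poly_Mapping.single w c\<close> is \<open>c\<cdot>w\<close>.
\<close>

instantiation list :: (type) monoid_add
begin

definition zero_list :: "'a list" where "zero_list = []"

definition plus_list :: "'a list \<Rightarrow> 'a list \<Rightarrow> 'a list" where "plus_list = append"

instance
  by standard (simp_all add: zero_list_def plus_list_def)

end

definition scal :: "'a::zero \<Rightarrow> 'x list \<Rightarrow>\<^sub>0 'a" where
  "scal c = Poly_Mapping.single [] c"


section \<open>The fields \<open>K(u)\<close> and \<open>K(u\<^bsup>1/2\<^esup>)\<close>\<close>

text \<open>
  Both fields are fraction fields of \<open>K[X]\<close>.  Over \<open>K(u)\<close> the variable \<open>X\<close> stands for \<open>u\<close>; over
  \<open>K(u\<^bsup>1/2\<^esup>)\<close> it stands for \<open>u\<^bsup>1/2\<^esup>\<close>.  The inclusion \<open>K(u) \<subseteq> K(u\<^bsup>1/2\<^esup>)\<close> is thus the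
  substitution \<open>X \<mapsto> X\<^sup>2\<close>.
\<close>

type_synonym 'k ratfun = "'k poly fract"

definition uvar :: "'k::field_char_0 ratfun" where
  "uvar = Fract [:0, 1:] 1"

definition sqrt_u :: "'k::field_char_0 ratfun" where
  "sqrt_u = Fract [:0, 1:] 1"

definition incl :: "'k::field_char_0 ratfun \<Rightarrow> 'k ratfun" where
  "incl r = (THE s. \<exists>p q. q \<noteq> 0 \<and> r = Fract p q \<and>
               s = Fract (pcompose p [:0, 0, 1:]) (pcompose q [:0, 0, 1:]))"

lemma incl_Fract:
  assumes "q \<noteq> 0"
  shows "incl (Fract p q) = Fract (pcompose p [:0, 0, 1:]) (pcompose q [:0, 0, 1:])"
proof -
  let ?h = "\<lambda>p :: 'a poly. pcompose p [:0, 0, 1:]"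
  have nz: "?h p \<noteq> 0" if "p \<noteq> 0" for p
    using that by (simp add: pcompose_eq_0_iff)
  have "Fract (?h p') (?h q') = Fract (?h p) (?h q)" if "q' \<noteq> 0" "Fract p q = Fract p' q'" for p' q'
  proof -
    have "?h (p * q') = ?h (p' * q)"
      using that assms by (simp add: eq_fract)
    then show ?thesis
      using nz that assms by (simp add: eq_fract pcompose_mult)
  qed
  then show ?thesis
    unfolding incl_def using assms by (intro the_equality) (blast, metis)
qed

lemma incl_uvar: "incl uvar = sqrt_u ^ 2"
  by (simp add: uvar_def sqrt_u_def incl_Fract pcompose_pCons pcompose_1 power2_eq_square)


section \<open>The Rook Yokonuma--Hecke algebra\<close>

datatype gen = GT nat | GF nat | GN

type_synonym 'k free = "gen list \<Rightarrow>\<^sub>0 'k ratfun"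

definition gT :: "nat \<Rightarrow> 'k::field_char_0 free" where "gT i = Poly_Mapping.single [GT i] 1"
definition gF :: "nat \<Rightarrow> 'k::field_char_0 free" where "gF i = Poly_Mapping.single [GF i] 1"
definition gN :: "'k::field_char_0 free" where "gN = Poly_Mapping.single [GN] 1"

definition gens :: "nat \<Rightarrow> gen set" where
  "gens n = GT ` {1..<n} \<union> GF ` {1..n} \<union> {GN}"

definition free_alg :: "nat \<Rightarrow> 'k::field_char_0 free ring" where
  "free_alg n = \<lparr>carrier = {x. Poly_Mapping.keys x \<subseteq> lists (gens n)},
     mult = (*), one = 1, zero = 0, add = (+)\<rparr>"

text \<open>\<open>F\<^bsub>i+1\<^esub>\<^bsup>-k\<^esup>\<close> is written as \<open>F\<^bsub>i+1\<^esub>\<^bsup>d-k\<^esup>\<close>, which is the same modulo \<open>F\<^bsub>i+1\<^esub>\<^bsup>d\<^esup> = 1\<close>.\<close>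

definition gE :: "nat \<Rightarrow> nat \<Rightarrow> 'k::field_char_0 free" where
  "gE d i = scal (1 / of_nat d) * (\<Sum>k<d. gF i ^ k * gF (i + 1) ^ (d - k))"

inductive_set relators :: "nat \<Rightarrow> nat \<Rightarrow> 'k::field_char_0 free set" for d n :: nat where
  braid: "\<lbrakk>i \<in> {1..<n}; j \<in> {1..<n}; j = i + 1 \<or> i = j + 1\<rbrakk> \<Longrightarrow>
    gT i * gT j * gT i - gT j * gT i * gT j \<in> relators d n"
| T_comm: "\<lbrakk>i \<in> {1..<n}; j \<in> {1..<n}; j > i + 1 \<or> i > j + 1\<rbrakk> \<Longrightarrow>
    gT i * gT j - gT j * gT i \<in> relators d n"
| F_order: "i \<in> {1..n} \<Longrightarrow> gF i ^ d - 1 \<in> relators d n"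
| F_comm: "\<lbrakk>i \<in> {1..n}; j \<in> {1..n}\<rbrakk> \<Longrightarrow> gF i * gF j - gF j * gF i \<in> relators d n"
| quadratic: "i \<in> {1..<n} \<Longrightarrow>
    gT i ^ 2 - (scal uvar + scal (uvar - 1) * gF i ^ ((d\<^sup>2 - d) div 2) * gE d i * gT i)
      \<in> relators d n"
| T_F: "\<lbrakk>i \<in> {1..<n}; j \<in> {1..n}\<rbrakk> \<Longrightarrow>
    gT i * gF j - gF (Transposition.transpose i (i + 1) j) * gT i \<in> relators d n"
| F_N: "i \<in> {1..<n} \<Longrightarrow> gF i * gN - gN * gF (i + 1) \<in> relators d n"
| N_F1: "gN * gF 1 - gN \<in> relators d n"
| Fn_N: "gF n * gN - gN \<in> relators d n"
| Npow_T: "i \<in> {1..<n} \<Longrightarrow> gN ^ (i + 1) * gT i - scal uvar * gN ^ (i + 1) \<in> relators d n"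
| T_Npow: "i \<in> {1..<n} \<Longrightarrow>
    gT i * gN ^ (n - i + 1) - scal uvar * gN ^ (n - i + 1) \<in> relators d n"
| T_N: "\<lbrakk>i \<in> {1..<n}; i + 1 \<in> {1..<n}\<rbrakk> \<Longrightarrow> gT i * gN - gN * gT (i + 1) \<in> relators d n"
| N_T_N: "gN * prod_list (map gT [1..<n]) * gN - scal (uvar ^ (n - 1)) * gN \<in> relators d n"

definition RY_ideal :: "nat \<Rightarrow> nat \<Rightarrow> 'k::field_char_0 free set" where
  "RY_ideal d n = Idl\<^bsub>free_alg n\<^esub> (relators d n)"

text \<open>The class of an element of the free algebra in \<open>RY\<^bsub>d,n\<^esub>(u)\<close>.\<close>

definition RY_class :: "nat \<Rightarrow> nat \<Rightarrow> 'k::field_char_0 free \<Rightarrow> 'k free set" where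
  "RY_class d n x = RY_ideal d n +>\<^bsub>free_alg n\<^esub> x"

definition RY :: "nat \<Rightarrow> nat \<Rightarrow> ('k::field_char_0 ratfun, 'k free set) module" where
  "RY d n = (let Q = free_alg n Quot RY_ideal d n in
     \<lparr>carrier = carrier Q, mult = mult Q, one = one Q, zero = zero Q, add = add Q,
      smult = (\<lambda>c X. RY_class d n (scal c) \<otimes>\<^bsub>Q\<^esub> X)\<rparr>)"


section \<open>The set \<open>C\<^sub>n\<close>\<close>

definition T_down :: "nat \<Rightarrow> nat \<Rightarrow> 'k::field_char_0 free" where
  "T_down k j = prod_list (map gT (rev [j..<k]))"

definition F_mono :: "nat \<Rightarrow> (nat \<Rightarrow> nat) \<Rightarrow> 'k::field_char_0 free" where
  "F_mono r m = prod_list (map (\<lambda>i. gF i ^ m i) [1..<r+1])"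

text \<open>Permutations act on the right, as in \<open>js\<^sub>i\<close>: the leftmost letter of the word acts first.\<close>

definition perm_of_word :: "nat list \<Rightarrow> nat \<Rightarrow> nat" where
  "perm_of_word is = fold (\<lambda>i \<sigma>. Transposition.transpose i (i + 1) \<circ> \<sigma>) is id"

definition reduced_word :: "nat \<Rightarrow> (nat \<Rightarrow> nat) \<Rightarrow> nat list \<Rightarrow> bool" where
  "reduced_word r \<omega> is \<longleftrightarrow> set is \<subseteq> {1..<r} \<and> perm_of_word is = \<omega> \<and>
     (\<forall>js. set js \<subseteq> {1..<r} \<and> perm_of_word js = \<omega> \<longrightarrow> length is \<le> length js)"

text \<open>By the braid relations, the class in \<open>RY\<^bsub>d,n\<^esub>(u)\<close> does not depend on the reduced word.\<close>

definition T_perm :: "nat \<Rightarrow> (nat \<Rightarrow> nat) \<Rightarrow> 'k::field_char_0 free" where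
  "T_perm r \<omega> = prod_list (map gT (SOME is. reduced_word r \<omega> is))"

definition T_set :: "nat set \<Rightarrow> 'k::field_char_0 free" where
  "T_set A = prod_list (map (\<lambda>i. T_down (sorted_list_of_set A ! (i - 1)) i) [1..<card A + 1])"

definition T_set_bar :: "nat \<Rightarrow> nat set \<Rightarrow> 'k::field_char_0 free" where
  "T_set_bar n A =
     prod_list (map (\<lambda>i. T_down (n - card A + i) (sorted_list_of_set A ! (i - 1))) [1..<card A + 1])"

definition C_level :: "nat \<Rightarrow> nat \<Rightarrow> nat \<Rightarrow> 'k::field_char_0 free set set" where
  "C_level d n r =
     (if r = 0 then {RY_class d n (gN ^ n)}
      else {RY_class d n (T_set A * F_mono r m * T_perm r \<omega> * gN ^ (n - r) * T_set_bar n B) |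
              A B m \<omega>. A \<subseteq> {1..n} \<and> B \<subseteq> {1..n} \<and> card A = r \<and> card B = r \<and>
                m \<in> {1..r} \<rightarrow>\<^sub>E {0..<d} \<and> \<omega> permutes {1..r}})"

definition C_set :: "nat \<Rightarrow> nat \<Rightarrow> 'k::field_char_0 free set set" where
  "C_set d n = (\<Union>r\<in>{0..n}. C_level d n r)"


section \<open>The tensor power of \<open>U\<close> and its operators\<close>

text \<open>\<open>V0\<close> is \<open>v\<^sub>0\<close> and \<open>V i s\<close> is \<open>v\<^sub>i\<^sup>s\<close>. Words are tensors of basis vectors.\<close>

datatype ubas = V0 | V nat nat

type_synonym 'k tensor = "ubas list \<Rightarrow>\<^sub>0 'k ratfun"

definition ubasis :: "nat \<Rightarrow> nat \<Rightarrow> ubas set" where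
  "ubasis d n = insert V0 {V i s | i s. i \<in> {1..n} \<and> s \<in> {1..d}}"

text \<open>
  \<open>U\<^bsup>\<otimes>n\<^esup>\<close> as a vector space over \<open>K(u)\<close>, by restriction of scalars from \<open>K(u\<^bsup>1/2\<^esup>)\<close>. The
  \<open>mult\<close> and \<open>one\<close> fields of the record carry no meaning for a module.
\<close>

definition tensor_power :: "nat \<Rightarrow> nat \<Rightarrow> ('k::field_char_0 ratfun, 'k tensor) module" where
  "tensor_power d n =
     \<lparr>carrier = {x. \<forall>w\<in>Poly_Mapping.keys x. length w = n \<and> set w \<subseteq> ubasis d n},
      mult = (\<lambda>x y. 0), one = 0, zero = 0, add = (+),
      smult = (\<lambda>c x. scal (incl c) * x)\<rparr>"

text \<open>
  Endomorphisms of a module. They are taken extensional so that each linear map on the carrier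
  has exactly one representative.
\<close>

definition End_alg :: "('a, 'c) ring_scheme \<Rightarrow> ('a, 'b, 'd) module_scheme \<Rightarrow> ('a, 'b \<Rightarrow> 'b) module" where
  "End_alg R M =
     \<lparr>carrier = LinearCombinations.module_hom R M M \<inter> extensional (carrier M),
      mult = compose (carrier M),
      one = (\<lambda>x\<in>carrier M. x),
      zero = (\<lambda>x\<in>carrier M. \<zero>\<^bsub>M\<^esub>),
      add = (\<lambda>f g. \<lambda>x\<in>carrier M. f x \<oplus>\<^bsub>M\<^esub> g x),
      smult = (\<lambda>c f. \<lambda>x\<in>carrier M. c \<odot>\<^bsub>M\<^esub> f x)\<rparr>"

text \<open>The \<open>K(u\<^bsup>1/2\<^esup>)\<close>-linear map with prescribed values on words.\<close>

definition lin_ext :: "(ubas list \<Rightarrow> 'k::field_char_0 tensor) \<Rightarrow> 'k tensor \<Rightarrow> 'k tensor" where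
  "lin_ext f x = (\<Sum>w\<in>Poly_Mapping.keys x. scal (Poly_Mapping.lookup x w) * f w)"

fun F_eigenvalue :: "'k::field_char_0 \<Rightarrow> ubas \<Rightarrow> 'k ratfun" where
  "F_eigenvalue \<xi> V0 = 1"
| "F_eigenvalue \<xi> (V i s) = Fract [:\<xi> ^ s:] 1"

definition op_F :: "'k::field_char_0 \<Rightarrow> nat \<Rightarrow> 'k tensor \<Rightarrow> 'k tensor" where
  "op_F \<xi> i = lin_ext (\<lambda>w. Poly_Mapping.single w (F_eigenvalue \<xi> (w ! (i - 1))))"

definition eps :: "nat \<Rightarrow> nat \<Rightarrow> 'k::field_char_0 ratfun" where
  "eps d s = (-1) ^ ((d - 1) * s)"

fun T_printed :: "nat \<Rightarrow> ubas \<Rightarrow> ubas \<Rightarrow> 'k::field_char_0 tensor" where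
  "T_printed d (V i s) (V j t) =
     (if s \<noteq> t then Poly_Mapping.single [V j t, V i s] sqrt_u
      else if i = j then Poly_Mapping.single [V i s, V i s] (eps d s * incl uvar)
      else if i > j then Poly_Mapping.single [V j s, V i s] (eps d s * sqrt_u)
      else Poly_Mapping.single [V i s, V j s] (eps d s * (incl uvar - 1)) +
           Poly_Mapping.single [V j s, V i s] (eps d s * sqrt_u))"
| "T_printed d V0 V0 = Poly_Mapping.single [V0, V0] (incl uvar)"
| "T_printed d V0 (V j t) = Poly_Mapping.single [V j t, V0] sqrt_u"
| "T_printed d (V i s) V0 = Poly_Mapping.single [V0, V i s] sqrt_u"

text \<open>
  \<open>T_printed\<close> is the published formula. For \<open>n \<ge> 2\<close> it contradicts the quadratic relation: as
  \<open>\<xi>\<^sup>d = 1\<close>, the idempotent \<open>E\<^sub>i\<close> fixes \<open>v\<^sub>0 \<otimes> v\<^sub>j\<^sup>d\<close>, so \<open>T\<^sup>2\<close> must send this vector to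
  \<open>u (v\<^sub>0 \<otimes> v\<^sub>j\<^sup>d) + (u - 1) T (v\<^sub>0 \<otimes> v\<^sub>j\<^sup>d)\<close>, whereas the formula gives \<open>u (v\<^sub>0 \<otimes> v\<^sub>j\<^sup>d)\<close>.
  All other relations hold. \<open>T_amended\<close> differs only on \<open>v\<^sub>0 \<otimes> v\<^sub>j\<^sup>d\<close>, where it follows the rule
  for \<open>v\<^sub>i\<^sup>d \<otimes> v\<^sub>j\<^sup>d\<close> with \<open>i < j\<close>, reading \<open>v\<^sub>0\<close> as \<open>v\<^sub>0\<^sup>d\<close>; note \<open>\<epsilon>\<^sub>d = 1\<close>.
\<close>

definition T_amended :: "nat \<Rightarrow> ubas \<Rightarrow> ubas \<Rightarrow> 'k::field_char_0 tensor" where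
  "T_amended d x y = T_printed d x y +
     (if x = V0 \<and> (\<exists>j. y = V j d) then Poly_Mapping.single [x, y] (incl uvar - 1) else 0)"

definition op_T :: "(ubas \<Rightarrow> ubas \<Rightarrow> 'k::field_char_0 tensor) \<Rightarrow> nat \<Rightarrow> 'k tensor \<Rightarrow> 'k tensor" where
  "op_T T i = lin_ext (\<lambda>w. Poly_Mapping.single (take (i - 1) w) 1 * T (w ! (i - 1)) (w ! i) *
                           Poly_Mapping.single (drop (i + 1) w) 1)"

definition op_N :: "'k::field_char_0 tensor \<Rightarrow> 'k tensor" where
  "op_N = lin_ext (\<lambda>w. if hd w = V0
     then Poly_Mapping.single (tl w @ [V0]) (sqrt_u ^ length (filter (\<lambda>x. x \<noteq> V0) w)) else 0)"

abbreviation End_tensor :: "nat \<Rightarrow> nat \<Rightarrow> ('k::field_char_0 ratfun, 'k tensor \<Rightarrow> 'k tensor) module" where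
  "End_tensor d n \<equiv> End_alg class_ring (tensor_power d n)"

text \<open>
  \<open>\<rho>\<close> is a homomorphism of \<open>K(u)\<close>-algebras \<open>RY\<^bsub>d,n\<^esub>(u) \<rightarrow> End(U\<^bsup>\<otimes>n\<^esup>)\<close> with the prescribed values
  on the generators, the operators of the \<open>T\<^sub>i\<close> being built from \<open>T\<close>.
\<close>

definition tensor_rep ::
  "nat \<Rightarrow> nat \<Rightarrow> 'k::field_char_0 \<Rightarrow> (ubas \<Rightarrow> ubas \<Rightarrow> 'k tensor) \<Rightarrow>
   ('k free set \<Rightarrow> 'k tensor \<Rightarrow> 'k tensor) \<Rightarrow> bool" where
  "tensor_rep d n \<xi> T \<rho> \<longleftrightarrow>
     \<rho> \<in> Ring.ring_hom (RY d n) (End_tensor d n) \<and>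
     \<rho> \<in> LinearCombinations.module_hom class_ring (RY d n) (End_tensor d n) \<and>
     (\<forall>i\<in>{1..n}. \<rho> (RY_class d n (gF i)) = restrict (op_F \<xi> i) (carrier (tensor_power d n))) \<and>
     (\<forall>i\<in>{1..<n}. \<rho> (RY_class d n (gT i)) = restrict (op_T T i) (carrier (tensor_power d n))) \<and>
     \<rho> (RY_class d n gN) = restrict op_N (carrier (tensor_power d n))"

definition faithful :: "nat \<Rightarrow> nat \<Rightarrow> ('k::field_char_0 free set \<Rightarrow> 'k tensor \<Rightarrow> 'k tensor) \<Rightarrow> bool" where
  "faithful d n \<rho> \<longleftrightarrow> inj_on \<rho> (carrier (RY d n))"

definition primitive_root :: "nat \<Rightarrow> 'k::field_char_0 \<Rightarrow> bool" where
  "primitive_root d \<xi> \<longleftrightarrow> \<xi> ^ d = 1 \<and> (\<forall>k\<in>{1..<d}. \<xi> ^ k \<noteq> 1)"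

end

theory Submission imports Defs "HOL-Algebra.Algebraic_Closure_Type" begin

text \<open>
  Over any field that contains a square root \<open>q\<close> of \<open>u\<close> and \<open>d\<close> distinct \<open>d\<close>th roots of unity, the free
  algebra acts on functions on words of length \<open>n\<close> through the formulas of the tensor representation,
  and the relations act as zero.  Two instances matter: the algebraic closure of \<open>\<K>(u)\<close>, which gives
  linear independence although \<open>\<K>\<close> need not contain roots of unity, and \<open>\<K>(u\<^sup>1\<^sup>/\<^sup>2)\<close> with a given \<open>\<xi>\<close>,
  which gives faithfulness.

  Independence: a combination of \<open>C\<^sub>n\<close> acting as zero is tested on words that carry decreasing indices on a
  set \<open>B\<close> and \<open>v\<^sub>0\<close> elsewhere.  On the largest occurring rank \<open>r\<close>, and there on the colexicographically
  smallest \<open>B\<close>, only terms of the form \<open>T\<^sub>A F\<^sub>m T\<^sub>\<omega> N\<^sup>n\<^sup>-\<^sup>r T\<^sub>B\<close> with this \<open>B\<close> survive, reduced words act by pure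
  permutations of the letters, and the remaining sum over \<open>m\<close> vanishes by a Vandermonde argument.

  Spanning: given independence, it is enough to find some generating family of at most \<open>|C\<^sub>n|\<close> elements.
  The family \<open>T\<^sub>A N\<^sup>k F\<^sub>m T\<^sub>k\<^sub>+\<^sub>1\<^sub>,\<^sub>b\<^sub>1 \<cdots> T\<^sub>n\<^sub>,\<^sub>b\<^sub>r\<close> has this property and avoids Matsumoto's theorem.
\<close>

section \<open>Actions of the free algebra\<close>

text \<open>The model treats \<open>V0\<close> as a letter of colour \<open>d\<close> and index 0.
  Its eigenvalue is then that of colour \<open>d\<close>, which is 1, and one rule covers all pairs
  of letters: different colours are exchanged with factor \<open>q\<close>, equal colours follow the
  Hecke rule for the order of the indices, times a sign. The sign is forced by the factor
  \<open>F_i^((d^2-d)/2)\<close> in the quadratic relation; its square is 1 since \<open>d\<close>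
  divides \<open>d^2 - d\<close>. Decreasing indices matter because the Hecke rule then has no
  diagonal term. Words are total functions with value \<open>V0\<close> outside
  \<open>{1..n}\<close>, so the shift performed by \<open>N\<close> needs no boundary case; the
  relations are verified only at such words, hence the attention paid to locality.

  In the spanning family the factors \<open>T_{k+1,b_1}, ..., T_{n,b_r}\<close> with
  \<open>k = n - r\<close> stand for \<omega> and \<open>B\<close> together: \<open>b_i\<close> runs
  through \<open>n - r + i\<close> values, and the product of these numbers is
  \<open>binom(n,r) r!\<close>. The \<open>b_i\<close> stay unsorted; sorting takes place only on
  the left of \<open>N^k\<close>, where a surplus \<open>T_i\<close> can escape through the power of
  \<open>N\<close>.\<close>

lemma pm_single_split:
  fixes x :: "'x list \<Rightarrow>\<^sub>0 'a::ring_1"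
  shows "x = (\<Sum>l\<in>Poly_Mapping.keys x. Poly_Mapping.single l (Poly_Mapping.lookup x l))"
  by (rule poly_mapping_eqI) (auto simp: lookup_sum lookup_single when_def in_keys_iff)

lemma scal_mult_single [simp]: "scal c * Poly_Mapping.single w (a::'a::semiring_1) = Poly_Mapping.single w (c * a)"
  by (simp add: scal_def mult_single plus_list_def)

lemma single_mult_scal [simp]: "Poly_Mapping.single w (a::'a::semiring_1) * scal c = Poly_Mapping.single w (a * c)"
  by (simp add: scal_def mult_single plus_list_def)

lemma lookup_scal_mult [simp]:
  fixes x :: "'x list \<Rightarrow>\<^sub>0 'a::ring_1"
  shows "Poly_Mapping.lookup (scal c * x) w = c * Poly_Mapping.lookup x w"
proof -
  have "scal c * x = (\<Sum>l\<in>Poly_Mapping.keys x. Poly_Mapping.single l (c * Poly_Mapping.lookup x l))"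
    by (subst (1) pm_single_split[of x]) (simp add: sum_distrib_left)
  then show ?thesis
    by (auto simp: lookup_sum lookup_single when_def in_keys_iff)
qed

text \<open>Scalars of the algebra lie in the source field, functions take values in the target
  field, and \<open>j\<close> translates. Of the operators only linearity over the target field is
  assumed.\<close>

locale gen_action =
  fixes j :: "'a::field \<Rightarrow> 'f::field" and opr :: "'x \<Rightarrow> ('w \<Rightarrow> 'f) \<Rightarrow> ('w \<Rightarrow> 'f)"
  assumes j_add: "j (x + y) = j x + j y" and j_mult: "j (x * y) = j x * j y" and j_1: "j 1 = 1"
    and opr_add: "opr g (\<lambda>w. f w + h w) = (\<lambda>w. opr g f w + opr g h w)"
    and opr_mult: "opr g (\<lambda>w. c * f w) = (\<lambda>w. c * opr g f w)"
begin

lemma j_0: "j 0 = 0" using j_add[of 0 0] by (metis add.right_neutral add_left_cancel)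
lemma j_minus: "j (- x) = - j x" using j_add[of x "-x"] j_0 by (simp add: add_eq_0_iff)
lemma j_diff: "j (x - y) = j x - j y" using j_add[of x "-y"] j_minus by simp
lemma j_pow: "j (x ^ k) = j x ^ k" by (induction k) (auto simp: j_1 j_mult)
lemma j_of_nat: "j (of_nat k) = of_nat k" by (induction k) (auto simp: j_0 j_1 j_add)
lemma j_eq_0: "j x = 0 \<longleftrightarrow> x = 0"
  using j_mult[of x "inverse x"] j_0 j_1 by (cases "x = 0") auto
lemma j_inverse: "j (inverse x) = inverse (j x)"
  using j_mult[of x "inverse x"] j_0 j_1 j_eq_0[of x]
  by (cases "x = 0") (auto simp: field_simps nonzero_eq_divide_eq)

text \<open>\<open>foldr\<close> lets the rightmost letter act first, so that concatenation of words
  becomes composition of operators.\<close>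

definition actw :: "'x list \<Rightarrow> ('w \<Rightarrow> 'f) \<Rightarrow> ('w \<Rightarrow> 'f)" where
  "actw l = foldr opr l"

definition act :: "('x list \<Rightarrow>\<^sub>0 'a) \<Rightarrow> ('w \<Rightarrow> 'f) \<Rightarrow> ('w \<Rightarrow> 'f)" where
  "act x f = (\<lambda>w. \<Sum>l\<in>Poly_Mapping.keys x. j (Poly_Mapping.lookup x l) * actw l f w)"

lemma actw_add: "actw l (\<lambda>w. f w + h w) = (\<lambda>w. actw l f w + actw l h w)"
  by (induction l arbitrary: f h) (auto simp: actw_def opr_add)
lemma actw_mult: "actw l (\<lambda>w. c * f w) = (\<lambda>w. c * actw l f w)"
  by (induction l arbitrary: f) (auto simp: actw_def opr_mult)
lemma actw_append: "actw (l @ l') f = actw l (actw l' f)"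
  by (simp add: actw_def)
lemma actw_0: "actw l (\<lambda>w. 0) = (\<lambda>w. 0)"
  using actw_mult[of l 0 "\<lambda>w. 0"] by simp
lemma actw_sum: "finite A \<Longrightarrow> actw l (\<lambda>w. \<Sum>a\<in>A. f a w) = (\<lambda>w. \<Sum>a\<in>A. actw l (f a) w)"
  by (induction A rule: finite_induct) (auto simp: actw_0 actw_add)

lemma act_superset:
  assumes "finite K" "Poly_Mapping.keys x \<subseteq> K"
  shows "act x f w = (\<Sum>l\<in>K. j (Poly_Mapping.lookup x l) * actw l f w)"
  unfolding act_def using assms by (intro sum.mono_neutral_left) (auto simp: in_keys_iff j_0)

lemma act_add: "act (x + y) f = (\<lambda>w. act x f w + act y f w)"
proof
  fix w
  let ?K = "Poly_Mapping.keys x \<union> Poly_Mapping.keys y"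
  have "Poly_Mapping.keys (x + y) \<subseteq> ?K" by (rule Poly_Mapping.keys_add)
  then show "act (x + y) f w = act x f w + act y f w"
    by (subst (1 2 3) act_superset[of ?K])
       (auto simp: lookup_add j_add distrib_right sum.distrib)
qed

lemma act_single: "act (Poly_Mapping.single l c) f = (\<lambda>w. j c * actw l f w)"
  by (rule ext, subst act_superset[of "{l}"]) auto

lemma act_0: "act 0 f = (\<lambda>w. 0)"
  by (simp add: act_def)
lemma act_1: "act 1 f = f"
proof -
  have "act (Poly_Mapping.single [] 1) f = f" by (simp add: act_single j_1 actw_def)
  then show ?thesis by (metis single_one zero_list_def)
qed
lemma act_minus: "act (- x) f = (\<lambda>w. - act x f w)"
  by (simp add: act_def j_minus sum_negf)
lemma act_diff: "act (x - y) f = (\<lambda>w. act x f w - act y f w)"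
  using act_add[of x "- y" f] act_minus[of y f] by simp
lemma act_sum: "act (\<Sum>a\<in>A. x a) f = (\<lambda>w. \<Sum>a\<in>A. act (x a) f w)"
  by (induction A rule: infinite_finite_induct) (auto simp: act_0 act_add)

lemma act_f_add: "act x (\<lambda>w. f w + h w) = (\<lambda>w. act x f w + act x h w)"
  by (simp add: act_def actw_add distrib_left sum.distrib)
lemma act_f_mult: "act x (\<lambda>w. c * f w) = (\<lambda>w. c * act x f w)"
  by (simp add: act_def actw_mult sum_distrib_left mult.left_commute)
lemma act_f_0: "act x (\<lambda>w. 0) = (\<lambda>w. 0)"
  by (simp add: act_def actw_0)

lemma act_single_mult: "act (Poly_Mapping.single l c * y) f = (\<lambda>w. j c * actw l (act y f) w)"
proof -
  have "Poly_Mapping.single l c * y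
      = (\<Sum>l'\<in>Poly_Mapping.keys y. Poly_Mapping.single (l @ l') (c * Poly_Mapping.lookup y l'))"
    by (subst (1) pm_single_split[of y]) (simp add: sum_distrib_left mult_single plus_list_def)
  then have "act (Poly_Mapping.single l c * y) f
      = (\<lambda>w. \<Sum>l'\<in>Poly_Mapping.keys y. j c * (j (Poly_Mapping.lookup y l') * actw l (actw l' f) w))"
    by (simp add: act_sum act_single j_mult actw_append mult.assoc)
  moreover have "actw l (act y f) = (\<lambda>w. \<Sum>l'\<in>Poly_Mapping.keys y. j (Poly_Mapping.lookup y l') * actw l (actw l' f) w)"
    unfolding act_def by (subst actw_sum) (simp_all add: actw_mult)
  ultimately show ?thesis by (simp add: sum_distrib_left)
qed

lemma act_mult: "act (x * y) f = act x (act y f)"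
proof -
  have "x * y = (\<Sum>l\<in>Poly_Mapping.keys x. Poly_Mapping.single l (Poly_Mapping.lookup x l) * y)"
    by (subst (1) pm_single_split[of x]) (simp add: sum_distrib_right)
  then show ?thesis
    by (simp add: act_sum act_single_mult act_def[of x])
qed

lemma act_scal: "act (scal c) f = (\<lambda>w. j c * f w)"
  by (simp add: scal_def act_single actw_def)

lemma act_scal_mult: "act (scal c * x) f = (\<lambda>w. j c * act x f w)"
  by (simp add: act_mult act_scal)

lemma act_pow: "act (x ^ k) = (act x ^^ k)"
  by (induction k) (auto simp: act_1 act_mult)

lemma act_prod_list: "act (prod_list xs) f = foldr act xs f"
  by (induction xs) (auto simp: act_1 act_mult)

end

section \<open>The tensor model\<close>

fun idx :: "ubas \<Rightarrow> nat" where "idx V0 = 0" | "idx (V i s) = i"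

fun col :: "nat \<Rightarrow> ubas \<Rightarrow> nat" where "col d V0 = d" | "col d (V i s) = s"

abbreviation "tp \<equiv> Transposition.transpose"

definition cnt :: "nat \<Rightarrow> (nat \<Rightarrow> ubas) \<Rightarrow> nat" where
  "cnt n w = card {k \<in> {1..n}. w k \<noteq> V0}"

definition words :: "nat \<Rightarrow> nat \<Rightarrow> (nat \<Rightarrow> ubas) set" where
  "words d n = {w. (\<forall>k. k \<notin> {1..n} \<longrightarrow> w k = V0) \<and> (\<forall>k\<in>{1..n}. w k \<in> ubasis d n)}"

locale tmodel_param =
  fixes n d :: nat and q :: "'f::field" and \<chi> :: "nat \<Rightarrow> 'f"
begin

text \<open>For \<open>\<chi> s = \<xi>^s\<close> with a primitive root \<xi> this is the sign
  \<open>eps d s\<close>. The form used here makes sense for any enumeration of the roots of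
  unity.\<close>

definition ep :: "nat \<Rightarrow> 'f" where "ep s = \<chi> s ^ ((d\<^sup>2 - d) div 2)"

text \<open>With the next definition this gives the two-letter operator: \<open>T\<close> sends
  \<open>x y\<close> to \<open>ca x y\<close> times \<open>x y\<close> plus \<open>cb x y\<close>
  times \<open>y x\<close>.\<close>

definition ca :: "ubas \<Rightarrow> ubas \<Rightarrow> 'f" where
  "ca x y = (if col d x \<noteq> col d y then 0 else if x = y then ep (col d x) * q\<^sup>2
     else if idx x < idx y then ep (col d x) * (q\<^sup>2 - 1) else 0)"

definition cb :: "ubas \<Rightarrow> ubas \<Rightarrow> 'f" where
  "cb x y = (if col d x \<noteq> col d y then q else if x = y then 0 else ep (col d x) * q)"

text \<open>\<open>f w\<close> is read as the coefficient of a tensor at the basis word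
  \<open>w\<close>. The coefficient of the image at \<open>w\<close> collects the preimages of
  \<open>w\<close>; this is why \<open>GN\<close> tests the last letter and shifts to the right,
  where the tensor formula tests the first letter and shifts to the left.\<close>

fun opr :: "gen \<Rightarrow> ((nat \<Rightarrow> ubas) \<Rightarrow> 'f) \<Rightarrow> (nat \<Rightarrow> ubas) \<Rightarrow> 'f" where
  "opr (GT i) f w = ca (w i) (w (i + 1)) * f w + cb (w i) (w (i + 1)) * f (w \<circ> tp i (i + 1))"
| "opr (GF i) f w = \<chi> (col d (w i)) * f w"
| "opr GN f w = (if w n = V0 then q ^ cnt n w * f (\<lambda>k. w (k - 1)) else 0)"

lemmas opr_N = opr.simps(3)
declare opr_N [simp del]

end

text \<open>\<open>q\<close> is a square root of \<open>u\<close>, and \<chi> enumerates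
  \<open>d\<close> distinct \<open>d\<close>-th roots of unity so that the root 1 belongs to colour
  \<open>d\<close>, the colour of \<open>V0\<close>.\<close>

locale tmodel = tmodel_param n d q \<chi> for n d q and \<chi> :: "nat \<Rightarrow> 'f::field" +
  fixes j :: "'k::field_char_0 ratfun \<Rightarrow> 'f"
  assumes n1: "1 \<le> n" and d1: "1 \<le> d"
    and j_add': "j (x + y) = j x + j y" and j_mult': "j (x * y) = j x * j y" and j_1': "j 1 = 1"
    and q2: "q\<^sup>2 = j uvar" and q0: "q \<noteq> 0"
    and dn0: "of_nat d \<noteq> (0::'f)"
    and \<chi>_pow: "s \<in> {1..d} \<Longrightarrow> \<chi> s ^ d = 1"
    and \<chi>_inj: "inj_on \<chi> {1..d}" and \<chi>_d: "\<chi> d = 1"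
begin

sublocale gen_action j opr
proof
  fix g f h c
  show "opr g (\<lambda>w. f w + h w) = (\<lambda>w. opr g f w + opr g h w)"
    by (cases g) (auto simp: algebra_simps fun_eq_iff opr_N)
  show "opr g (\<lambda>w. c * f w) = (\<lambda>w. c * opr g f w)"
    by (cases g) (auto simp: algebra_simps fun_eq_iff opr_N)
qed (simp_all add: j_add' j_mult' j_1')

lemma act_gT: "act (gT i) = opr (GT i)"
  by (simp add: gT_def act_single j_1 actw_def fun_eq_iff)
lemma act_gF: "act (gF i) = opr (GF i)"
  by (simp add: gF_def act_single j_1 actw_def fun_eq_iff)
lemma act_gN: "act gN = opr GN"
  by (simp add: gN_def act_single j_1 actw_def fun_eq_iff)

lemma ep_d: "ep d = 1"
  by (simp add: ep_def \<chi>_d)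
lemma ep_sq: assumes "s \<in> {1..d}" shows "ep s * ep s = 1"
proof -
  have "even (d\<^sup>2 - d)" by (simp add: power2_eq_square)
  then have "ep s * ep s = \<chi> s ^ (d\<^sup>2 - d)"
    unfolding ep_def power_add[symmetric] by (metis dvd_div_mult_self mult_2_right)
  also have "d\<^sup>2 - d = d * (d - 1)" by (simp add: power2_eq_square algebra_simps)
  finally show ?thesis using \<chi>_pow[OF assms] by (simp add: power_mult)
qed

lemma wordsD: "w \<in> words d n \<Longrightarrow> col d (w i) \<in> {1..d}"
proof -
  assume w: "w \<in> words d n"
  then have "w i \<in> ubasis d n"
    by (cases "i \<in> {1..n}") (auto simp: words_def, auto simp: ubasis_def)
  then show ?thesis using d1 by (auto simp: ubasis_def)
qed

lemma words_0: "w \<in> words d n \<Longrightarrow> k \<notin> {1..n} \<Longrightarrow> w k = V0"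
  by (auto simp: words_def)

text \<open>The letters \<open>V a s\<close> of a word have index at least 1, so index 0 singles out
  \<open>V0\<close> although \<open>V0\<close> shares its colour \<open>d\<close> with other
  letters.\<close>

lemma words_inj: "\<lbrakk>w \<in> words d n; v \<in> words d n; col d (w i) = col d (v k); idx (w i) = idx (v k)\<rbrakk> \<Longrightarrow> w i = v k"
proof -
  have *: "w i = V0 \<or> (\<exists>a s. w i = V a s \<and> a \<ge> 1)" if "w \<in> words d n" for w i
    using that by (cases "i \<in> {1..n}") (auto simp: words_def ubasis_def)
  assume a: "w \<in> words d n" "v \<in> words d n" "col d (w i) = col d (v k)" "idx (w i) = idx (v k)"
  show ?thesis
    using a(3,4) *[OF a(1), of i] *[OF a(2), of k] by auto
qed

lemma tp_notin: "i \<in> {1..<n} \<Longrightarrow> k \<notin> {1..n} \<Longrightarrow> tp i (i + 1) k = k"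
  by (auto simp: transpose_def)
lemma tp_in: "i \<in> {1..<n} \<Longrightarrow> k \<in> {1..n} \<Longrightarrow> tp i (i + 1) k \<in> {1..n}"
  by (auto simp: transpose_def)

lemma words_swap: "w \<in> words d n \<Longrightarrow> i \<in> {1..<n} \<Longrightarrow> w \<circ> tp i (i + 1) \<in> words d n"
  using tp_notin[of i] tp_in[of i] by (auto simp: words_def simp del: atLeastAtMost_iff)

lemma words_shift:
  assumes "w \<in> words d n" "w n = V0" shows "(\<lambda>k. w (k - 1)) \<in> words d n"
proof -
  have "w (k - 1) = V0" if "k \<notin> {1..n}" for k
  proof (cases "k - 1 = n")
    case False
    then have "k - 1 \<notin> {1..n}" using that by auto
    then show ?thesis using words_0[OF assms(1)] by blast
  qed (use assms(2) in simp)
  moreover have "w k \<in> ubasis d n" for k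
    using assms by (cases "k \<in> {1..n}") (auto simp: words_def, auto simp: ubasis_def)
  ultimately show ?thesis unfolding words_def mem_Collect_eq by blast
qed

lemma cnt_swap: "i \<in> {1..<n} \<Longrightarrow> cnt n (w \<circ> tp i (i + 1)) = cnt n w"
proof -
  assume i: "i \<in> {1..<n}"
  have "bij_betw (tp i (i + 1)) {k \<in> {1..n}. (w \<circ> tp i (i + 1)) k \<noteq> V0} {k \<in> {1..n}. w k \<noteq> V0}"
  proof (rule bij_betw_byWitness[where f' = "tp i (i + 1)"])
    show "tp i (i + 1) ` {k \<in> {1..n}. (w \<circ> tp i (i + 1)) k \<noteq> V0} \<subseteq> {k \<in> {1..n}. w k \<noteq> V0}"
      using tp_in[OF i] by (force simp del: atLeastAtMost_iff)
    show "tp i (i + 1) ` {k \<in> {1..n}. w k \<noteq> V0} \<subseteq> {k \<in> {1..n}. (w \<circ> tp i (i + 1)) k \<noteq> V0}"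
      using tp_in[OF i] by (force simp del: atLeastAtMost_iff)
  qed simp_all
  from bij_betw_same_card[OF this] show ?thesis by (simp only: cnt_def)
qed

lemma cnt_shift: "w \<in> words d n \<Longrightarrow> w n = V0 \<Longrightarrow> cnt n (\<lambda>k. w (k - 1)) = cnt n w"
proof -
  assume w: "w \<in> words d n" "w n = V0"
  have "bij_betw Suc {k \<in> {1..n}. w k \<noteq> V0} {k \<in> {1..n}. w (k - 1) \<noteq> V0}"
  proof (rule bij_betw_byWitness[where f' = "\<lambda>k. k - 1"])
    show "Suc ` {k \<in> {1..n}. w k \<noteq> V0} \<subseteq> {k \<in> {1..n}. w (k - 1) \<noteq> V0}"
    proof
      fix m assume "m \<in> Suc ` {k \<in> {1..n}. w k \<noteq> V0}"
      then obtain k where "m = Suc k" "k \<in> {1..n}" "w k \<noteq> V0" by auto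
      moreover have "k \<noteq> n" using calculation w by auto
      ultimately show "m \<in> {k \<in> {1..n}. w (k - 1) \<noteq> V0}" by auto
    qed
    show "(\<lambda>k. k - 1) ` {k \<in> {1..n}. w (k - 1) \<noteq> V0} \<subseteq> {k \<in> {1..n}. w k \<noteq> V0}"
      using words_0[OF w(1), of 0] by (auto simp: Suc_le_eq intro!: gr0I)
  qed (use words_0[OF w(1), of 0] in auto)
  from bij_betw_same_card[OF this] show ?thesis by (simp add: cnt_def)
qed

section \<open>The two-letter operator and its braid identities\<close>

lemma cb_sym: "cb x y = cb y x" by (auto simp: cb_def)

text \<open>The one-colour case of \<open>ca\<close> and \<open>cb\<close>, expressed through the
  indices alone and with an arbitrary sign \<open>e\<close>.\<close>

definition hecke_a :: "'f \<Rightarrow> nat \<Rightarrow> nat \<Rightarrow> 'f" where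
  "hecke_a e x y = (if x = y then e * q\<^sup>2 else if x < y then e * (q\<^sup>2 - 1) else 0)"
definition hecke_b :: "'f \<Rightarrow> nat \<Rightarrow> nat \<Rightarrow> 'f" where
  "hecke_b e x y = (if x = y then 0 else e * q)"

text \<open>These compare, in the braid relation, the coefficients at a word, at the word after the
  second swap and at the word after the first swap; the remaining coefficients agree by
  commutativity. Everything is decided by the relative order of \<open>x\<close>, \<open>y\<close>,
  \<open>z\<close>.\<close>

lemma hecke_braid:
  assumes e: "e * e = 1"
  defines "a \<equiv> hecke_a e" and "b \<equiv> hecke_b e"
  shows "a x y * a y z * a x y + b x y * b x y * a x z = a y z * a x y * a y z + b y z * b y z * a x z"
    and "a x y * b y z * a x z = a y z * a x y * b y z + b y z * a x z * a z y"
    and "a x y * a y z * b x y + b x y * a x z * a y x = a y z * b x y * a x z"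
proof -
  have e': "e * (e * x) = x" for x using e by (metis mult.assoc mult_1)
  have ord: "x < y \<or> x = y \<or> y < x" "y < z \<or> y = z \<or> z < y" "x < z \<or> x = z \<or> z < x" by auto
  show "a x y * a y z * a x y + b x y * b x y * a x z = a y z * a x y * a y z + b y z * b y z * a x z"
    using ord by (auto simp: a_def b_def hecke_a_def hecke_b_def algebra_simps power2_eq_square e')
  show "a x y * b y z * a x z = a y z * a x y * b y z + b y z * a x z * a z y"
    using ord by (auto simp: a_def b_def hecke_a_def hecke_b_def algebra_simps power2_eq_square e')
  show "a x y * a y z * b x y + b x y * a x z * a y x = a y z * b x y * a x z"
    using ord by (auto simp: a_def b_def hecke_a_def hecke_b_def algebra_simps power2_eq_square e')
qed

text \<open>If all three colours agree, the Hecke case applies to the indices. Otherwise at most one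
  pair of letters shares a colour, so most diagonal coefficients vanish and the identities become
  trivial.\<close>

lemma braid_coeffs:
  assumes "col d x \<in> {1..d}" "col d y \<in> {1..d}" "col d z \<in> {1..d}"
    "col d x = col d y \<Longrightarrow> idx x = idx y \<Longrightarrow> x = y"
    "col d x = col d z \<Longrightarrow> idx x = idx z \<Longrightarrow> x = z"
    "col d y = col d z \<Longrightarrow> idx y = idx z \<Longrightarrow> y = z"
  shows "ca x y * ca y z * ca x y + cb x y * cb x y * ca x z = ca y z * ca x y * ca y z + cb y z * cb y z * ca x z" (is ?A)
    and "ca x y * cb y z * ca x z = ca y z * ca x y * cb y z + cb y z * ca x z * ca z y" (is ?B)
    and "ca x y * ca y z * cb x y + cb x y * ca x z * ca y x = ca y z * cb x y * ca x z" (is ?C)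
proof -
  have e: "ep (col d x) * ep (col d x) = 1" "ep (col d y) * ep (col d y) = 1" using assms ep_sq by auto
  consider "col d x = col d y" "col d y = col d z" | "col d x = col d y" "col d y \<noteq> col d z"
    | "col d x \<noteq> col d y" "col d y = col d z" | "col d x \<noteq> col d y" "col d x = col d z"
    | "col d x \<noteq> col d y" "col d y \<noteq> col d z" "col d x \<noteq> col d z" by blast
  then have "?A \<and> ?B \<and> ?C"
  proof cases
    case 1
    define e where "e = ep (col d x)"
    have ee: "e * e = 1" "ep (col d x) = e" "ep (col d y) = e" "ep (col d z) = e"
      using assms ep_sq 1 by (auto simp: e_def)
    have eq: "x = y \<longleftrightarrow> idx x = idx y" "y = x \<longleftrightarrow> idx y = idx x" "x = z \<longleftrightarrow> idx x = idx z"
       "y = z \<longleftrightarrow> idx y = idx z" "z = y \<longleftrightarrow> idx z = idx y"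
      using assms(4-6) 1 by metis+
    have c: "ca x y = hecke_a e (idx x) (idx y)" "ca y x = hecke_a e (idx y) (idx x)"
      "ca y z = hecke_a e (idx y) (idx z)" "ca z y = hecke_a e (idx z) (idx y)"
      "ca x z = hecke_a e (idx x) (idx z)" "cb x y = hecke_b e (idx x) (idx y)"
      "cb y z = hecke_b e (idx y) (idx z)"
      using 1 ee by (auto simp: ca_def cb_def hecke_a_def hecke_b_def eq simp del: ee(1))
    show ?thesis
      unfolding c using hecke_braid[OF ee(1)] by blast
  qed (use e in \<open>auto simp: ca_def cb_def algebra_simps\<close>)
  then show ?A ?B ?C by blast+
qed

text \<open>The relations are shown to vanish only at genuine words. Locality ensures that an
  element applied to a function vanishing at all words again gives such a function.\<close>

lemma opr_local:
  assumes "g \<in> gens n" "\<And>v. v \<in> words d n \<Longrightarrow> f v = h v" "w \<in> words d n"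
  shows "opr g f w = opr g h w"
  using assms words_swap[OF assms(3)] words_shift[OF assms(3)]
  by (cases g) (auto simp: gens_def opr_N)

lemma actw_local:
  assumes "l \<in> lists (gens n)" "\<And>v. v \<in> words d n \<Longrightarrow> f v = h v" "w \<in> words d n"
  shows "actw l f w = actw l h w"
  using assms(1,3)
proof (induction l arbitrary: w)
  case Nil then show ?case using assms(2) by (simp add: actw_def)
next
  case (Cons g l)
  then have gl: "g \<in> gens n" "l \<in> lists (gens n)" by auto
  have "opr g (actw l f) w = opr g (actw l h) w"
    by (rule opr_local[OF gl(1) Cons.IH Cons.prems])
  then show ?case by (simp add: actw_def)
qed

lemma act_local:
  assumes "Poly_Mapping.keys x \<subseteq> lists (gens n)" "\<And>v. v \<in> words d n \<Longrightarrow> f v = h v" "w \<in> words d n"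
  shows "act x f w = act x h w"
  unfolding act_def
proof (rule sum.cong)
  fix l assume "l \<in> Poly_Mapping.keys x"
  then have l: "l \<in> lists (gens n)" using assms(1) by blast
  show "j (Poly_Mapping.lookup x l) * actw l f w = j (Poly_Mapping.lookup x l) * actw l h w"
    using actw_local[OF l assms(2) assms(3)] by simp
qed simp

lemma words_col_idx:
  "w \<in> words d n \<Longrightarrow> col d (w i) = col d (w k) \<Longrightarrow> idx (w i) = idx (w k) \<Longrightarrow> w i = w k"
  using words_inj by blast

section \<open>Verification of the defining relations\<close>

lemma tp_braid: "w \<circ> tp i (i + 1) \<circ> tp (i + 1) (i + 2) \<circ> tp i (i + 1)
    = w \<circ> tp (i + 1) (i + 2) \<circ> tp i (i + 1) \<circ> tp (i + 1) (i + (2::nat))"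
  by (auto simp: fun_eq_iff transpose_def)

text \<open>Both sides are expanded over the six rearrangements of \<open>w\<close> by the swaps
  \<open>s\<close> and \<open>t\<close>; the longest ones coincide because
  \<open>s t s = t s t\<close>, and \<open>braid_coeffs\<close> settles the others that differ in
  form.\<close>

lemma rel_braid:
  assumes w: "w \<in> words d n"
  shows "opr (GT i) (opr (GT (i + 1)) (opr (GT i) f)) w = opr (GT (i + 1)) (opr (GT i) (opr (GT (i + 1)) f)) w"
proof -
  define x y z where "x = w i" and "y = w (i + 1)" and "z = w (i + 2)"
  define s t where "s = tp i (i + 1)" and "t = tp (i + 1) (i + 2)"
  have st: "s i = i + 1" "s (i + 1) = i" "s (i + 2) = i + 2" "t i = i" "t (i + 1) = i + 2" "t (i + 2) = i + 1"
    by (auto simp: s_def t_def transpose_def)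
  have inv: "w \<circ> s \<circ> s = w" "w \<circ> t \<circ> t = w" for w :: "nat \<Rightarrow> ubas"
    by (auto simp: s_def t_def fun_eq_iff)
  have sts: "w \<circ> s \<circ> t \<circ> s = w \<circ> t \<circ> s \<circ> t"
    unfolding s_def t_def by (rule tp_braid)
  have T1: "opr (GT i) h v = ca (v i) (v (i + 1)) * h v + cb (v i) (v (i + 1)) * h (v \<circ> s)" for h v
    by (simp add: s_def)
  have T2: "opr (GT (i + 1)) h v = ca (v (i + 1)) (v (i + 2)) * h v + cb (v (i + 1)) (v (i + 2)) * h (v \<circ> t)" for h v
    by (simp add: t_def)
  note A = braid_coeffs[of x y z, OF wordsD[OF w, of i, folded x_def] wordsD[OF w, of "i + 1", folded y_def]
     wordsD[OF w, of "i + 2", folded z_def]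
     words_col_idx[OF w, of i "i + 1", folded x_def y_def]
     words_col_idx[OF w, of i "i + 2", folded x_def z_def]
     words_col_idx[OF w, of "i + 1" "i + 2", folded y_def z_def]]
  have "opr (GT i) (opr (GT (i + 1)) (opr (GT i) f)) w =
     (ca x y * ca y z * ca x y + cb x y * cb x y * ca x z) * f w
   + (ca x y * cb y z * ca x z) * f (w \<circ> t) + (ca x y * ca y z * cb x y + cb x y * ca x z * ca y x) * f (w \<circ> s)
   + cb x y * cb x z * ca y z * f (w \<circ> s \<circ> t) + ca x y * cb y z * cb x z * f (w \<circ> t \<circ> s)
   + cb x y * cb x z * cb y z * f (w \<circ> s \<circ> t \<circ> s)"
    unfolding T1 T2 o_apply st x_def[symmetric] y_def[symmetric] z_def[symmetric] inv
    by (simp add: algebra_simps cb_sym[of y x])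
  also have "\<dots> = (ca y z * ca x y * ca y z + cb y z * cb y z * ca x z) * f w
   + (ca y z * ca x y * cb y z + cb y z * ca x z * ca z y) * f (w \<circ> t) + (ca y z * cb x y * ca x z) * f (w \<circ> s)
   + cb x y * cb x z * ca y z * f (w \<circ> s \<circ> t) + ca x y * cb y z * cb x z * f (w \<circ> t \<circ> s)
   + cb x y * cb x z * cb y z * f (w \<circ> t \<circ> s \<circ> t)"
    by (simp only: A sts)
  also have "\<dots> = opr (GT (i + 1)) (opr (GT i) (opr (GT (i + 1)) f)) w"
    unfolding T1 T2 o_apply st x_def[symmetric] y_def[symmetric] z_def[symmetric] inv
    by (simp add: algebra_simps cb_sym[of z y])
  finally show ?thesis .
qed

lemma rel_T_comm:
  assumes "k > i + 1"
  shows "opr (GT i) (opr (GT k) f) w = opr (GT k) (opr (GT i) f) w"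
proof -
  have c: "w \<circ> tp i (i + 1) \<circ> tp k (k + 1) = w \<circ> tp k (k + 1) \<circ> tp i (i + 1)"
    using assms by (auto simp: fun_eq_iff transpose_def)
  have "tp i (Suc i) k = k" "tp i (Suc i) (Suc k) = Suc k" "tp k (Suc k) i = i" "tp k (Suc k) (Suc i) = Suc i"
    using assms by (auto simp: transpose_def)
  then show ?thesis
    using c by (simp add: algebra_simps)
qed

lemma act_F_pow: "act (gF i ^ k) f w = \<chi> (col d (w i)) ^ k * f w"
  by (induction k arbitrary: f) (auto simp: act_1 act_mult act_gF)

text \<open>Orthogonality of the roots of unity: reading \<open>\<chi> t ^ (d - k)\<close> as an
  inverse power turns the sum into a geometric one, whose ratio \<open>\<chi> s / \<chi> t\<close>
  is a \<open>d\<close>-th root of unity.\<close>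

lemma geom:
  assumes "s \<in> {1..d}" "t \<in> {1..d}"
  shows "(\<Sum>k<d. \<chi> s ^ k * \<chi> t ^ (d - k)) = (if s = t then of_nat d else 0)"
proof -
  have nz: "\<chi> t \<noteq> 0"
  proof
    assume "\<chi> t = 0"
    then show False using \<chi>_pow[OF assms(2)] d1 by (simp add: power_0_left)
  qed
  have "(\<Sum>k<d. \<chi> s ^ k * \<chi> t ^ (d - k)) = (\<Sum>k<d. (\<chi> s / \<chi> t) ^ k)"
  proof (rule sum.cong)
    fix k assume "k \<in> {..<d}"
    then have "\<chi> t ^ (d - k) * \<chi> t ^ k = \<chi> t ^ d" by (simp add: power_add[symmetric])
    then have e: "\<chi> t ^ (d - k) = 1 / \<chi> t ^ k"
      unfolding \<chi>_pow[OF assms(2)] using nz by (intro eq_divide_imp) simp_all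
    show "\<chi> s ^ k * \<chi> t ^ (d - k) = (\<chi> s / \<chi> t) ^ k" unfolding e power_divide by simp
  qed simp
  also have "\<dots> = (if s = t then of_nat d else 0)"
  proof (cases "s = t")
    case False
    have 1: "\<chi> s / \<chi> t \<noteq> 1"
    proof
      assume "\<chi> s / \<chi> t = 1"
      then have "\<chi> s = \<chi> t" using nz by simp
      then show False using False inj_onD[OF \<chi>_inj _ assms] by blast
    qed
    have 2: "(\<chi> s / \<chi> t) ^ d = 1" unfolding power_divide \<chi>_pow[OF assms(1)] \<chi>_pow[OF assms(2)] by simp
    show ?thesis unfolding sum_gp_strict if_not_P[OF 1] 2 using False by simp
  next
    case True
    show ?thesis using nz unfolding True by simp
  qed
  finally show ?thesis .
qed

lemma act_E:
  assumes w: "w \<in> words d n"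
  shows "act (gE d i) f w = (if col d (w i) = col d (w (i + 1)) then f w else 0)"
proof -
  have jd: "j (1 / of_nat d) = 1 / of_nat d"
    by (simp add: divide_inverse j_mult j_1 j_inverse j_of_nat)
  have "act (gE d i) f w = j (1 / of_nat d) * ((\<Sum>k<d. \<chi> (col d (w i)) ^ k * \<chi> (col d (w (i + 1))) ^ (d - k)) * f w)"
    unfolding gE_def act_scal_mult by (simp add: act_sum act_mult act_F_pow sum_distrib_right mult.assoc)
  also have "\<dots> = 1 / of_nat d * ((if col d (w i) = col d (w (i + 1)) then of_nat d else 0) * f w)"
    unfolding geom[OF wordsD[OF w] wordsD[OF w]] jd ..
  also have "\<dots> = (if col d (w i) = col d (w (i + 1)) then f w else 0)"
    using dn0 by simp
  finally show ?thesis .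
qed

text \<open>Where the colours differ, \<open>E_i\<close> kills the last term and two exchanges give
  \<open>q^2\<close>. Where they agree, the operator is a sign times a Hecke operator, and the power
  of \<open>F_i\<close> supplies that same sign.\<close>

lemma rel_quadratic:
  assumes w: "w \<in> words d n"
  shows "act (gT i ^ 2 - (scal uvar + scal (uvar - 1) * gF i ^ ((d\<^sup>2 - d) div 2) * gE d i * gT i)) f w = 0"
proof -
  define x y where "x = w i" and "y = w (i + 1)"
  have q: "j (uvar - 1) = q\<^sup>2 - 1" "j uvar = q\<^sup>2" by (simp_all add: j_diff j_1 q2)
  have inv: "w \<circ> tp i (i + 1) \<circ> tp i (i + 1) = w" by (auto simp: fun_eq_iff)
  have e: "ep (col d x) * ep (col d x) = 1" using ep_sq wordsD[OF w] by (simp add: x_def)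
  have e': "ep (col d x) * (ep (col d x) * z) = z" for z using e by (metis mult.assoc mult_1)
  have e2: "ep (col d y) * ep (col d y) = 1" using ep_sq wordsD[OF w] by (simp add: y_def)
  have e'2: "ep (col d y) * (ep (col d y) * z) = z" for z using e2 by (metis mult.assoc mult_1)
  have xy: "col d x = col d y \<Longrightarrow> idx x = idx y \<Longrightarrow> x = y"
    using words_col_idx[OF w] by (simp add: x_def y_def)
  have h1: "act (gT i ^ 2) f w = (ca x y * ca x y + cb x y * cb x y) * f w
      + (ca x y * cb x y + cb x y * ca y x) * f (w \<circ> tp i (i + 1))"
    using inv by (simp add: act_mult act_gT power2_eq_square x_def y_def algebra_simps cb_sym[of "w (Suc i)" "w i"])
  have h2: "act (scal (uvar - 1) * gF i ^ ((d\<^sup>2 - d) div 2) * gE d i * gT i) f w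
     = (q\<^sup>2 - 1) * (ep (col d x) * (if col d x = col d y then ca x y * f w + cb x y * f (w \<circ> tp i (i + 1)) else 0))"
    using w by (simp add: act_mult act_scal_mult act_scal act_F_pow q act_E act_gT x_def y_def ep_def)
  have h3: "(ca x y * ca x y + cb x y * cb x y) = q\<^sup>2 + (q\<^sup>2 - 1) * (ep (col d x) * (if col d x = col d y then ca x y else 0))"
    by (auto simp: ca_def cb_def algebra_simps power2_eq_square e'2 e2)
  have h4: "(ca x y * cb x y + cb x y * ca y x) = (q\<^sup>2 - 1) * (ep (col d x) * (if col d x = col d y then cb x y else 0))"
    using xy by (auto simp: ca_def cb_def algebra_simps power2_eq_square e'2 e2)
  have "act (gT i ^ 2 - (scal uvar + scal (uvar - 1) * gF i ^ ((d\<^sup>2 - d) div 2) * gE d i * gT i)) f w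
    = act (gT i ^ 2) f w - (q\<^sup>2 * f w + act (scal (uvar - 1) * gF i ^ ((d\<^sup>2 - d) div 2) * gE d i * gT i) f w)"
    by (simp add: act_diff act_add act_scal q)
  also have "\<dots> = 0"
  proof (cases "col d x = col d y")
    case True
    have lin: "(Q + P * (e * a)) * F + (P * (e * b)) * G - (Q * F + P * (e * (a * F + b * G))) = 0"
      for Q P e a b F G :: 'f by (simp add: algebra_simps)
    show ?thesis by (simp only: h1 h2 h3 h4 if_P[OF True] lin)
  next
    case False
    show ?thesis by (simp only: h1 h2 h3 h4 if_not_P[OF False]) simp
  qed
  finally show ?thesis .
qed

text \<open>The diagonal term of \<open>T\<close> occurs only at equal colours, where the eigenvalue
  of \<open>F\<close> does not change under the swap.\<close>

lemma rel_T_F: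
  shows "opr (GT i) (opr (GF k) f) w = opr (GF (tp i (i + 1) k)) (opr (GT i) f) w"
proof -
  have "ca (w i) (w (i + 1)) * \<chi> (col d (w k)) = ca (w i) (w (i + 1)) * \<chi> (col d (w (tp i (i + 1) k)))"
    by (cases "col d (w i) = col d (w (i + 1))") (auto simp: transpose_def ca_def)
  then have "ca (w i) (w (i + 1)) * (\<chi> (col d (w k)) * f w) = ca (w i) (w (i + 1)) * (\<chi> (col d (w (tp i (i + 1) k))) * f w)"
    by (simp only: mult.assoc[symmetric])
  then show ?thesis by (simp add: algebra_simps)
qed

text \<open>Each shift preserves the number of letters other than \<open>V0\<close>, so the factors
  accumulate to a single power of \<open>q\<close>.\<close>

lemma opr_N_pow:
  assumes "w \<in> words d n" "k \<le> n"
  shows "(opr GN ^^ k) f w = (if \<forall>m\<in>{n-k+1..n}. w m = V0 then q ^ (k * cnt n w) * f (\<lambda>m. w (m - k)) else 0)"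
  using assms
proof (induction k arbitrary: w)
  case 0 then show ?case by simp
next
  case (Suc k)
  show ?case
  proof (cases "w n = V0")
    case True
    let ?v = "\<lambda>m. w (m - 1)"
    have "(opr GN ^^ Suc k) f w = q ^ cnt n w * (opr GN ^^ k) f ?v"
      using True by (simp add: opr_N)
    also have "(opr GN ^^ k) f ?v = (if \<forall>m\<in>{n-k+1..n}. ?v m = V0 then q ^ (k * cnt n w) * f (\<lambda>m. ?v (m - k)) else 0)"
      using Suc.IH[OF words_shift[OF Suc.prems(1) True]] Suc.prems cnt_shift[OF Suc.prems(1) True] by simp
    also have "(\<forall>m\<in>{n-k+1..n}. ?v m = V0) \<longleftrightarrow> (\<forall>m\<in>{n-Suc k+1..n}. w m = V0)"
    proof
      assume *: "\<forall>m\<in>{n-k+1..n}. ?v m = V0"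
      show "\<forall>m\<in>{n-Suc k+1..n}. w m = V0"
      proof
        fix m assume "m \<in> {n - Suc k + 1..n}"
        then show "w m = V0" using *[rule_format, of "m + 1"] True Suc.prems(2) by (cases "m = n") auto
      qed
    next
      assume *: "\<forall>m\<in>{n-Suc k+1..n}. w m = V0"
      show "\<forall>m\<in>{n-k+1..n}. ?v m = V0"
      proof
        fix m assume "m \<in> {n-k+1..n}"
        then have "m - 1 \<in> {n - Suc k + 1..n}" using Suc.prems(2) by auto
        then show "?v m = V0" using * by blast
      qed
    qed
    also have "(\<lambda>m. ?v (m - k)) = (\<lambda>m. w (m - Suc k))" by simp
    finally show ?thesis by (simp add: power_add mult.assoc)
  next
    case False
    then have "\<not> (\<forall>m\<in>{n-Suc k+1..n}. w m = V0)" using Suc.prems n1 by auto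
    then show ?thesis using False by (simp only: funpow.simps o_apply opr_N if_False)
  qed
qed

lemma act_N_pow: "act (gN ^ k) f = (opr GN ^^ k) f"
  by (simp add: act_pow act_gN)

text \<open>The factor gained when a \<open>V0\<close> is carried past the letter
  \<open>x\<close>.\<close>

definition zfac :: "ubas \<Rightarrow> 'f" where "zfac x = (if x = V0 then q\<^sup>2 else q)"

lemma opr_T_zero: "w \<in> words d n \<Longrightarrow> w i = V0 \<Longrightarrow> w (i + 1) = V0 \<Longrightarrow> opr (GT i) f w = q\<^sup>2 * f w"
  by (simp add: ca_def cb_def ep_d)

lemma words_idx: "w \<in> words d n \<Longrightarrow> idx (w k) = 0 \<longleftrightarrow> w k = V0"
  using words_inj[of w w k 0]
  by (cases "k \<in> {1..n}") (auto simp: words_def ubasis_def)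

text \<open>A value produced by \<open>N\<close> is nonzero only at words ending in
  \<open>V0\<close>, and each \<open>T\<close> of the chain pulls this condition one place to the
  left. Only the exchange term survives, except for two adjacent \<open>V0\<close>, where the
  diagonal term has the same effect. A letter of \<open>V\<close> in front of \<open>V0\<close>
  contributes nothing, since \<open>ca\<close> vanishes at decreasing indices.\<close>

lemma word_chain:
  assumes "w \<in> words d n" "1 \<le> m" "m \<le> n"
  shows "foldr opr (map GT [m..<n]) (opr GN f) w
    = (if w m = V0 then (\<Prod>k\<in>{m+1..n}. zfac (w k)) *
         opr GN f (\<lambda>k. if k < m then w k else if k < n then w (k + 1) else V0) else 0)"
  using assms(3,1,2)
proof (induction m arbitrary: w rule: inc_induct)
  case base
  have "w = (\<lambda>k. if k < n then w k else if k < n then w (k + 1) else V0)" if "w n = V0"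
  proof
    fix k show "w k = (if k < n then w k else if k < n then w (k + 1) else V0)"
      using that words_0[OF base(1), of k] by (cases "k = n") auto
  qed
  then show ?case by (auto simp: opr_N)
next
  case (step m)
  let ?h = "foldr opr (map GT [Suc m..<n]) (opr GN f)"
  let ?t = "w \<circ> tp m (m + 1)"
  have m: "m \<in> {1..<n}" using step by auto
  have le: "1 \<le> Suc m" by simp
  note IH1 = step.IH[OF step.prems(1) le] and IH2 = step.IH[OF words_swap[OF step.prems(1) m] le]
  have "[m..<n] = m # [Suc m..<n]" using step by (simp add: upt_conv_Cons)
  then have e: "foldr opr (map GT [m..<n]) (opr GN f) w = ca (w m) (w (m + 1)) * ?h w + cb (w m) (w (m + 1)) * ?h ?t"
    by simp
  show ?case
  proof (cases "w m = V0")
    case False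
    have "?t (Suc m) \<noteq> V0" using False by simp
    then have "?h ?t = 0" by (rule IH2[THEN trans, OF if_not_P])
    moreover have "ca (w m) (w (m + 1)) * ?h w = 0"
      using IH1 False by (auto simp: ca_def)
    ultimately show ?thesis unfolding e using False by simp
  next
    case True
    have split: "{m+1..n} = insert (m+1) {Suc m + 1..n}" using step by auto
    have p: "(\<Prod>k\<in>{Suc m+1..n}. zfac (?t k)) = (\<Prod>k\<in>{Suc m+1..n}. zfac (w k))"
      by (intro prod.cong) (auto simp: transpose_def)
    have w: "(\<lambda>k. if k < Suc m then ?t k else if k < n then ?t (k + 1) else V0)
       = (\<lambda>k. if k < m then w k else if k < n then w (k + 1) else V0)"
      using m by (auto simp: fun_eq_iff transpose_def less_Suc_eq)
    have tz: "?t (Suc m) = V0" using True by simp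
    have t: "?h ?t = (\<Prod>k\<in>{Suc m+1..n}. zfac (w k)) *
         opr GN f (\<lambda>k. if k < m then w k else if k < n then w (k + 1) else V0)"
      by (rule trans[OF IH2 trans[OF if_P[OF tz]]]) (simp only: p w)
    have "ca (w m) (w (m + 1)) * ?h w + cb (w m) (w (m + 1)) * ?h ?t = zfac (w (m + 1)) * ?h ?t"
    proof (cases "w (m + 1) = V0")
      case T: True
      then have "?t = w" using True by (auto simp: fun_eq_iff transpose_def)
      then show ?thesis using T True by (simp add: zfac_def ca_def cb_def ep_d)
    next
      case False
      then show ?thesis using IH1 True
        by (auto simp: zfac_def ca_def cb_def ep_d)
    qed
    then show ?thesis unfolding e t split using True by simp
  qed
qed

text \<open>With \<open>c\<close> letters other than \<open>V0\<close> among the first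
  \<open>n - 1\<close>, the exponents of \<open>q\<close> are \<open>c\<close>, then
  \<open>c\<close> again, and \<open>2 (n - 1 - c)\<close>.\<close>

lemma zfac_prod:
  assumes "w \<in> words d n" "w n = V0"
  shows "q ^ cnt n w * (\<Prod>k\<in>{2..n}. zfac (w (k - 1))) = (q\<^sup>2) ^ (n - 1)"
proof -
  have "(\<Prod>k\<in>{2..n}. zfac (w (k - 1))) = (\<Prod>k\<in>{1..<n}. zfac (w k))"
    by (rule prod.reindex_bij_witness[of _ Suc "\<lambda>k. k - 1"]) auto
  also have "\<dots> = (\<Prod>k\<in>{k\<in>{1..<n}. w k = V0}. q\<^sup>2) * (\<Prod>k\<in>{k\<in>{1..<n}. w k \<noteq> V0}. q)"
    unfolding zfac_def by (subst prod.If_cases) (auto intro!: arg_cong2[where f = "(*)"] arg_cong2[where f = "(^)"] arg_cong[of _ _ card])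
  also have "\<dots> = (q\<^sup>2) ^ card {k\<in>{1..<n}. w k = V0} * q ^ card {k\<in>{1..<n}. w k \<noteq> V0}" by simp
  also have "{k\<in>{1..<n}. w k \<noteq> V0} = {k\<in>{1..n}. w k \<noteq> V0}"
    using assms(2) by (auto simp: order.order_iff_strict)
  finally have "q ^ cnt n w * (\<Prod>k\<in>{2..n}. zfac (w (k - 1)))
     = (q\<^sup>2) ^ (card {k\<in>{1..<n}. w k = V0} + cnt n w)"
    by (simp add: cnt_def power_add power2_eq_square power_mult_distrib mult_ac)
  moreover have "cnt n w = card {k\<in>{1..<n}. w k \<noteq> V0}"
    unfolding cnt_def using assms(2) by (intro arg_cong[of _ _ card]) (auto simp: order.order_iff_strict)
  moreover have "card {k\<in>{1..<n}. w k = V0} + card {k\<in>{1..<n}. w k \<noteq> V0} = card {1..<n}"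
    by (subst card_Un_disjoint[symmetric]) (auto intro!: arg_cong[of _ _ card] simp del: card_atLeastLessThan)
  ultimately show ?thesis by simp
qed

lemma rel_NTN:
  assumes w: "w \<in> words d n"
  shows "opr GN (foldr opr (map GT [1..<n]) (opr GN f)) w = (q\<^sup>2) ^ (n - 1) * opr GN f w"
proof (cases "w n = V0")
  case True
  let ?v = "\<lambda>k. w (k - 1)"
  have v1: "?v 1 = V0" using words_0[OF w] by simp
  \<comment> \<open>Deleting the leading \<open>V0\<close> of the shifted word and appending
    \<open>V0\<close> at the end restores \<open>w\<close>.\<close>
  have e: "(\<lambda>k. if k < 1 then ?v k else if k < n then ?v (k + 1) else V0) = w"
  proof
    fix k show "(if k < 1 then ?v k else if k < n then ?v (k + 1) else V0) = w k"
      using words_0[OF w, of k] True by (cases "k = n") auto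
  qed
  have "opr GN (foldr opr (map GT [1..<n]) (opr GN f)) w
      = q ^ cnt n w * ((\<Prod>k\<in>{1+1..n}. zfac (?v k)) * opr GN f w)"
    using True word_chain[OF words_shift[OF w True], of 1 f] n1 v1 unfolding e by (subst opr_N) auto
  also have "\<dots> = (q\<^sup>2) ^ (n - 1) * opr GN f w"
    using zfac_prod[OF w True] by (simp add: numeral_2_eq_2 mult.assoc[symmetric])
  finally show ?thesis .
qed (simp add: opr_N)

lemma rel_Npow_T:
  assumes w: "w \<in> words d n" and i: "i \<in> {1..<n}"
  shows "(opr GN ^^ (i + 1)) (opr (GT i) f) w = q\<^sup>2 * (opr GN ^^ (i + 1)) f w"
proof -
  have "i + 1 \<le> n" using i by auto
  note N = opr_N_pow[OF w this]
  \<comment> \<open>Positions \<open>i\<close> and \<open>i + 1\<close> of the shifted word both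
    read \<open>w 0\<close>, which is \<open>V0\<close>.\<close>
  have "opr (GT i) f (\<lambda>m. w (m - (i + 1))) = q\<^sup>2 * f (\<lambda>m. w (m - (i + 1)))"
    using words_0[OF w, of 0] by (simp add: ca_def cb_def ep_d)
  then show ?thesis unfolding N by simp
qed

text \<open>The power \<open>n - i + 1\<close> of \<open>N\<close> requires \<open>V0\<close> in the
  positions \<open>i, ..., n\<close>. This condition is invariant under the swap at
  \<open>i\<close>, so either both terms of \<open>T_i\<close> vanish or \<open>T_i\<close> meets
  two letters \<open>V0\<close>.\<close>

lemma rel_T_Npow:
  assumes w: "w \<in> words d n" and i: "i \<in> {1..<n}"
  shows "opr (GT i) ((opr GN ^^ (n - i + 1)) f) w = q\<^sup>2 * (opr GN ^^ (n - i + 1)) f w"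
proof -
  have le: "n - i + 1 \<le> n" using i by auto
  show ?thesis
  proof (cases "w i = V0 \<and> w (i + 1) = V0")
    case True
    then show ?thesis using opr_T_zero[OF w] by blast
  next
    case False
    have "\<not> (\<forall>m\<in>{n-(n-i+1)+1..n}. w m = V0)" using False i
      by (auto simp: Suc_diff_Suc dest!: bspec[of _ _ i] bspec[of _ _ "i+1"])
    then have a: "(opr GN ^^ (n - i + 1)) f w = 0" unfolding opr_N_pow[OF w le, of f] by (rule if_not_P)
    have "\<not> (\<forall>m\<in>{n-(n-i+1)+1..n}. (w \<circ> tp i (i + 1)) m = V0)"
    proof
      assume *: "\<forall>m\<in>{n-(n-i+1)+1..n}. (w \<circ> tp i (i + 1)) m = V0"
      show False using *[rule_format, of i] *[rule_format, of "i + 1"] False i by auto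
    qed
    then have b: "(opr GN ^^ (n - i + 1)) f (w \<circ> tp i (i + 1)) = 0"
      unfolding opr_N_pow[OF words_swap[OF w i] le, of f] by (rule if_not_P)
    show ?thesis unfolding opr.simps(1) a b by simp
  qed
qed

lemma rel_T_N:
  assumes w: "w \<in> words d n" and i: "i \<in> {1..<n}" "i + 1 \<in> {1..<n}"
  shows "opr (GT i) (opr GN f) w = opr GN (opr (GT (i + 1)) f) w"
proof -
  have a: "(w \<circ> tp i (i + 1)) n = w n" using i by (auto simp: transpose_def)
  have b: "(\<lambda>k. (w \<circ> tp i (i + 1)) (k - 1)) = (\<lambda>k. w (k - 1)) \<circ> tp (i + 1) (i + 1 + 1)"
  proof
    fix k show "(w \<circ> tp i (i + 1)) (k - 1) = ((\<lambda>k. w (k - 1)) \<circ> tp (i + 1) (i + 1 + 1)) k"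
    proof (cases k)
      case 0 then show ?thesis using i by (simp add: transpose_def)
    next
      case (Suc m)
      have "tp (i + 1) (i + 1 + 1) (Suc m) = Suc (tp i (i + 1) m)" by (auto simp: transpose_def)
      then show ?thesis using Suc by simp
    qed
  qed
  show ?thesis
  proof (cases "w n = V0")
    case True
    let ?v = "\<lambda>k. w (k - 1)"
    have 1: "opr GN f w = q ^ cnt n w * f ?v" "opr GN (opr (GT (i + 1)) f) w = q ^ cnt n w * opr (GT (i + 1)) f ?v"
      using True by (simp_all add: opr_N)
    have 2: "opr GN f (w \<circ> tp i (i + 1)) = q ^ cnt n w * f (?v \<circ> tp (i + 1) (i + 1 + 1))"
      using True a cnt_swap[OF i(1), of w] b by (simp only: opr_N if_True simp_thms)
    have "opr (GT i) (opr GN f) w = ca (w i) (w (i + 1)) * opr GN f w + cb (w i) (w (i + 1)) * opr GN f (w \<circ> tp i (i + 1))"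
      by (rule opr.simps(1))
    also have "\<dots> = q ^ cnt n w * opr (GT (i + 1)) f ?v"
      by (simp only: 1 2 opr.simps(1) distrib_left mult.left_commute add_diff_cancel_right')
    finally show ?thesis unfolding 1 .
  next
    case False
    then have na: "(w \<circ> tp i (i + 1)) n \<noteq> V0" unfolding a .
    have 1: "opr GN h w = 0" "opr GN h (w \<circ> tp i (i + 1)) = 0" for h
      unfolding opr_N if_not_P[OF False] if_not_P[OF na] by (rule refl)+
    show ?thesis by (simp only: opr.simps(1) 1 mult_zero_right add_0)
  qed
qed

lemma relators_act:
  assumes "x \<in> relators d n" "w \<in> words d n"
  shows "act x f w = 0"
  using assms(1)
proof cases
  case (braid i k)
  have "act x f w = opr (GT i) (opr (GT k) (opr (GT i) f)) w - opr (GT k) (opr (GT i) (opr (GT k) f)) w"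
    by (simp only: braid(1) act_diff act_mult act_gT)
  also have "\<dots> = 0"
    using braid(4)
  proof
    assume k: "k = i + 1"
    show ?thesis unfolding k rel_braid[OF assms(2), of i f] by (rule diff_self)
  next
    assume k: "i = k + 1"
    show ?thesis unfolding k rel_braid[OF assms(2), of k f] by (rule diff_self)
  qed
  finally show ?thesis .
next
  case (T_comm i k)
  have "act x f w = opr (GT i) (opr (GT k) f) w - opr (GT k) (opr (GT i) f) w"
    by (simp only: T_comm(1) act_diff act_mult act_gT)
  also have "\<dots> = 0"
    using T_comm(4)
  proof
    assume k: "k > i + 1"
    show ?thesis unfolding rel_T_comm[OF k, of f w] by (rule diff_self)
  next
    assume k: "i > k + 1"
    show ?thesis unfolding rel_T_comm[OF k, of f w] by (rule diff_self)
  qed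
  finally show ?thesis .
next
  case (F_order i)
  then show ?thesis
    using \<chi>_pow[OF wordsD[OF assms(2)]] by (simp add: act_diff act_F_pow act_1)
next
  case (quadratic i)
  then show ?thesis using rel_quadratic[OF assms(2)] by simp
next
  case (T_F i k)
  then show ?thesis
    by (simp only: T_F(1) act_diff act_mult act_gT act_gF rel_T_F diff_self)
next
  case (F_N i)
  then show ?thesis by (simp add: act_diff act_mult act_gN act_gF opr_N)
next
  case N_F1
  then show ?thesis using words_0[OF assms(2), of 0]
    by (simp add: act_diff act_mult act_gN act_gF opr_N \<chi>_d)
next
  case Fn_N
  then show ?thesis
    by (simp add: act_diff act_mult act_gN act_gF opr_N \<chi>_d)
next
  case (Npow_T i)
  then show ?thesis using rel_Npow_T[OF assms(2)]
    by (simp only: act_diff act_mult act_N_pow act_gT act_scal q2[symmetric] diff_self)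
next
  case (T_Npow i)
  then show ?thesis using rel_T_Npow[OF assms(2)]
    by (simp only: act_diff act_mult act_N_pow act_gT act_scal q2[symmetric] diff_self)
next
  case (T_N i)
  then show ?thesis using rel_T_N[OF assms(2)]
    by (simp only: act_diff act_mult act_gN act_gT diff_self)
next
  case N_T_N
  have "foldr act (map gT l) h = foldr opr (map GT l) h" for l h
    by (induction l) (auto simp: act_gT simp del: opr.simps)
  then show ?thesis using rel_NTN[OF assms(2)]
    by (simp only: N_T_N act_diff act_mult act_gN act_prod_list act_scal j_pow q2[symmetric] diff_self)
next
  case (F_comm i k)
  then show ?thesis by (simp add: act_diff act_mult act_gF)
qed

end

section \<open>Inversions and reduced words\<close>

definition inversions :: "nat \<Rightarrow> (nat \<Rightarrow> nat) \<Rightarrow> (nat \<times> nat) set" where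
  "inversions r f = {(a, b). a \<in> {1..r} \<and> b \<in> {1..r} \<and> a < b \<and> f b < f a}"

lemma finite_inversions: "finite (inversions r f)"
  by (rule finite_subset[of _ "{1..r} \<times> {1..r}"]) (auto simp: inversions_def)

lemma tp_less:
  assumes "a < b" "(a, b) \<noteq> (i, i + 1)"
  shows "tp i (i + 1) a < tp i (i + (1::nat)) b"
proof -
  consider "a = i" | "a = i + 1" | "a \<noteq> i" "a \<noteq> i + 1" by blast
  then show ?thesis
    using assms by cases (auto simp: transpose_def)
qed

text \<open>Applying the transposition to both entries of a pair matches the inversions of
  \<open>f\<close> with those of the composite, apart from the new inversion
  \<open>(i, i + 1)\<close>.\<close>

lemma inversions_swap:
  assumes i: "i \<in> {1..<r}" and lt: "f i < f (i + 1)"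
  shows "card (inversions r (f \<circ> tp i (i + 1))) = Suc (card (inversions r f))"
proof -
  let ?t = "tp i (i + 1)"
  let ?D = "inversions r (f \<circ> ?t)"
  have mem: "(i, i + 1) \<in> ?D" using assms by (auto simp: inversions_def)
  have t: "?t a \<in> {1..r}" if "a \<in> {1..r}" for a using that i by (auto simp: transpose_def)
  have "bij_betw (\<lambda>(a, b). (?t a, ?t b)) (inversions r f) (?D - {(i, i + 1)})"
  proof (rule bij_betw_byWitness[where f' = "\<lambda>(a, b). (?t a, ?t b)"])
    show "(\<lambda>(a, b). (?t a, ?t b)) ` inversions r f \<subseteq> ?D - {(i, i + 1)}"
    proof (clarify)
      fix a b assume ab: "(a, b) \<in> inversions r f"
      then have *: "a \<in> {1..r}" "b \<in> {1..r}" "a < b" "f b < f a" by (auto simp: inversions_def)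
      have ne: "(a, b) \<noteq> (i, i + 1)" using *(4) lt by auto
      have "?t a < ?t b" by (rule tp_less[OF *(3) ne])
      moreover have "(?t a, ?t b) \<noteq> (i, i + 1)"
      proof
        assume "(?t a, ?t b) = (i, i + 1)"
        then have "a = i + 1" "b = i"
          by (metis Pair_inject transpose_apply_first transpose_involutory)
             (metis \<open>(?t a, ?t b) = (i, i + 1)\<close> Pair_inject transpose_apply_second transpose_involutory)
        then show False using *(3) by simp
      qed
      ultimately show "(?t a, ?t b) \<in> ?D - {(i, i + 1)}"
        using t[OF *(1)] t[OF *(2)] *(4) by (simp add: inversions_def del: atLeastAtMost_iff)
    qed
    show "(\<lambda>(a, b). (?t a, ?t b)) ` (?D - {(i, i + 1)}) \<subseteq> inversions r f"
    proof
      fix x assume "x \<in> (\<lambda>(a, b). (?t a, ?t b)) ` (?D - {(i, i + 1)})"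
      then obtain a b where ab: "(a, b) \<in> ?D" "(a, b) \<noteq> (i, i + 1)" "x = (?t a, ?t b)" by auto
      then have *: "a \<in> {1..r}" "b \<in> {1..r}" "a < b" "f (?t b) < f (?t a)" by (auto simp: inversions_def)
      have "?t a < ?t b" by (rule tp_less[OF *(3) ab(2)])
      then show "x \<in> inversions r f"
        unfolding ab(3) using t[OF *(1)] t[OF *(2)] *(4) by (simp add: inversions_def del: atLeastAtMost_iff)
    qed
  qed auto
  then have "card (inversions r f) = card (?D - {(i, i + 1)})" by (rule bij_betw_same_card)
  then show ?thesis
    using mem by (metis card.remove finite_inversions)
qed

lemma inversions_swap_ge:
  assumes i: "i \<in> {1..<r}" and lt: "f (i + 1) < f i"
  shows "card (inversions r f) = Suc (card (inversions r (f \<circ> tp i (i + 1))))"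
proof -
  have "(f \<circ> tp i (i + 1)) i < (f \<circ> tp i (i + 1)) (i + 1)" using lt by simp
  from inversions_swap[OF i this] have "card (inversions r (f \<circ> (tp i (i + 1) \<circ> tp i (i + 1))))
      = Suc (card (inversions r (f \<circ> tp i (i + 1))))" unfolding comp_assoc .
  then show ?thesis unfolding transpose_comp_involutory comp_id .
qed

lemma perm_of_word_Nil [simp]: "perm_of_word [] = id"
  by (simp add: perm_of_word_def)

text \<open>The leftmost letter acts first, hence it is the innermost factor; this agrees with the
  way swaps of positions are composed with words of letters.\<close>

lemma perm_of_word_Cons: "perm_of_word (i # js) = perm_of_word js \<circ> tp i (i + 1)"
proof -
  have "fold (\<lambda>i \<sigma>. tp i (i + 1) \<circ> \<sigma>) js s = fold (\<lambda>i \<sigma>. tp i (i + 1) \<circ> \<sigma>) js id \<circ> s" for s :: "nat \<Rightarrow> nat"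
  proof (induction js arbitrary: s)
    case (Cons a js)
    show ?case
      using Cons[of "tp a (a + 1) \<circ> s"] Cons[of "tp a (a + 1) \<circ> id"] by (simp add: o_assoc)
  qed simp
  from this[of "tp i (i + 1)"] show ?thesis by (simp add: perm_of_word_def)
qed

lemma perm_of_word_permutes: "set js \<subseteq> {1..<r} \<Longrightarrow> perm_of_word js permutes {1..r}"
proof (induction js)
  case (Cons a js)
  have "tp a (a + 1) permutes {1..r}" using Cons.prems by (intro permutes_swap_id) auto
  then show ?case
    unfolding perm_of_word_Cons using Cons by (intro permutes_compose) auto
qed (simp add: permutes_id)

lemma inversions_word: "set js \<subseteq> {1..<r} \<Longrightarrow> card (inversions r (perm_of_word js)) \<le> length js"
proof (induction js)
  case Nil
  have e: "inversions r id = {}" by (auto simp: inversions_def)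
  show ?case unfolding perm_of_word_Nil e by simp
next
  case (Cons a js)
  let ?p = "perm_of_word js"
  have a: "a \<in> {1..<r}" using Cons.prems by simp
  have "inj ?p" using perm_of_word_permutes[of js r] Cons.prems by (auto simp: permutes_inj)
  then have "?p a \<noteq> ?p (a + 1)" by (metis injD n_not_Suc_n Suc_eq_plus1)
  then consider "?p a < ?p (a + 1)" | "?p (a + 1) < ?p a" by linarith
  moreover have l: "card (inversions r ?p) \<le> length js" using Cons by simp
  ultimately show ?case
    unfolding perm_of_word_Cons list.size
    using inversions_swap[OF a, of ?p] inversions_swap_ge[OF a, of ?p] by cases linarith+
qed

text \<open>Removing a descent lowers the number of inversions by one, and a permutation of
  \<open>{1..r}\<close> without descents is increasing, hence the identity.\<close>

lemma ex_word:
  assumes "p permutes {1..r}"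
  shows "\<exists>js. set js \<subseteq> {1..<r} \<and> perm_of_word js = p \<and> length js = card (inversions r p)"
  using assms
proof (induction "card (inversions r p)" arbitrary: p rule: less_induct)
  case less
  show ?case
  proof (cases "\<exists>i\<in>{1..<r}. p (i + 1) < p i")
    case True
    then obtain i where i: "i \<in> {1..<r}" "p (i + 1) < p i" by blast
    let ?p = "p \<circ> tp i (i + 1)"
    have "tp i (i + 1) permutes {1..r}" using i by (intro permutes_swap_id) auto
    then have "?p permutes {1..r}" using less.prems by (rule permutes_compose)
    moreover have c: "card (inversions r p) = Suc (card (inversions r ?p))" by (rule inversions_swap_ge[OF i])
    ultimately obtain js where js: "set js \<subseteq> {1..<r}" "perm_of_word js = ?p" "length js = card (inversions r ?p)"
      using less.hyps[of ?p] by auto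
    have "perm_of_word (i # js) = p" unfolding perm_of_word_Cons js(2) by (simp add: comp_assoc)
    then show ?thesis using js c i by (intro exI[of _ "i # js"]) auto
  next
    case False
    have st: "p i < p (i + 1)" if "i \<in> {1..<r}" for i
    proof -
      have "p i \<noteq> p (i + 1)" using permutes_inj[OF less.prems] by (metis injD n_not_Suc_n Suc_eq_plus1)
      then show ?thesis using False that by (meson linorder_neqE_nat)
    qed
    have mono: "p i < p k" if "i < k" "1 \<le> i" "k \<le> r" for i k
    proof -
      have "Suc i \<le> k" using that by simp
      then show ?thesis using that(3)
      proof (induction k rule: dec_induct)
        case base then show ?case using st[of i] that(2) by simp
      next
        case (step m) then show ?case using st[of m] that(2) by auto
      qed
    qed
    \<comment> \<open>A value below \<open>i\<close> is already taken, by induction. A value above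
      \<open>i\<close> leaves \<open>i\<close> to be attained at a later place, against
      monotonicity.\<close>
    have "p i = i" if "i \<in> {1..r}" for i
      using that
    proof (induction i rule: less_induct)
      case (less i)
      have pi: "p i \<in> {1..r}" using permutes_in_image[OF \<open>p permutes {1..r}\<close>] less.prems by blast
      have inj: "inj p" using \<open>p permutes {1..r}\<close> by (rule permutes_inj)
      have "\<not> p i < i"
      proof
        assume l: "p i < i"
        then have "p (p i) = p i" using less.IH[OF l] pi by simp
        then show False using inj l by (metis injD less_irrefl)
      qed
      moreover have "\<not> i < p i"
      proof
        assume l: "i < p i"
        obtain k where k: "p k = i" "k \<in> {1..r}"
          using \<open>p permutes {1..r}\<close> less.prems by (metis permutes_def permutes_in_image)
        have "k \<noteq> i" using k l by auto
        moreover have "\<not> k < i" using less.IH[of k] k by auto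
        ultimately have "i < k" by simp
        then have "p i < p k" by (rule mono) (use k less.prems in auto)
        then show False using k l by simp
      qed
      ultimately show ?case by simp
    qed
    then have "p = id"
      using permutes_not_in[OF less.prems] by (metis (no_types) eq_id_iff)
    moreover have "inversions r id = {}" by (auto simp: inversions_def)
    ultimately show ?thesis
      by (intro exI[of _ "[]"]) (simp only: perm_of_word_Nil list.size card.empty set_simps empty_subsetI simp_thms)
  qed
qed

text \<open>The chosen word attains the lower bound of \<open>inversions_word\<close>, because some
  word of that length exists. The exact length is what forces every letter of the word to prolong
  the permutation.\<close>

lemma reduced_wordD:
  assumes "p permutes {1..r}"
  defines "js \<equiv> (SOME js. reduced_word r p js)"
  shows "set js \<subseteq> {1..<r}" "perm_of_word js = p" "length js = card (inversions r p)"
proof -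
  obtain ks where ks: "set ks \<subseteq> {1..<r}" "perm_of_word ks = p" "length ks = card (inversions r p)"
    using ex_word[OF assms(1)] by blast
  have "reduced_word r p ks"
    unfolding reduced_word_def using ks inversions_word by metis
  then have red: "reduced_word r p js"
    unfolding js_def by (rule someI)
  then show 1: "set js \<subseteq> {1..<r}" and 2: "perm_of_word js = p"
    by (auto simp: reduced_word_def)
  have "length js \<le> length ks" using red ks by (auto simp: reduced_word_def)
  then show "length js = card (inversions r p)"
    using inversions_word[OF 1] 2 ks(3) by simp
qed

section \<open>Independence of monomials as functions\<close>

text \<open>The \<open>C t\<close> are the coefficients of a polynomial of degree below
  \<open>d\<close> with at least \<open>d\<close> roots.\<close>

lemma poly_vanish:
  fixes C :: "nat \<Rightarrow> 'f::field"
  assumes "finite Z" "d \<le> card Z" "\<And>z. z \<in> Z \<Longrightarrow> (\<Sum>t<d. C t * z ^ t) = 0" "t < d"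
  shows "C t = 0"
proof -
  let ?p = "\<Sum>t<d. Polynomial.monom (C t) t"
  have ev: "poly ?p z = (\<Sum>t<d. C t * z ^ t)" for z by (simp add: poly_sum poly_monom)
  have co: "Polynomial.coeff ?p t = C t" using assms(4) by (simp add: Polynomial.coeff_sum)
  have "?p = 0"
  proof (rule ccontr)
    assume nz: "?p \<noteq> 0"
    have "Polynomial.degree ?p \<le> d - 1"
      by (rule degree_sum_le) (auto intro: order_trans[OF Polynomial.degree_monom_le])
    then have "Polynomial.degree ?p < d" using assms(4) by linarith
    moreover have "card Z \<le> card {z. poly ?p z = 0}"
      using assms(3) ev poly_roots_finite[OF nz] by (intro card_mono) auto
    moreover have "card {z. poly ?p z = 0} \<le> Polynomial.degree ?p" by (rule card_poly_roots_bound[OF nz])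
    ultimately show False using assms(2) by linarith
  qed
  then show ?thesis using co by simp
qed

text \<open>Induction on the set of variables: with the others fixed, the sum is a polynomial in the
  new variable that vanishes on \<open>Z\<close>. Its coefficients are sums of the same kind in
  fewer variables.\<close>

lemma monomials_independent:
  fixes c :: "('i \<Rightarrow> nat) \<Rightarrow> 'f::field"
  assumes "finite I" "finite Z" "d \<le> card Z"
    and "\<And>x. (\<And>i. i \<in> I \<Longrightarrow> x i \<in> Z) \<Longrightarrow> (\<Sum>m\<in>I \<rightarrow>\<^sub>E {0..<d}. c m * (\<Prod>i\<in>I. x i ^ m i)) = 0"
    and "m \<in> I \<rightarrow>\<^sub>E {0..<d}"
  shows "c m = 0"
  using assms(1,4,5)
proof (induction I arbitrary: c m rule: finite_induct)
  case empty
  then show ?case by simp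
next
  case (insert a I)
  have van: "(\<Sum>g\<in>I \<rightarrow>\<^sub>E {0..<d}. c (g(a := t)) * (\<Prod>i\<in>I. x i ^ g i)) = 0"
    if x: "\<And>i. i \<in> I \<Longrightarrow> x i \<in> Z" and t: "t < d" for x t
  proof (rule poly_vanish[of Z d "\<lambda>t. \<Sum>g\<in>I \<rightarrow>\<^sub>E {0..<d}. c (g(a := t)) * (\<Prod>i\<in>I. x i ^ g i)", OF assms(2,3) _ t])
    fix z assume z: "z \<in> Z"
    let ?x = "x(a := z)"
    have inj: "inj_on (\<lambda>(y, g). g(a := y)) ({0..<d} \<times> (I \<rightarrow>\<^sub>E {0..<d}))"
      using inj_combinator[OF insert.hyps(2), of "\<lambda>_. {0..<d}"] by simp
    have "0 = (\<Sum>m\<in>insert a I \<rightarrow>\<^sub>E {0..<d}. c m * (\<Prod>i\<in>insert a I. ?x i ^ m i))"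
      using insert.prems(1)[of ?x] x z by (metis (no_types, lifting) fun_upd_apply insert_iff)
    also have "\<dots> = (\<Sum>(y, g)\<in>{0..<d} \<times> (I \<rightarrow>\<^sub>E {0..<d}). c (g(a := y)) * (\<Prod>i\<in>insert a I. ?x i ^ (g(a := y)) i))"
      unfolding PiE_insert_eq by (subst sum.reindex[OF inj]) (simp add: case_prod_unfold o_def)
    also have "\<dots> = (\<Sum>y<d. \<Sum>g\<in>I \<rightarrow>\<^sub>E {0..<d}. c (g(a := y)) * (\<Prod>i\<in>insert a I. ?x i ^ (g(a := y)) i))"
      by (simp only: sum.cartesian_product[symmetric] lessThan_atLeast0)
    also have "\<dots> = (\<Sum>y<d. (\<Sum>g\<in>I \<rightarrow>\<^sub>E {0..<d}. c (g(a := y)) * (\<Prod>i\<in>I. x i ^ g i)) * z ^ y)"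
    proof (rule sum.cong[OF refl])
      fix y
      have "(\<Prod>i\<in>insert a I. ?x i ^ (g(a := y)) i) = (\<Prod>i\<in>I. x i ^ g i) * z ^ y" for g
      proof -
        have "(\<Prod>i\<in>I. ?x i ^ (g(a := y)) i) = (\<Prod>i\<in>I. x i ^ g i)"
          using insert.hyps(2) by (intro prod.cong) auto
        then show ?thesis using insert.hyps by (simp add: mult.commute)
      qed
      then show "(\<Sum>g\<in>I \<rightarrow>\<^sub>E {0..<d}. c (g(a := y)) * (\<Prod>i\<in>insert a I. ?x i ^ (g(a := y)) i))
        = (\<Sum>g\<in>I \<rightarrow>\<^sub>E {0..<d}. c (g(a := y)) * (\<Prod>i\<in>I. x i ^ g i)) * z ^ y"
        by (simp only: sum_distrib_right mult.assoc)
    qed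
    finally show "(\<Sum>y<d. (\<Sum>g\<in>I \<rightarrow>\<^sub>E {0..<d}. c (g(a := y)) * (\<Prod>i\<in>I. x i ^ g i)) * z ^ y) = 0" by simp
  qed
  obtain t g where tg: "t < d" "g \<in> I \<rightarrow>\<^sub>E {0..<d}" "m = g(a := t)"
    using insert.prems(2) unfolding PiE_insert_eq by auto
  have "c (g(a := t)) = 0"
    by (rule insert.IH[of "\<lambda>g. c (g(a := t))", OF van[OF _ tg(1)] tg(2)])
  then show ?case unfolding tg(3) .
qed

section \<open>Placements of letters\<close>

text \<open>The word of rank \<open>r\<close> with the letter \<open>L i\<close> in position
  \<open>a i\<close> and \<open>V0\<close> elsewhere. The independence proof tests on such words and
  follows them through the factors of an element of \<open>C_n\<close>.\<close>

definition pl :: "nat \<Rightarrow> (nat \<Rightarrow> nat) \<Rightarrow> (nat \<Rightarrow> ubas) \<Rightarrow> nat \<Rightarrow> ubas" where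
  "pl r a L k = (if k \<in> a ` {1..r} then L (the_inv_into {1..r} a k) else V0)"

lemma pl_at: "inj_on a {1..r} \<Longrightarrow> i \<in> {1..r} \<Longrightarrow> pl r a L (a i) = L i"
  by (auto simp: pl_def the_inv_into_f_f simp del: atLeastAtMost_iff)

lemma pl_out: "k \<notin> a ` {1..r} \<Longrightarrow> pl r a L k = V0"
  by (simp add: pl_def)

lemma pl_eqI:
  assumes "inj_on a {1..r}" "\<And>i. i \<in> {1..r} \<Longrightarrow> v (a i) = L i" "\<And>k. k \<notin> a ` {1..r} \<Longrightarrow> v k = V0"
  shows "pl r a L = v"
proof
  fix k show "pl r a L k = v k"
  proof (cases "k \<in> a ` {1..r}")
    case True
    then obtain i where "i \<in> {1..r}" "k = a i" by blast
    then show ?thesis using pl_at[OF assms(1)] assms(2) by simp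
  qed (use assms(3) pl_out in auto)
qed

lemma pl_move:
  assumes "inj_on a {1..r}" "inj_on (a(i := k)) {1..r}" "i \<in> {1..r}"
  shows "pl r (a(i := k)) L = (pl r a L)(a i := V0, k := L i)"
proof (rule pl_eqI[OF assms(2)])
  fix m assume m: "m \<in> {1..r}"
  show "((pl r a L)(a i := V0, k := L i)) ((a(i := k)) m) = L m"
  proof (cases "m = i")
    case False
    have "a m \<noteq> a i" using False m assms(1,3) by (auto dest: inj_onD)
    moreover have "a m \<noteq> k" using inj_onD[OF assms(2), of m i] False m assms(3) by auto
    ultimately show ?thesis using False pl_at[OF assms(1) m] by simp
  qed simp
next
  fix x assume x: "x \<notin> (a(i := k)) ` {1..r}"
  then have "x \<noteq> k" using assms(3) by auto
  moreover have "x \<notin> a ` {1..r}" if "x \<noteq> a i" using x that by force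
  ultimately show "((pl r a L)(a i := V0, k := L i)) x = V0" using pl_out by auto
qed

lemma pl_words:
  assumes "inj_on a {1..r}" "a ` {1..r} \<subseteq> {1..n}" "\<And>i. i \<in> {1..r} \<Longrightarrow> L i \<in> ubasis d n"
  shows "pl r a L \<in> words d n"
proof -
  have "pl r a L k \<in> ubasis d n" for k
  proof (cases "k \<in> a ` {1..r}")
    case True
    then obtain i where "i \<in> {1..r}" "k = a i" by blast
    then show ?thesis using pl_at[OF assms(1)] assms(3) by simp
  next
    case False
    then show ?thesis by (simp add: pl_out ubasis_def)
  qed
  moreover have "pl r a L k = V0" if "k \<notin> {1..n}" for k
    using that assms(2) by (intro pl_out) blast
  ultimately show ?thesis unfolding words_def by blast
qed

lemma pl_cnt:
  assumes "inj_on a {1..r}" "a ` {1..r} \<subseteq> {1..n}" "\<And>i. i \<in> {1..r} \<Longrightarrow> L i \<noteq> V0"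
  shows "cnt n (pl r a L) = r"
proof -
  have "{k \<in> {1..n}. pl r a L k \<noteq> V0} = a ` {1..r}"
  proof (intro equalityI subsetI)
    fix k assume "k \<in> {k \<in> {1..n}. pl r a L k \<noteq> V0}"
    then show "k \<in> a ` {1..r}" using pl_out by blast
  next
    fix k assume k: "k \<in> a ` {1..r}"
    then obtain i where "i \<in> {1..r}" "k = a i" by blast
    then have "pl r a L k \<noteq> V0" using pl_at[OF assms(1)] assms(3) by simp
    then show "k \<in> {k \<in> {1..n}. pl r a L k \<noteq> V0}"
      using subsetD[OF assms(2) k] by blast
  qed
  then show ?thesis using assms(1) by (simp add: cnt_def card_image)
qed

section \<open>The action on basis functions\<close>

text \<open>The coefficient function of the basis tensor \<open>v\<close>.\<close>

definition dl :: "'w \<Rightarrow> 'w \<Rightarrow> 'f::field" where "dl v w = (if w = v then 1 else 0)"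

context tmodel
begin

definition aT :: "nat list \<Rightarrow> ((nat \<Rightarrow> ubas) \<Rightarrow> 'f) \<Rightarrow> (nat \<Rightarrow> ubas) \<Rightarrow> 'f" where
  "aT js f = foldr (\<lambda>i. opr (GT i)) js f"

lemma act_T_word: "act (prod_list (map gT js)) f = aT js f"
  by (induction js) (simp_all add: aT_def act_1 act_mult act_gT del: opr.simps)

lemma aT_Cons: "aT (i # js) f = opr (GT i) (aT js f)" by (simp add: aT_def del: opr.simps)
lemma aT_Nil [simp]: "aT [] f = f" by (simp add: aT_def)
lemma aT_scale: "aT js (\<lambda>w. c * f w) = (\<lambda>w. c * aT js f w)"
  by (simp add: act_T_word[symmetric] act_f_mult)

text \<open>On basis vectors the coefficient formula turns back into the tensor formula; the
  symmetry of \<open>cb\<close> allows the exchange coefficient to be read at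
  \<open>v\<close>.\<close>

lemma opr_T_dl: "opr (GT i) (dl v) = (\<lambda>w. ca (v i) (v (i + 1)) * dl v w + cb (v i) (v (i + 1)) * dl (v \<circ> tp i (i + 1)) w)"
proof
  fix w
  have "w \<circ> tp i (i + 1) = v \<longleftrightarrow> w = v \<circ> tp i (i + 1)"
    by (metis comp_assoc transpose_comp_involutory comp_id)
  then have "dl v (w \<circ> tp i (i + 1)) = (dl (v \<circ> tp i (i + 1)) w :: 'f)" by (simp add: dl_def)
  moreover have "ca (w i) (w (i + 1)) * dl v w = ca (v i) (v (i + 1)) * dl v w" by (simp add: dl_def)
  moreover have "cb (w i) (w (i + 1)) * dl (v \<circ> tp i (i + 1)) w = cb (v i) (v (i + 1)) * dl (v \<circ> tp i (i + 1)) w"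
    using cb_sym by (simp add: dl_def)
  ultimately show "opr (GT i) (dl v) w = ca (v i) (v (i + 1)) * dl v w + cb (v i) (v (i + 1)) * dl (v \<circ> tp i (i + 1)) w"
    by (simp only: opr.simps)
qed

lemma ep_nz: "s \<in> {1..d} \<Longrightarrow> ep s \<noteq> 0"
  using ep_sq[of s] by fastforce

text \<open>At a descent of the indices the diagonal coefficient vanishes whatever the colours are,
  and the exchange coefficient is \<open>q\<close> up to a sign.\<close>

lemma opr_T_pure:
  assumes "v \<in> words d n" "idx (v (i + 1)) < idx (v i)"
  obtains c where "c \<noteq> 0" "opr (GT i) (dl v) = (\<lambda>w. c * dl (v \<circ> tp i (i + 1)) w)"
proof
  show "cb (v i) (v (i + 1)) \<noteq> 0" using assms(2) q0 ep_nz[OF wordsD[OF assms(1), of i]] by (auto simp: cb_def)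
  have "ca (v i) (v (i + 1)) = 0" using assms(2) by (auto simp: ca_def)
  then show "opr (GT i) (dl v) = (\<lambda>w. cb (v i) (v (i + 1)) * dl (v \<circ> tp i (i + 1)) w)"
    unfolding opr_T_dl by simp
qed

lemma opr_T_dl_zero:
  assumes "v i = V0" "v (i + 1) = V0"
  shows "opr (GT i) (dl v) = (\<lambda>w. q\<^sup>2 * dl v w)"
  unfolding opr_T_dl assms by (simp add: ca_def cb_def ep_d)

text \<open>\<open>V0\<close> has the least index, so a letter of \<open>V\<close> followed by
  \<open>V0\<close> is a descent and travels to the right by pure exchanges.\<close>

lemma move_letter:
  assumes "p \<le> k" "k \<le> n" "1 \<le> p" "v \<in> words d n" "v p \<noteq> V0" "\<And>m. p < m \<Longrightarrow> m \<le> k \<Longrightarrow> v m = V0"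
  shows "\<exists>c. c \<noteq> 0 \<and> aT (rev [p..<k]) (dl v) = (\<lambda>w. c * dl (v(p := V0, k := v p)) w) \<and> v(p := V0, k := v p) \<in> words d n"
  using assms(1,2,6)
proof (induction k rule: dec_induct)
  case base
  have "v(p := V0, p := v p) = v" by (simp add: fun_eq_iff)
  then show ?case using assms(4) by (intro exI[of _ 1]) (simp del: fun_upd_apply fun_upd_upd)
next
  case (step k)
  let ?u = "v(p := V0, k := v p)"
  have "k \<le> n" "\<And>m. p < m \<Longrightarrow> m \<le> k \<Longrightarrow> v m = V0" using step.prems by auto
  from step.IH[OF this] obtain c
    where c: "c \<noteq> 0" "aT (rev [p..<k]) (dl v) = (\<lambda>w. c * dl ?u w)" "?u \<in> words d n"
    by blast
  have k1: "?u (k + 1) = V0" using step.prems(2)[of "k + 1"] step by simp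
  have "idx (?u k) \<noteq> 0" using words_idx[OF c(3), of k] assms(5) by simp
  then have lt: "idx (?u (k + 1)) < idx (?u k)" using k1 by simp
  obtain c' where c': "c' \<noteq> 0" "opr (GT k) (dl ?u) = (\<lambda>w. c' * dl (?u \<circ> tp k (k + 1)) w)"
    by (rule opr_T_pure[OF c(3) lt])
  have u: "?u \<circ> tp k (k + 1) = v(p := V0, Suc k := v p)"
  proof
    fix m show "(?u \<circ> tp k (k + 1)) m = (v(p := V0, Suc k := v p)) m"
      using k1 step by (cases "m = k"; cases "m = k + 1") auto
  qed
  have "aT (rev [p..<Suc k]) (dl v) = (\<lambda>w. c * c' * dl (?u \<circ> tp k (k + 1)) w)"
    using step.hyps c(2) c'(2) by (simp add: aT_Cons opr_mult mult.assoc del: opr.simps)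
  moreover have "?u \<circ> tp k (k + 1) \<in> words d n"
    using step assms(3) by (intro words_swap[OF c(3)]) auto
  moreover have "c * c' \<noteq> 0" using c(1) c'(1) by simp
  ultimately show ?case unfolding u by blast
qed

lemma act_T_down: "act (T_down k i) f = aT (rev [i..<k]) f"
  by (simp add: T_down_def act_T_word)

text \<open>The rightmost factor acts first, so the letters move in the order
  \<open>r, r - 1, ..., u + 1\<close>. Each finds its way free: the later letters are already beyond
  its target, the earlier ones are still behind it. The bound \<open>u\<close> makes the statement
  usable for partial products.\<close>

lemma shift_letters:
  fixes src dst :: "nat \<Rightarrow> nat"
  assumes s: "strict_mono_on {1..r} src" and t: "strict_mono_on {1..r} dst"
    and le: "\<And>i. i \<in> {1..r} \<Longrightarrow> 1 \<le> src i \<and> src i \<le> dst i \<and> dst i \<le> n"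
    and L: "\<And>i. i \<in> {1..r} \<Longrightarrow> L i \<in> ubasis d n \<and> L i \<noteq> V0"
    and u: "u \<le> r"
  shows "\<exists>c. c \<noteq> 0 \<and> act (prod_list (map (\<lambda>i. T_down (dst i) (src i)) [u+1..<r+1])) (dl (pl r src L))
     = (\<lambda>w. c * dl (pl r (\<lambda>i. if i \<le> u then src i else dst i) L) w)"
  using u
proof (induction u rule: inc_induct)
  case base
  have "pl r (\<lambda>i. if i \<le> r then src i else dst i) L = pl r src L"
  proof (rule pl_eqI)
    have "strict_mono_on {1..r} (\<lambda>i. if i \<le> r then src i else dst i)" using s by (auto simp: strict_mono_on_def)
    then show "inj_on (\<lambda>i. if i \<le> r then src i else dst i) {1..r}" by (rule strict_mono_on_imp_inj_on)
  next
    fix i assume i: "i \<in> {1..r}"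
    show "pl r src L (if i \<le> r then src i else dst i) = L i"
      using i pl_at[OF strict_mono_on_imp_inj_on[OF s] i] by simp
  next
    fix k assume "k \<notin> (\<lambda>i. if i \<le> r then src i else dst i) ` {1..r}"
    moreover have "(\<lambda>i. if i \<le> r then src i else dst i) ` {1..r} = src ` {1..r}" by (rule image_cong) auto
    ultimately show "pl r src L k = V0" using pl_out by metis
  qed
  then show ?case by (intro exI[of _ 1]) (simp add: act_1)
next
  case (step u)
  define e where "e u = (\<lambda>i. if i \<le> u then src i else dst i)" for u
  have sm: "strict_mono_on {1..r} (e u)" for u
  proof (rule strict_mono_onI)
    fix x y assume xy: "x \<in> {1..r}" "y \<in> {1..r}" "x < y"
    have "src x < src y" "dst x < dst y" using xy s t by (auto simp: strict_mono_on_def)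
    then show "e u x < e u y" using le[OF xy(1)] le[OF xy(2)] xy(3) by (auto simp: e_def)
  qed
  have inj: "inj_on (e u) {1..r}" for u by (rule strict_mono_on_imp_inj_on[OF sm])
  have rng: "e u ` {1..r} \<subseteq> {1..n}" for u
  proof
    fix x assume "x \<in> e u ` {1..r}"
    then obtain i where "i \<in> {1..r}" "x = e u i" by blast
    then show "x \<in> {1..n}" using le[of i] by (auto simp: e_def)
  qed
  obtain c where c: "c \<noteq> 0" "act (prod_list (map (\<lambda>i. T_down (dst i) (src i)) [Suc u+1..<r+1])) (dl (pl r src L))
     = (\<lambda>w. c * dl (pl r (e (Suc u)) L) w)"
    using step.IH unfolding e_def by blast
  let ?i = "Suc u"
  let ?v = "pl r (e ?i) L"
  have i: "?i \<in> {1..r}" using step by simp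
  have v: "?v \<in> words d n" using L by (intro pl_words[OF inj rng]) blast
  have at: "?v (src ?i) = L ?i" using pl_at[OF inj i, of ?i L] by (simp add: e_def)
  have between: "?v m = V0" if "src ?i < m" "m \<le> dst ?i" for m
  proof (rule pl_out, rule notI)
    assume "m \<in> e ?i ` {1..r}"
    then obtain k where k: "k \<in> {1..r}" "m = e ?i k" by blast
    show False
    proof (cases "k \<le> ?i")
      case True
      then have "src k \<le> src ?i" using s k(1) i by (metis strict_mono_on_leD)
      then show False using that k True by (simp add: e_def)
    next
      case False
      then have "dst ?i < dst k" using t k(1) i by (auto simp: strict_mono_on_def)
      then show False using that k False by (simp add: e_def)
    qed
  qed
  have ne: "?v (src ?i) \<noteq> V0" using L[OF i] unfolding at by blast
  have "src ?i \<le> dst ?i" "dst ?i \<le> n" "1 \<le> src ?i" using le[OF i] by auto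
  from move_letter[OF this v ne between] obtain c'
    where c': "c' \<noteq> 0" "aT (rev [src ?i..<dst ?i]) (dl ?v) = (\<lambda>w. c' * dl (?v(src ?i := V0, dst ?i := L ?i)) w)"
    unfolding at by blast
  have upd: "(e ?i)(?i := dst ?i) = e u" by (auto simp: e_def fun_eq_iff le_Suc_eq)
  have "?v(src ?i := V0, dst ?i := L ?i) = pl r (e u) L"
    using pl_move[OF inj[of ?i] inj[of u, folded upd] i, of L] unfolding upd by (simp add: e_def)
  moreover have "[u+1..<r+1] = ?i # [Suc u+1..<r+1]" using step by (simp add: upt_conv_Cons)
  ultimately have "act (prod_list (map (\<lambda>i. T_down (dst i) (src i)) [u+1..<r+1])) (dl (pl r src L))
     = (\<lambda>w. c * c' * dl (pl r (e u) L) w)"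
    using c(2) c'(2) by (simp add: act_mult act_T_down aT_scale mult.assoc)
  then show ?case unfolding e_def using c(1) c'(1) by (intro exI[of _ "c * c'"]) simp
qed

text \<open>\<open>N^(n-r)\<close> carries a block of \<open>r\<close> letters from the right end to
  the left end, each of the \<open>n - r\<close> shifts contributing \<open>q ^ r\<close>.\<close>

lemma opr_N_pow_dl:
  assumes r: "r \<le> n" and L: "\<And>i. i \<in> {1..r} \<Longrightarrow> L i \<noteq> V0" and w: "w \<in> words d n"
  shows "(opr GN ^^ (n - r)) (dl (pl r (\<lambda>i. n - r + i) L)) w = q ^ ((n - r) * r) * dl (pl r id L) w"
proof -
  let ?a = "\<lambda>i. n - r + i" and ?k = "n - r"
  have inj: "inj_on ?a {1..r}" "inj_on id {1..r}" by (auto intro: inj_onI)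
  have k: "?k \<le> n" "n - ?k = r" using r by auto
  note N = opr_N_pow[OF w k(1), of "dl (pl r ?a L)", unfolded k(2)]
  have img: "?a ` {1..r} = {n-r+1..n}"
    using image_add_atLeastAtMost[of "n - r" 1 r] r by (simp add: add.commute)
  show ?thesis
  proof (cases "w = pl r id L")
    case True
    have "\<forall>m\<in>{r+1..n}. w m = V0" unfolding True by (auto intro!: pl_out)
    moreover have "pl r ?a L = (\<lambda>m. w (m - ?k))"
    proof (rule pl_eqI[OF inj(1)])
      fix i assume i: "i \<in> {1..r}"
      show "w (n - r + i - (n - r)) = L i" unfolding True using pl_at[OF inj(2) i, of L] by simp
    next
      fix x assume x: "x \<notin> ?a ` {1..r}"
      have "x - ?k \<notin> id ` {1..r}" using x unfolding img using r by auto
      then show "w (x - ?k) = V0" unfolding True by (rule pl_out)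
    qed
    moreover have "cnt n w = r" unfolding True using r L by (intro pl_cnt[OF inj(2)]) auto
    ultimately show ?thesis unfolding N by (simp add: dl_def True)
  next
    case False
    have "(\<lambda>m. w (m - ?k)) \<noteq> pl r ?a L" if v: "\<forall>m\<in>{r+1..n}. w m = V0"
    proof
      assume e: "(\<lambda>m. w (m - ?k)) = pl r ?a L"
      have "pl r id L = w"
      proof (rule pl_eqI[OF inj(2)])
        fix i assume i: "i \<in> {1..r}"
        show "w (id i) = L i" using pl_at[OF inj(1) i, of L] fun_cong[OF e, of "n - r + i"] by simp
      next
        fix x assume "x \<notin> id ` {1..r}"
        then have "x \<in> {r+1..n} \<or> x \<notin> {1..n}" by auto
        then show "w x = V0" using v words_0[OF w] by blast
      qed
      then show False using False by simp
    qed
    then show ?thesis unfolding N using False by (simp add: dl_def)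
  qed
qed

lemma pl_permute:
  assumes "p permutes {1..r}"
  shows "pl r id L \<circ> p = pl r id (L \<circ> p)"
proof
  have e: "pl r id L k = (if k \<in> {1..r} then L k else V0)" for L k
    using pl_at[of id r k L] pl_out[of k id r L] by (auto simp del: atLeastAtMost_iff)
  fix k show "(pl r id L \<circ> p) k = pl r id (L \<circ> p) k"
    using permutes_in_image[OF assms, of k] by (simp add: e del: atLeastAtMost_iff)
qed

text \<open>Since the word is as short as the inversions allow, each new letter \<open>a\<close>
  satisfies \<open>?p a < ?p (a + 1)\<close> for the permutation \<open>?p\<close> already applied.
  The indices of \<open>L\<close> decrease, so this is a descent of indices and the swap is
  pure.\<close>

lemma pure_perm:
  assumes L: "\<And>i. i \<in> {1..r} \<Longrightarrow> L i \<in> ubasis d n \<and> idx (L i) = r + 1 - i" and r: "r \<le> n"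
    and js: "set js \<subseteq> {1..<r}" "length js = card (inversions r (perm_of_word js))"
  shows "\<exists>c. c \<noteq> 0 \<and> aT js (dl (pl r id L)) = (\<lambda>w. c * dl (pl r id (L \<circ> perm_of_word js)) w)"
  using js
proof (induction js)
  case Nil
  then show ?case by (intro exI[of _ 1]) (simp add: o_def)
next
  case (Cons a js)
  let ?p = "perm_of_word js"
  let ?v = "pl r id (L \<circ> ?p)"
  have a: "a \<in> {1..<r}" and js: "set js \<subseteq> {1..<r}" using Cons.prems(1) by auto
  have perm: "?p permutes {1..r}" by (rule perm_of_word_permutes[OF js])
  have "?p a \<noteq> ?p (a + 1)" using permutes_inj[OF perm] by (metis injD n_not_Suc_n Suc_eq_plus1)
  moreover have len: "length js + 1 = card (inversions r (?p \<circ> tp a (a + 1)))"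
    using Cons.prems(2) unfolding perm_of_word_Cons by (simp only: list.size One_nat_def)
  have "\<not> ?p (a + 1) < ?p a"
    using inversions_swap_ge[OF a, of ?p] inversions_word[OF js] len by linarith
  ultimately have lt: "?p a < ?p (a + 1)" by linarith
  have "length js = card (inversions r ?p)"
    using inversions_swap[OF a lt] len by linarith
  then obtain c where c: "c \<noteq> 0" "aT js (dl (pl r id L)) = (\<lambda>w. c * dl ?v w)"
    using Cons.IH[OF js] by blast
  have im: "?p a \<in> {1..r}" "?p (a + 1) \<in> {1..r}" using permutes_in_image[OF perm] a by auto
  have inj: "inj_on id {1..r}" by simp
  have at: "?v a = L (?p a)" "?v (a + 1) = L (?p (a + 1))"
    using pl_at[OF inj, of a "L \<circ> ?p"] pl_at[OF inj, of "a + 1" "L \<circ> ?p"] a by auto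
  have idx: "idx (?v (a + 1)) < idx (?v a)"
    unfolding at using L[OF im(1)] L[OF im(2)] lt im by auto
  have v: "?v \<in> words d n"
    using r L permutes_in_image[OF perm] by (intro pl_words[OF inj]) auto
  obtain c' where c': "c' \<noteq> 0" "opr (GT a) (dl ?v) = (\<lambda>w. c' * dl (?v \<circ> tp a (a + 1)) w)"
    by (rule opr_T_pure[OF v idx])
  have tp: "tp a (a + 1) permutes {1..r}" using a by (intro permutes_swap_id) auto
  have "aT (a # js) (dl (pl r id L)) = (\<lambda>w. c * c' * dl (?v \<circ> tp a (a + 1)) w)"
    unfolding aT_Cons c(2) opr_mult c'(2) by (simp only: mult.assoc)
  also have "?v \<circ> tp a (a + 1) = pl r id (L \<circ> perm_of_word (a # js))"
    unfolding pl_permute[OF tp] perm_of_word_Cons o_assoc ..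
  finally have e: "aT (a # js) (dl (pl r id L)) = (\<lambda>w. c * c' * dl (pl r id (L \<circ> perm_of_word (a # js))) w)" .
  have "c * c' \<noteq> 0" using c(1) c'(1) by simp
  then show ?case using e by blast
qed

lemma act_T_perm:
  assumes "p permutes {1..r}" "r \<le> n"
    and L: "\<And>i. i \<in> {1..r} \<Longrightarrow> L i \<in> ubasis d n \<and> idx (L i) = r + 1 - i"
  shows "\<exists>c. c \<noteq> 0 \<and> act (T_perm r p) (dl (pl r id L)) = (\<lambda>w. c * dl (pl r id (L \<circ> p)) w)"
proof -
  note R = reduced_wordD[OF assms(1)]
  have "length (SOME js. reduced_word r p js) = card (inversions r (perm_of_word (SOME js. reduced_word r p js)))"
    unfolding R(2) by (rule R(3))
  from pure_perm[OF L assms(2) R(1) this] show ?thesis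
    unfolding T_perm_def act_T_word R(2) by blast
qed

lemma act_F_mono:
  "act (F_mono r m) (dl v) = (\<lambda>w. (\<Prod>i\<in>{1..r}. \<chi> (col d (v i)) ^ m i) * dl v w)"
proof (induction r)
  case 0
  then show ?case by (simp add: F_mono_def act_1)
next
  case (Suc r)
  have "(F_mono (Suc r) m :: 'k free) = F_mono r m * gF (Suc r) ^ m (Suc r)"
    by (simp add: F_mono_def)
  moreover have "act (gF (Suc r) ^ m (Suc r)) (dl v) = (\<lambda>w. \<chi> (col d (v (Suc r))) ^ m (Suc r) * dl v w)"
    by (auto simp: act_F_pow dl_def fun_eq_iff)
  ultimately have "act (F_mono (Suc r) m) (dl v)
      = (\<lambda>w. \<chi> (col d (v (Suc r))) ^ m (Suc r) * ((\<Prod>i\<in>{1..r}. \<chi> (col d (v i)) ^ m i) * dl v w))"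
    by (simp only: act_mult act_f_mult Suc)
  then show ?case by (simp add: mult_ac)
qed

text \<open>Vanishing statements need only supports: a property of words that is stable under the
  relevant swaps passes through a product of \<open>T\<close>s without evaluating the
  product.\<close>

definition supp_on :: "((nat \<Rightarrow> ubas) \<Rightarrow> bool) \<Rightarrow> ((nat \<Rightarrow> ubas) \<Rightarrow> 'f) \<Rightarrow> bool" where
  "supp_on P f \<longleftrightarrow> (\<forall>w. f w \<noteq> 0 \<longrightarrow> P w)"

lemma supp_aT:
  assumes "supp_on P f" "\<And>i w. i \<in> set js \<Longrightarrow> P (w \<circ> tp i (i + 1)) \<Longrightarrow> P w"
  shows "supp_on P (aT js f)"
  using assms(2)
proof (induction js)
  case Nil then show ?case using assms(1) by simp
next
  case (Cons a js)
  have IH: "supp_on P (aT js f)"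
    by (rule Cons.IH, rule Cons.prems) simp_all
  show ?case unfolding supp_on_def
  proof (intro allI impI)
    fix w assume "aT (a # js) f w \<noteq> 0"
    then have "aT js f w \<noteq> 0 \<or> aT js f (w \<circ> tp a (a + 1)) \<noteq> 0"
      unfolding aT_Cons opr.simps by (metis add_0 mult_zero_right)
    then show "P w" using IH Cons.prems[of a w] unfolding supp_on_def by (metis list.set_intros(1))
  qed
qed

lemma supp_prod_T_down:
  assumes "supp_on P f" "\<And>i x w. x \<in> set xs \<Longrightarrow> i \<in> {lo x..<hi x} \<Longrightarrow> P (w \<circ> tp i (i + 1)) \<Longrightarrow> P w"
  shows "supp_on P (act (prod_list (map (\<lambda>x. T_down (hi x) (lo x)) xs)) f)"
  using assms(2)
proof (induction xs)
  case Nil then show ?case using assms(1) by (simp add: act_1)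
next
  case (Cons x xs)
  have "supp_on P (act (prod_list (map (\<lambda>x. T_down (hi x) (lo x)) xs)) f)"
  proof (rule Cons.IH)
    fix i y w assume "y \<in> set xs" "i \<in> {lo y..<hi y}" "P (w \<circ> tp i (i + 1))"
    then show "P w" using Cons.prems[of y i w] by (metis list.set_intros(2))
  qed
  then have "supp_on P (aT (rev [lo x..<hi x]) (act (prod_list (map (\<lambda>x. T_down (hi x) (lo x)) xs)) f))"
  proof (rule supp_aT)
    fix i w assume "i \<in> set (rev [lo x..<hi x])" and P: "P (w \<circ> tp i (i + 1))"
    then have "i \<in> {lo x..<hi x}" by simp
    from Cons.prems[OF _ this P] show "P w" by (metis list.set_intros(1))
  qed
  then show ?case by (simp add: act_mult act_T_down)
qed

text \<open>\<open>N^k\<close> evaluates \<open>f\<close> at a word shifted by \<open>k\<close>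
  places, all of whose letters other than \<open>V0\<close> lie to the right of position
  \<open>k\<close>.\<close>

lemma N_pow_kill:
  assumes "supp_on (\<lambda>w. \<not> {m\<in>{1..n}. w m \<noteq> V0} \<subseteq> {k+1..n}) f" "k \<le> n" "w \<in> words d n"
  shows "(opr GN ^^ k) f w = 0"
proof -
  have "{m\<in>{1..n}. w (m - k) \<noteq> V0} \<subseteq> {k+1..n}"
  proof
    fix m assume m: "m \<in> {m\<in>{1..n}. w (m - k) \<noteq> V0}"
    have "\<not> m \<le> k"
    proof
      assume "m \<le> k"
      then show False using m words_0[OF assms(3), of 0] by simp
    qed
    then show "m \<in> {k+1..n}" using m by simp
  qed
  then have "f (\<lambda>m. w (m - k)) = 0" using assms(1) unfolding supp_on_def by blast
  then show ?thesis unfolding opr_N_pow[OF assms(3,2)] by simp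
qed

end

section \<open>Words in the generators\<close>

definition carr :: "nat \<Rightarrow> (gen list \<Rightarrow>\<^sub>0 'a::ring_1) set" where
  "carr n = {x. Poly_Mapping.keys x \<subseteq> lists (gens n)}"

lemma carr_1: "1 \<in> carr n"
  by (simp add: carr_def zero_list_def)
lemma carr_0: "0 \<in> carr n"
  by (simp add: carr_def)
lemma carr_single: "l \<in> lists (gens n) \<Longrightarrow> Poly_Mapping.single l c \<in> carr n"
  by (auto simp: carr_def split: if_splits)
lemma carr_scal: "scal c \<in> carr n"
  unfolding scal_def by (rule carr_single) simp
lemma carr_add: "x \<in> carr n \<Longrightarrow> y \<in> carr n \<Longrightarrow> x + y \<in> carr n"
  unfolding carr_def using Poly_Mapping.keys_add[of x y] by blast
lemma carr_minus: "x \<in> carr n \<Longrightarrow> - x \<in> carr n"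
  by (simp add: carr_def)
lemma carr_diff: "x \<in> carr n \<Longrightarrow> y \<in> carr n \<Longrightarrow> x - y \<in> carr n"
  using carr_add[of x n "- y"] carr_minus[of y] by simp
lemma carr_mult:
  assumes "x \<in> carr n" "y \<in> carr n" shows "x * y \<in> carr n"
proof -
  have "Poly_Mapping.keys (x * y) \<subseteq> {a + b |a b. a \<in> Poly_Mapping.keys x \<and> b \<in> Poly_Mapping.keys y}"
    by (rule keys_mult)
  moreover have "a + b \<in> lists (gens n)" if "a \<in> Poly_Mapping.keys x" "b \<in> Poly_Mapping.keys y" for a b
    using that assms unfolding carr_def plus_list_def append_in_lists_conv by blast
  ultimately show ?thesis unfolding carr_def by blast
qed
lemma carr_pow: "x \<in> carr n \<Longrightarrow> x ^ k \<in> carr n"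
  by (induction k) (simp_all add: carr_1 carr_mult)
lemma carr_sum: "(\<And>a. a \<in> A \<Longrightarrow> f a \<in> carr n) \<Longrightarrow> sum f A \<in> carr n"
  by (induction A rule: infinite_finite_induct) (simp_all add: carr_0 carr_add)
lemma carr_prod_list: "(\<And>x. x \<in> set xs \<Longrightarrow> x \<in> carr n) \<Longrightarrow> prod_list xs \<in> carr n"
  by (induction xs) (simp_all add: carr_1 carr_mult)
lemma carr_gT: "i \<in> {1..<n} \<Longrightarrow> gT i \<in> carr n"
  unfolding gT_def by (rule carr_single) (simp add: gens_def)
lemma carr_gF: "i \<in> {1..n} \<Longrightarrow> gF i \<in> carr n"
  unfolding gF_def by (rule carr_single) (simp add: gens_def)
lemma carr_gN: "gN \<in> carr n"
  unfolding gN_def by (rule carr_single) (simp add: gens_def)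
lemma carr_T_word: "set js \<subseteq> {1..<n} \<Longrightarrow> prod_list (map gT js) \<in> carr n"
proof (rule carr_prod_list)
  fix x :: "'a free" assume js: "set js \<subseteq> {1..<n}" and "x \<in> set (map gT js)"
  then obtain i where "i \<in> set js" "x = gT i" by auto
  then show "x \<in> carr n" using carr_gT[of i n] js by blast
qed
lemma carr_T_down: "1 \<le> i \<Longrightarrow> k \<le> n \<Longrightarrow> T_down k i \<in> carr n"
  unfolding T_down_def by (intro carr_T_word) auto
lemma carr_F_mono: "r \<le> n \<Longrightarrow> F_mono r m \<in> carr n"
  unfolding F_mono_def by (intro carr_prod_list) (auto intro!: carr_pow carr_gF)

section \<open>Enumerations of finite sets of indices\<close>

definition en :: "nat set \<Rightarrow> nat \<Rightarrow> nat" where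
  "en A i = sorted_list_of_set A ! (i - 1)"

lemma en_mono: "finite A \<Longrightarrow> strict_mono_on {1..card A} (en A)"
  unfolding en_def by (rule strict_mono_onI) (auto intro!: sorted_wrt_nth_less[OF strict_sorted_list_of_set])

lemma en_inj: "finite A \<Longrightarrow> inj_on (en A) {1..card A}"
  by (rule strict_mono_on_imp_inj_on[OF en_mono])

lemma en_image: "finite A \<Longrightarrow> en A ` {1..card A} = A"
proof -
  assume A: "finite A"
  have "en A ` {1..card A} = (\<lambda>i. sorted_list_of_set A ! i) ` {..<card A}"
    by (force simp: en_def image_iff Bex_def intro: exI[of _ "Suc _"])
  also have "\<dots> = A" using nth_image[of "card A" "sorted_list_of_set A"] A by (simp add: lessThan_atLeast0)
  finally show ?thesis .
qed

lemma strict_mono_lower: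
  fixes f :: "nat \<Rightarrow> nat"
  assumes "strict_mono_on {1..r} f" "\<And>i. i \<in> {1..r} \<Longrightarrow> 1 \<le> f i" "1 \<le> i" "i \<le> r"
  shows "i \<le> f i"
  using assms(3,4)
proof (induction i rule: dec_induct)
  case base then show ?case using assms(2)[of 1] by simp
next
  case (step i)
  have "f i < f (Suc i)" using assms(1) step by (intro strict_mono_onD[OF assms(1)]) auto
  then show ?case using step by simp
qed

lemma strict_mono_upper:
  fixes f :: "nat \<Rightarrow> nat"
  assumes "strict_mono_on {1..r} f" "\<And>i. i \<in> {1..r} \<Longrightarrow> f i \<le> n" "i \<le> r" "1 \<le> i"
  shows "f i + r \<le> n + i"
  using assms(3,4)
proof (induction i rule: inc_induct)
  case base then show ?case using assms(2)[of r] by simp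
next
  case (step i)
  have "f i < f (Suc i)" using assms(1) step by (intro strict_mono_onD[OF assms(1)]) auto
  then show ?case using step by simp
qed

lemma en_in: "finite A \<Longrightarrow> i \<in> {1..card A} \<Longrightarrow> en A i \<in> A"
  using en_image by blast

lemma en_bounds:
  assumes "A \<subseteq> {1..n}" "card A = r" "i \<in> {1..r}"
  shows "1 \<le> en A i" "i \<le> en A i" "en A i \<le> n" "en A i \<le> n - r + i" "r \<le> n"
proof -
  have f: "finite A" using assms(1) finite_subset by blast
  have m: "strict_mono_on {1..r} (en A)" using en_mono[OF f] assms(2) by simp
  have b: "1 \<le> en A k \<and> en A k \<le> n" if "k \<in> {1..r}" for k
    using en_in[OF f, of k] assms(1,2) that by auto
  show rn: "r \<le> n" using card_mono[OF _ assms(1)] assms(2) by simp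
  show "1 \<le> en A i" "en A i \<le> n" using b assms(3) by auto
  show "i \<le> en A i" by (rule strict_mono_lower[OF m]) (use b assms(3) in auto)
  have "en A i + r \<le> n + i" by (rule strict_mono_upper[OF m]) (use b assms(3) in auto)
  then show "en A i \<le> n - r + i" using rn by simp
qed

lemma sum_pow2_less:
  assumes "finite S" "\<And>x. x \<in> S \<Longrightarrow> x < k" shows "(\<Sum>x\<in>S. 2 ^ x) < (2::nat) ^ k"
proof -
  have "(\<Sum>x\<in>S. 2 ^ x) \<le> (\<Sum>x\<in>{..<k}. (2::nat) ^ x)" using assms by (intro sum_mono2) auto
  also have "\<dots> < 2 ^ k" by (simp add: lessThan_atLeast0 sum_power2)
  finally show ?thesis .
qed

text \<open>The sum of powers of 2 is the binary code of a set, which orders sets of equal size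
  colexicographically. At the largest place \<open>i\<close> of disagreement,
  \<open>en B i < en C i\<close> would make the elements of \<open>B\<close> up to \<open>i\<close>
  sum to less than \<open>2 ^ en C i\<close>.\<close>

lemma colex:
  assumes fin: "finite B" "finite C" and card: "card B = r" "card C = r" and ne: "B \<noteq> C"
    and le: "(\<Sum>b\<in>C. 2 ^ b) \<le> (\<Sum>b\<in>B. (2::nat) ^ b)"
  obtains i where "i \<in> {1..r}" "en C i < en B i" "\<And>m. m \<in> {1..r} \<Longrightarrow> i < m \<Longrightarrow> en B m = en C m"
proof -
  let ?S = "{i \<in> {1..r}. en B i \<noteq> en C i}"
  have "?S \<noteq> {}"
  proof
    assume "?S = {}"
    then have "en B ` {1..r} = en C ` {1..r}" by (intro image_cong) auto
    then show False using ne en_image[OF fin(1)] en_image[OF fin(2)] card by simp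
  qed
  moreover have fS: "finite ?S" by simp
  ultimately have iS: "Max ?S \<in> ?S" by (metis Max_in)
  define i where "i = Max ?S"
  have i: "i \<in> {1..r}" "en B i \<noteq> en C i" using iS by (auto simp: i_def)
  have above: "en B m = en C m" if "m \<in> {1..r}" "i < m" for m
  proof (rule ccontr)
    assume "en B m \<noteq> en C m"
    then have "m \<le> i" unfolding i_def using that(1) by (intro Max_ge[OF fS]) simp
    then show False using that(2) by simp
  qed
  have "\<not> en B i < en C i"
  proof
    assume lt: "en B i < en C i"
    have s: "(\<Sum>b\<in>Y. (2::nat) ^ b) = (\<Sum>m\<in>{1..i}. 2 ^ en Y m) + (\<Sum>m\<in>{i+1..r}. 2 ^ en Y m)"
      if "finite Y" "card Y = r" for Y
    proof -
      have "(\<Sum>b\<in>Y. (2::nat) ^ b) = (\<Sum>m\<in>{1..r}. 2 ^ en Y m)"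
        using sum.reindex[OF en_inj[OF that(1)], of "\<lambda>b. (2::nat) ^ b"] en_image[OF that(1)] that(2)
        by (simp add: o_def)
      also have "\<dots> = (\<Sum>m\<in>{1..i}. 2 ^ en Y m) + (\<Sum>m\<in>{i+1..r}. 2 ^ en Y m)"
        using sum.ub_add_nat[of 1 i "\<lambda>m. 2 ^ en Y m" "r - i"] i by simp
      finally show ?thesis .
    qed
    have tail: "(\<Sum>m\<in>{i+1..r}. (2::nat) ^ en B m) = (\<Sum>m\<in>{i+1..r}. 2 ^ en C m)"
      by (rule sum.cong) (use above i in auto)
    have injB: "inj_on (en B) {1..i}" using en_inj[OF fin(1)] card(1) i(1) by (auto intro: inj_on_subset)
    have "(\<Sum>m\<in>{1..i}. (2::nat) ^ en B m) = (\<Sum>x\<in>en B ` {1..i}. 2 ^ x)"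
      using sum.reindex[OF injB, of "\<lambda>b. (2::nat) ^ b"] by (simp add: o_def)
    also have "\<dots> < 2 ^ en C i"
    proof (rule sum_pow2_less)
      fix x assume "x \<in> en B ` {1..i}"
      then obtain m where m: "m \<in> {1..i}" "x = en B m" by blast
      have "en B m \<le> en B i"
        using strict_mono_on_leD[OF en_mono[OF fin(1)], of m i] m i card by simp
      then show "x < en C i" using m lt by simp
    qed simp
    also have "\<dots> \<le> (\<Sum>m\<in>{1..i}. 2 ^ en C m)"
      by (rule member_le_sum[of i "{1..i}" "\<lambda>m. 2 ^ en C m"]) (use i in auto)
    finally show False using s[OF fin(1) card(1)] s[OF fin(2) card(2)] tail le by linarith
  qed
  then have "en C i < en B i" using i by simp
  with i(1) above show ?thesis using that by blast
qed

lemma pl_cong: "(\<And>i. i \<in> {1..r} \<Longrightarrow> a i = b i) \<Longrightarrow> inj_on b {1..r} \<Longrightarrow> pl r a L = pl r b L"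
proof -
  assume ab: "\<And>i. i \<in> {1..r} \<Longrightarrow> a i = b i" and b: "inj_on b {1..r}"
  have im: "a ` {1..r} = b ` {1..r}" using ab by (intro image_cong) auto
  show ?thesis
  proof (rule pl_eqI)
    show "inj_on a {1..r}" using inj_on_cong[of "{1..r}" a b] ab b by blast
    show "pl r b L (a i) = L i" if "i \<in> {1..r}" for i using pl_at[OF b that] ab[OF that] by simp
    show "pl r b L k = V0" if "k \<notin> a ` {1..r}" for k using that pl_out unfolding im by blast
  qed
qed

section \<open>Linear independence\<close>

definition Cel :: "nat \<Rightarrow> nat \<Rightarrow> nat set \<Rightarrow> nat set \<Rightarrow> (nat \<Rightarrow> nat) \<Rightarrow> (nat \<Rightarrow> nat) \<Rightarrow> 'k::field_char_0 free" where
  "Cel n r A B m p = T_set A * F_mono r m * T_perm r p * gN ^ (n - r) * T_set_bar n B"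

definition subs :: "nat \<Rightarrow> nat \<Rightarrow> nat set set" where
  "subs n r = {A. A \<subseteq> {1..n} \<and> card A = r}"

lemma T_set_en: "card A = r \<Longrightarrow> T_set A = prod_list (map (\<lambda>i. T_down (en A i) i) [0+1..<r+1])"
  by (simp add: T_set_def en_def)

lemma T_set_bar_en: "card A = r \<Longrightarrow> T_set_bar n A = prod_list (map (\<lambda>i. T_down (n - r + i) (en A i)) [0+1..<r+1])"
  by (simp add: T_set_bar_def en_def)

lemma carr_T_set: "A \<in> subs n r \<Longrightarrow> T_set A \<in> carr n"
proof -
  assume A: "A \<in> subs n r"
  then have "card A = r" by (simp add: subs_def)
  then show ?thesis unfolding T_set_en[OF \<open>card A = r\<close>]
  proof (intro carr_prod_list)
    fix x :: "'a free" assume "x \<in> set (map (\<lambda>i. T_down (en A i) i) [0+1..<r+1])"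
    then obtain i where "i \<in> set [0+1..<r+1]" and x: "x = T_down (en A i) i" unfolding set_map by blast
    then have i: "i \<in> {1..r}" "x = T_down (en A i) i" by auto
    show "x \<in> carr n" unfolding i(2)
      using en_bounds[of A n r i] A i(1) by (intro carr_T_down) (auto simp: subs_def)
  qed
qed

lemma carr_T_set_bar: "A \<in> subs n r \<Longrightarrow> T_set_bar n A \<in> carr n"
proof -
  assume A: "A \<in> subs n r"
  then have "card A = r" by (simp add: subs_def)
  then show ?thesis unfolding T_set_bar_en[OF \<open>card A = r\<close>]
  proof (intro carr_prod_list)
    fix x :: "'a free" assume "x \<in> set (map (\<lambda>i. T_down (n - r + i) (en A i)) [0+1..<r+1])"
    then obtain i where "i \<in> set [0+1..<r+1]" and x: "x = T_down (n - r + i) (en A i)" unfolding set_map by blast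
    then have i: "i \<in> {1..r}" "x = T_down (n - r + i) (en A i)" by auto
    show "x \<in> carr n" unfolding i(2)
      using en_bounds[of A n r i] A i(1) by (intro carr_T_down) (auto simp: subs_def)
  qed
qed

lemma carr_T_perm: "p permutes {1..r} \<Longrightarrow> r \<le> n \<Longrightarrow> T_perm r p \<in> carr n"
  unfolding T_perm_def using reduced_wordD(1)[of p r] by (intro carr_T_word) auto

lemma subs_le: "A \<in> subs n r \<Longrightarrow> r \<le> n"
  using card_mono[of "{1..n}" A] by (auto simp: subs_def)

lemma carr_Cel:
  assumes "A \<in> subs n r" "B \<in> subs n r" "p permutes {1..r}"
  shows "Cel n r A B m p \<in> carr n"
  unfolding Cel_def using assms subs_le[OF assms(1)]
  by (intro carr_mult carr_T_set[OF assms(1)] carr_T_set_bar[OF assms(2)] carr_F_mono carr_T_perm carr_pow carr_gN)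

text \<open>\<open>C_set\<close> consists of classes that might coincide; the indexed family keeps
  the terms apart until independence shows that they do not. For \<open>r = 0\<close> there is
  exactly one index.\<close>

definition Cidx :: "nat \<Rightarrow> nat \<Rightarrow> (nat \<times> nat set \<times> nat set \<times> (nat \<Rightarrow> nat) \<times> (nat \<Rightarrow> nat)) set" where
  "Cidx d n = (SIGMA r:{0..n}. subs n r \<times> subs n r \<times> ({1..r} \<rightarrow>\<^sub>E {0..<d}) \<times> {p. p permutes {1..r}})"

definition CX :: "nat \<Rightarrow> nat \<times> nat set \<times> nat set \<times> (nat \<Rightarrow> nat) \<times> (nat \<Rightarrow> nat) \<Rightarrow> 'k::field_char_0 free" where
  "CX n = (\<lambda>(r, A, B, m, p). Cel n r A B m p)"

lemma finite_subs: "finite (subs n r)"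
  by (simp add: subs_def)

lemma finite_Cidx: "finite (Cidx d n)"
  unfolding Cidx_def
  by (intro finite_SigmaI finite_cartesian_product finite_subs finite_PiE finite_permutations) auto

text \<open>The set is recovered as the places where the word differs from \<open>V0\<close>, and
  the permutation is then read off from the letters, which are distinct.\<close>

lemma pl_inj:
  assumes A: "A \<in> subs n r" "C \<in> subs n r" and p: "p permutes {1..r}" "s permutes {1..r}"
    and L: "\<And>i. i \<in> {1..r} \<Longrightarrow> L i \<noteq> V0" "inj_on L {1..r}"
    and eq: "pl r (en A) (L \<circ> p) = pl r (en C) (L \<circ> s)"
  shows "A = C \<and> p = s"
proof -
  have sub: "card A = r" "card C = r" "finite A" "finite C"
    using A finite_subset[of A "{1..n}"] finite_subset[of C "{1..n}"] by (auto simp: subs_def)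
  have inj: "inj_on (en A) {1..r}" "inj_on (en C) {1..r}" using en_inj[OF sub(3)] en_inj[OF sub(4)] sub by simp_all
  have im: "en A ` {1..r} = A" "en C ` {1..r} = C" using en_image[OF sub(3)] en_image[OF sub(4)] sub by simp_all
  have nz: "{k. pl r (en Y) (L \<circ> t) k \<noteq> V0} = Y" if h: "inj_on (en Y) {1..r}" "en Y ` {1..r} = Y" "t permutes {1..r}" for Y t
  proof (intro equalityI subsetI)
    fix k assume "k \<in> {k. pl r (en Y) (L \<circ> t) k \<noteq> V0}"
    then show "k \<in> Y" using pl_out[of k "en Y" r "L \<circ> t"] h(2) by auto
  next
    fix k assume "k \<in> Y"
    then obtain i where i: "i \<in> {1..r}" "k = en Y i" using h(2) by blast
    then have "t i \<in> {1..r}" using permutes_in_image[OF h(3)] by blast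
    then show "k \<in> {k. pl r (en Y) (L \<circ> t) k \<noteq> V0}" using pl_at[OF h(1) i(1), of "L \<circ> t"] L(1) i(2) by simp
  qed
  have AC: "A = C" using nz[OF inj(1) im(1) p(1)] nz[OF inj(2) im(2) p(2)] unfolding eq by simp
  have e2: "pl r (en C) (L \<circ> p) = pl r (en C) (L \<circ> s)" using eq unfolding AC .
  have "p i = s i" for i
  proof (cases "i \<in> {1..r}")
    case True
    have eL: "L (p i) = L (s i)"
      using pl_at[OF inj(2) True, of "L \<circ> p"] pl_at[OF inj(2) True, of "L \<circ> s"] unfolding e2 by simp
    have "p i \<in> {1..r}" "s i \<in> {1..r}"
      unfolding permutes_in_image[OF p(1)] permutes_in_image[OF p(2)] by (rule True)+
    then show ?thesis by (rule inj_onD[OF L(2) eL])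
  next
    case False
    then show ?thesis using p by (metis permutes_not_in)
  qed
  then show ?thesis using AC by blast
qed

section \<open>Which terms survive on a test word\<close>

context tmodel
begin

lemma act_zero_mult:
  assumes "x \<in> carr n" "\<And>w. w \<in> words d n \<Longrightarrow> act y f w = 0" "w \<in> words d n"
  shows "act (x * y) f w = 0"
proof -
  have "act x (act y f) w = act x (\<lambda>w. 0) w"
    using assms(1) by (intro act_local[OF _ assms(2,3)]) (simp add: carr_def)
  then show ?thesis by (simp add: act_mult act_f_0)
qed

lemma supp_T_set_bar:
  assumes B: "B \<in> subs n k" and f: "supp_on (\<lambda>w. cnt n w = r) f"
  shows "supp_on (\<lambda>w. cnt n w = r) (act (T_set_bar n B) f)"
proof -
  have cB: "card B = k" and sB: "B \<subseteq> {1..n}" using B by (auto simp: subs_def)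
  show ?thesis
    unfolding T_set_bar_en[OF cB]
  proof (rule supp_prod_T_down[OF f])
    fix i x w assume x: "x \<in> set [0+1..<k+1]" and i: "i \<in> {en B x..<n - k + x}" and c: "cnt n (w \<circ> tp i (i + 1)) = r"
    have x: "x \<in> {1..k}" using x by auto
    have "i \<in> {1..<n}" using en_bounds[OF sB cB x] i x by auto
    then show "cnt n w = r" using c cnt_swap by metis
  qed
qed

text \<open>For a nonzero value, \<open>N^(n-k)\<close> requires all letters of \<open>V\<close> to
  sit in the last \<open>k\<close> positions, which cannot hold \<open>r > k\<close> of them; the
  preceding swaps do not change the number of letters.\<close>

lemma lower_level_zero:
  assumes A: "A \<in> subs n k" and B: "B \<in> subs n k" and p: "p permutes {1..k}" and k: "k < r"
    and f: "supp_on (\<lambda>w. cnt n w = r) f" and w: "w \<in> words d n"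
  shows "act (Cel n k A B m p) f w = 0"
proof -
  have kn: "k \<le> n" by (rule subs_le[OF A])
  have 1: "act (gN ^ (n - k) * T_set_bar n B) f v = 0" if v: "v \<in> words d n" for v
    unfolding act_mult act_N_pow
  proof (rule N_pow_kill[OF _ _ v])
    show "supp_on (\<lambda>w. \<not> {m\<in>{1..n}. w m \<noteq> V0} \<subseteq> {n-k+1..n}) (act (T_set_bar n B) f)"
      unfolding supp_on_def
    proof (intro allI impI notI)
      fix w assume "act (T_set_bar n B) f w \<noteq> 0" and s: "{m\<in>{1..n}. w m \<noteq> V0} \<subseteq> {n-k+1..n}"
      then have "card {m\<in>{1..n}. w m \<noteq> V0} = r"
        using supp_T_set_bar[OF B f] by (simp add: supp_on_def cnt_def)
      then show False using card_mono[OF _ s] kn k by simp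
    qed
  qed simp
  have "act ((T_set A * F_mono k m * T_perm k p) * (gN ^ (n - k) * T_set_bar n B)) f w = 0"
    by (rule act_zero_mult[OF _ 1 w]) (intro carr_mult carr_T_set[OF A] carr_F_mono carr_T_perm p kn)
  then show ?thesis by (simp add: Cel_def mult.assoc)
qed

lemma zero_pass:
  assumes "\<And>k. k \<in> set js \<Longrightarrow> v k = V0 \<and> v (k + 1) = V0"
  shows "\<exists>c. aT js (dl v) = (\<lambda>w. c * dl v w)"
  using assms
proof (induction js)
  case Nil
  show ?case by (intro exI[of _ 1]) simp
next
  case (Cons k js)
  then obtain c where c: "aT js (dl v) = (\<lambda>w. c * dl v w)" by fastforce
  have "opr (GT k) (dl v) = (\<lambda>w. q\<^sup>2 * dl v w)" using Cons.prems[of k] by (intro opr_T_dl_zero) auto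
  then show ?case unfolding aT_Cons c opr_mult by (intro exI[of _ "c * q\<^sup>2"]) (simp add: mult.assoc)
qed

text \<open>Let \<open>i\<close> be the largest index with \<open>en C i < en B i\<close> and
  agreement above. The factors above \<open>i\<close> move their letters to the right end as
  intended. The factor at \<open>i\<close> then sees only \<open>V0\<close> and acts by a scalar, so
  position \<open>n - r + i\<close> stays empty, and the remaining factors do not reach that
  position. Hence \<open>r\<close> letters would have to fit into \<open>r - 1\<close> of the last
  \<open>r\<close> positions, and \<open>N^(n-r)\<close> gives zero.\<close>

lemma other_B_zero:
  assumes A: "A \<in> subs n r" and B: "B \<in> subs n r" and C: "C \<in> subs n r" and p: "p permutes {1..r}" and ne: "B \<noteq> C"
    and le: "(\<Sum>b\<in>C. 2 ^ b) \<le> (\<Sum>b\<in>B. (2::nat) ^ b)"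
    and L: "\<And>i. i \<in> {1..r} \<Longrightarrow> L i \<in> ubasis d n \<and> L i \<noteq> V0" and w: "w \<in> words d n"
  shows "act (Cel n r A B m p) (dl (pl r (en C) L)) w = 0"
proof -
  have rn: "r \<le> n" by (rule subs_le[OF A])
  have sub: "B \<subseteq> {1..n}" "C \<subseteq> {1..n}" "card B = r" "card C = r" using B C by (auto simp: subs_def)
  have fin: "finite B" "finite C" using sub finite_subset by blast+
  obtain i where i: "i \<in> {1..r}" "en C i < en B i" and above: "\<And>m. m \<in> {1..r} \<Longrightarrow> i < m \<Longrightarrow> en B m = en C m"
    using colex[OF fin sub(3,4) ne le] by blast
  let ?D = "\<lambda>x. T_down (n - r + x) (en B x) :: 'k free"
  have "[0+1..<r+1] = [1..<i] @ i # [i+1..<r+1]"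
    using i(1) upt_add_eq_append[of 1 i "r + 1 - i"] by (simp add: upt_conv_Cons)
  then have split: "T_set_bar n B = prod_list (map ?D [1..<i]) * ?D i * prod_list (map ?D [i+1..<r+1])"
    unfolding T_set_bar_en[OF sub(3)] by (simp add: mult.assoc)
  have tail: "prod_list (map ?D [i+1..<r+1]) = prod_list (map (\<lambda>x. T_down (n - r + x) (en C x)) [i+1..<r+1])"
    by (intro arg_cong[of _ _ prod_list] map_cong refl) (use above i in auto)
  define e where "e = (\<lambda>x. if x \<le> i then en C x else n - r + x)"
  have sm: "strict_mono_on {1..r} (en C)" using en_mono[OF fin(2)] sub by simp
  have sm2: "strict_mono_on {1..r} (\<lambda>x. n - r + x)" by (auto intro: strict_mono_onI)
  have bd: "1 \<le> en C x \<and> en C x \<le> n - r + x \<and> n - r + x \<le> n" if "x \<in> {1..r}" for x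
    using en_bounds[OF sub(2,4) that] rn that by auto
  have "i \<le> r" using i by simp
  from shift_letters[where src = "en C" and dst = "\<lambda>x. n - r + x" and L = L, OF sm sm2 bd L this] obtain c
    where c: "act (prod_list (map ?D [i+1..<r+1])) (dl (pl r (en C) L)) = (\<lambda>w. c * dl (pl r e L) w)"
    unfolding tail e_def by blast
  have esm: "strict_mono_on {1..r} e"
  proof (rule strict_mono_onI)
    fix x y assume xy: "x \<in> {1..r}" "y \<in> {1..r}" "x < y"
    have "en C x < en C y" using xy sm by (auto simp: strict_mono_on_def)
    then show "e x < e y" using bd[OF xy(1)] bd[OF xy(2)] xy(3) by (auto simp: e_def)
  qed
  have einj: "inj_on e {1..r}" by (rule strict_mono_on_imp_inj_on[OF esm])
  have erng: "e ` {1..r} \<subseteq> {1..n}"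
  proof
    fix y assume "y \<in> e ` {1..r}"
    then obtain x where "x \<in> {1..r}" "y = e x" by blast
    then show "y \<in> {1..n}" using bd[of x] by (auto simp: e_def)
  qed
  let ?v = "pl r e L"
  have zeros: "?v k = V0" if "en B i \<le> k" "k \<le> n - r + i" for k
  proof (rule pl_out, rule notI)
    assume "k \<in> e ` {1..r}"
    then obtain x where x: "x \<in> {1..r}" "k = e x" by blast
    show False
    proof (cases "x \<le> i")
      case True
      then have "en C x \<le> en C i" using strict_mono_on_leD[OF sm x(1) i(1)] by simp
      then show False using x True that i(2) by (simp add: e_def)
    next
      case False
      then show False using x that by (simp add: e_def)
    qed
  qed
  have "\<exists>c. aT (rev [en B i..<n - r + i]) (dl ?v) = (\<lambda>w. c * dl ?v w)"
    by (rule zero_pass) (use zeros in auto)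
  then obtain c' where c': "act (?D i) (dl ?v) = (\<lambda>w. c' * dl ?v w)"
    unfolding act_T_down by blast
  let ?P = "\<lambda>w. w (n - r + i) = V0 \<and> cnt n w = r"
  have cv: "cnt n ?v = r" using L by (intro pl_cnt[OF einj erng]) blast
  have "?v (n - r + i) = V0" by (rule zeros) (use en_bounds(4)[OF sub(1,3) i(1)] in auto)
  then have "supp_on ?P (\<lambda>w. c * (c' * dl ?v w))"
    using cv by (auto simp: supp_on_def dl_def)
  moreover have "act (?D i * prod_list (map ?D [i+1..<r+1])) (dl (pl r (en C) L)) = (\<lambda>w. c * (c' * dl ?v w))"
    unfolding act_mult c act_f_mult c' ..
  ultimately have s1: "supp_on ?P (act (?D i * prod_list (map ?D [i+1..<r+1])) (dl (pl r (en C) L)))" by simp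
  have "supp_on ?P (act (prod_list (map ?D [1..<i])) (act (?D i * prod_list (map ?D [i+1..<r+1])) (dl (pl r (en C) L))))"
  proof (rule supp_prod_T_down[OF s1])
    fix k x w assume x: "x \<in> set [1..<i]" and k: "k \<in> {en B x..<n - r + x}" and P: "?P (w \<circ> tp k (k + 1))"
    have x: "x \<in> {1..r}" "x < i" using x i by auto
    have kn: "k \<in> {1..<n}" using en_bounds[OF sub(1,3) x(1)] k x(1) by auto
    have "tp k (k + 1) (n - r + i) = n - r + i" using k x by (auto simp: transpose_def)
    then show "?P w" using P cnt_swap[OF kn, of w] by simp
  qed
  then have s2: "supp_on ?P (act (T_set_bar n B) (dl (pl r (en C) L)))"
    unfolding split by (simp add: act_mult mult.assoc)
  have 1: "act (gN ^ (n - r) * T_set_bar n B) (dl (pl r (en C) L)) v = 0" if v: "v \<in> words d n" for v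
    unfolding act_mult act_N_pow
  proof (rule N_pow_kill[OF _ _ v])
    show "supp_on (\<lambda>w. \<not> {m\<in>{1..n}. w m \<noteq> V0} \<subseteq> {n-r+1..n}) (act (T_set_bar n B) (dl (pl r (en C) L)))"
      unfolding supp_on_def
    proof (intro allI impI notI)
      fix w assume "act (T_set_bar n B) (dl (pl r (en C) L)) w \<noteq> 0" and s: "{m\<in>{1..n}. w m \<noteq> V0} \<subseteq> {n-r+1..n}"
      then have P: "?P w" using s2 by (simp add: supp_on_def)
      then have s': "{m\<in>{1..n}. w m \<noteq> V0} \<subseteq> {n-r+1..n} - {n - r + i}" using s by auto
      have "card {m\<in>{1..n}. w m \<noteq> V0} \<le> card ({n-r+1..n} - {n - r + i})" by (rule card_mono[OF _ s']) simp
      also have "\<dots> < r" using i(1) rn by (subst card_Diff_singleton) auto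
      finally show False using P by (simp add: cnt_def)
    qed
  qed simp
  have "act ((T_set A * F_mono r m * T_perm r p) * (gN ^ (n - r) * T_set_bar n B)) (dl (pl r (en C) L)) w = 0"
    by (rule act_zero_mult[OF _ 1 w]) (intro carr_mult carr_T_set[OF A] carr_F_mono carr_T_perm p rn)
  then show ?thesis by (simp add: Cel_def mult.assoc)
qed

text \<open>All three products act by pure permutations of letters. The constant is chosen before
  \<open>m\<close>, so that \<open>m\<close> enters only through the monomial in the eigenvalues;
  this turns the sum over \<open>m\<close> into a polynomial.\<close>

lemma pure_action:
  assumes A: "A \<in> subs n r" and B: "B \<in> subs n r" and p: "p permutes {1..r}"
    and L: "\<And>i. i \<in> {1..r} \<Longrightarrow> L i \<in> ubasis d n \<and> idx (L i) = r + 1 - i"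
  shows "\<exists>c. c \<noteq> 0 \<and> (\<forall>m. \<forall>w\<in>words d n. act (Cel n r A B m p) (dl (pl r (en B) L)) w
     = c * (\<Prod>i\<in>{1..r}. \<chi> (col d (L (p i))) ^ m i) * dl (pl r (en A) (L \<circ> p)) w)"
proof -
  have rn: "r \<le> n" by (rule subs_le[OF A])
  have sub: "A \<subseteq> {1..n}" "B \<subseteq> {1..n}" "card A = r" "card B = r" using A B by (auto simp: subs_def)
  have fin: "finite A" "finite B" using sub finite_subset by blast+
  have L1: "L i \<in> ubasis d n \<and> L i \<noteq> V0" if "i \<in> {1..r}" for i using L[OF that] that by (cases "L i") auto
  have pin: "p i \<in> {1..r}" if "i \<in> {1..r}" for i using permutes_in_image[OF p] that by blast
  have L2: "(L \<circ> p) i \<in> ubasis d n \<and> (L \<circ> p) i \<noteq> V0" if "i \<in> {1..r}" for i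
    using L1[OF pin[OF that]] by simp
  have smA: "strict_mono_on {1..r} (en A)" and smB: "strict_mono_on {1..r} (en B)"
    using en_mono[OF fin(1)] en_mono[OF fin(2)] sub by simp_all
  have smi: "strict_mono_on {1..r} id" and smn: "strict_mono_on {1..r} (\<lambda>x. n - r + x)" by (auto intro: strict_mono_onI)
  have bB: "1 \<le> en B x \<and> en B x \<le> n - r + x \<and> n - r + x \<le> n" if "x \<in> {1..r}" for x
    using en_bounds[OF sub(2,4) that] rn that by auto
  have bA: "1 \<le> id x \<and> id x \<le> en A x \<and> en A x \<le> n" if "x \<in> {1..r}" for x
    using en_bounds[OF sub(1,3) that] that by auto
  have c0: "pl r (\<lambda>i. if i \<le> 0 then a i else b i) K = pl r b K" if "strict_mono_on {1..r} b" for a b K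
    by (rule pl_cong[OF _ strict_mono_on_imp_inj_on[OF that]]) auto
  from shift_letters[where src = "en B" and dst = "\<lambda>x. n - r + x" and L = L and u = 0, OF smB smn bB L1] obtain c1
    where c1: "c1 \<noteq> 0" "act (T_set_bar n B) (dl (pl r (en B) L)) = (\<lambda>w. c1 * dl (pl r (\<lambda>x. n - r + x) L) w)"
    unfolding T_set_bar_en[OF sub(4)] c0[OF smn] by (metis le0)
  from shift_letters[where src = id and dst = "en A" and L = "L \<circ> p" and u = 0, OF smi smA bA L2] obtain c3
    where c3: "c3 \<noteq> 0" "act (T_set A) (dl (pl r id (L \<circ> p))) = (\<lambda>w. c3 * dl (pl r (en A) (L \<circ> p)) w)"
    unfolding T_set_en[OF sub(3)] c0[OF smA] id_apply by (metis le0)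
  obtain c2 where c2: "c2 \<noteq> 0" "act (T_perm r p) (dl (pl r id L)) = (\<lambda>w. c2 * dl (pl r id (L \<circ> p)) w)"
    using act_T_perm[OF p rn L] by blast
  let ?c = "c1 * q ^ ((n - r) * r) * c2 * c3"
  have inj: "inj_on id {1..r}" by simp
  have N: "act (gN ^ (n - r) * T_set_bar n B) (dl (pl r (en B) L)) w = c1 * q ^ ((n - r) * r) * dl (pl r id L) w"
    if w: "w \<in> words d n" for w
  proof -
    have "act (gN ^ (n - r) * T_set_bar n B) (dl (pl r (en B) L)) w = c1 * (opr GN ^^ (n - r)) (dl (pl r (\<lambda>x. n - r + x) L)) w"
      unfolding act_mult c1 act_f_mult act_N_pow ..
    also have "\<dots> = c1 * q ^ ((n - r) * r) * dl (pl r id L) w"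
    proof -
      have "(opr GN ^^ (n - r)) (dl (pl r (\<lambda>x. n - r + x) L)) w = q ^ ((n - r) * r) * dl (pl r id L) w"
        by (rule opr_N_pow_dl[OF rn _ w]) (use L1 in blast)
      then show ?thesis by (simp only: mult.assoc)
    qed
    finally show ?thesis .
  qed
  have main: "act (Cel n r A B m p) (dl (pl r (en B) L)) w
     = ?c * (\<Prod>i\<in>{1..r}. \<chi> (col d (L (p i))) ^ m i) * dl (pl r (en A) (L \<circ> p)) w" if w: "w \<in> words d n" for m w
  proof -
    let ?x = "T_set A * F_mono r m * T_perm r p :: 'k free"
    have x: "?x \<in> carr n" by (intro carr_mult carr_T_set[OF A] carr_F_mono carr_T_perm p rn)
    have "act (Cel n r A B m p) (dl (pl r (en B) L)) w = act ?x (act (gN ^ (n - r) * T_set_bar n B) (dl (pl r (en B) L))) w"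
      unfolding Cel_def act_mult[symmetric] by (simp only: mult.assoc)
    also have "\<dots> = act ?x (\<lambda>w. c1 * q ^ ((n - r) * r) * dl (pl r id L) w) w"
      using x by (intro act_local[OF _ N w]) (simp add: carr_def)
    also have "\<dots> = c1 * q ^ ((n - r) * r) * (c2 * ((\<Prod>i\<in>{1..r}. \<chi> (col d (pl r id (L \<circ> p) i)) ^ m i) * (c3 * dl (pl r (en A) (L \<circ> p)) w)))"
      unfolding act_f_mult act_mult c2(2) act_F_mono c3(2) ..
    also have "(\<Prod>i\<in>{1..r}. \<chi> (col d (pl r id (L \<circ> p) i)) ^ m i) = (\<Prod>i\<in>{1..r}. \<chi> (col d (L (p i))) ^ m i)"
    proof (rule prod.cong[OF refl])
      fix i assume "i \<in> {1..r}"
      from pl_at[OF inj this, of "L \<circ> p"] show "\<chi> (col d (pl r id (L \<circ> p) i)) ^ m i = \<chi> (col d (L (p i))) ^ m i" by simp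
    qed
    finally show ?thesis by (simp only: mult_ac)
  qed
  have "?c \<noteq> 0" using c1(1) c2(1) c3(1) q0 by simp
  then show ?thesis using main by blast
qed

theorem Cel_independent:
  assumes rel: "\<And>f w. w \<in> words d n \<Longrightarrow> (\<Sum>\<alpha>\<in>Cidx d n. c \<alpha> * act (CX n \<alpha>) f w) = 0"
    and mem: "\<alpha> \<in> Cidx d n"
  shows "c \<alpha> = 0"
proof (rule ccontr)
  assume nz: "c \<alpha> \<noteq> 0"
  define S where "S = {\<alpha> \<in> Cidx d n. c \<alpha> \<noteq> 0}"
  have S: "finite S" "S \<noteq> {}" using nz mem finite_Cidx[of d n] unfolding S_def by (simp, blast)
  define r where "r = Max (fst ` S)"
  have rS: "r \<in> fst ` S" unfolding r_def using S by (intro Max_in) auto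
  have rmax: "fst \<beta> \<le> r" if "\<beta> \<in> S" for \<beta>
    unfolding r_def using S that by (intro Max_ge) auto
  define wt where "wt \<beta> = (\<Sum>b\<in>fst (snd (snd \<beta>)). (2::nat) ^ b)" for \<beta> :: "nat \<times> nat set \<times> nat set \<times> (nat \<Rightarrow> nat) \<times> (nat \<Rightarrow> nat)"
  define S' where "S' = {\<beta> \<in> S. fst \<beta> = r}"
  have S': "finite S'" "S' \<noteq> {}" using S rS by (auto simp: S'_def)
  define \<gamma> where "\<gamma> = arg_min_on wt S'"
  have \<gamma>: "\<gamma> \<in> S'" unfolding \<gamma>_def by (rule arg_min_if_finite(1)[OF S'])
  have \<gamma>_min: "wt \<gamma> \<le> wt \<beta>" if "\<beta> \<in> S'" for \<beta>
    unfolding \<gamma>_def using arg_min_if_finite(2)[OF S'] that by (meson not_le)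
  obtain r' A B m0 p where "\<gamma> = (r', A, B, m0, p)" by (cases \<gamma>)
  then have g: "\<gamma> = (r, A, B, m0, p)" using \<gamma> by (simp add: S'_def)
  have G: "\<gamma> \<in> Cidx d n" "c \<gamma> \<noteq> 0" using \<gamma> by (auto simp: S'_def S_def)
  have A: "A \<in> subs n r" and B: "B \<in> subs n r" and m0: "m0 \<in> {1..r} \<rightarrow>\<^sub>E {0..<d}" and p: "p permutes {1..r}"
    and rn: "r \<in> {0..n}"
    using G(1) unfolding g Cidx_def by auto
  have cB: "card B = r" "B \<subseteq> {1..n}" using B by (auto simp: subs_def)
  have fB: "finite B" using cB(2) finite_subset by blast
  have key: "(\<Sum>m\<in>{1..r} \<rightarrow>\<^sub>E {0..<d}. c (r, A, B, m, p) * (\<Prod>i\<in>{1..r}. x i ^ m i)) = 0"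
    if x: "\<And>i. i \<in> {1..r} \<Longrightarrow> x i \<in> \<chi> ` {1..d}" for x
  proof -
    have "\<forall>i\<in>{1..r}. \<exists>s\<in>{1..d}. x i = \<chi> s" using x by blast
    then obtain s where s: "\<And>i. i \<in> {1..r} \<Longrightarrow> s i \<in> {1..d} \<and> x i = \<chi> (s i)" by metis
    \<comment> \<open>Colours are assigned through the inverse of \<open>p\<close>, so that the
      letter \<open>L (p i)\<close> has the prescribed eigenvalue \<open>x i\<close>. The indices
      decrease as the pure action demands.\<close>
    define L where "L i = V (r + 1 - i) (s (inv_into UNIV p i))" for i
    have ip: "inv_into UNIV p i \<in> {1..r}" if "i \<in> {1..r}" for i
      using permutes_in_image[OF permutes_inv[OF p]] that by blast
    have Lp: "\<chi> (col d (L (p i))) = x i" if "i \<in> {1..r}" for i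
      using s[OF that] permutes_inverses(2)[OF p] by (simp add: L_def)
    have L: "L i \<in> ubasis d n \<and> idx (L i) = r + 1 - i" if "i \<in> {1..r}" for i
      using s[OF ip[OF that]] that rn by (auto simp: L_def ubasis_def)
    have L0: "L i \<in> ubasis d n \<and> L i \<noteq> V0" if "i \<in> {1..r}" for i using L[OF that] by (simp add: L_def)
    have Linj: "inj_on L {1..r}"
    proof (rule inj_onI)
      fix a b assume ab: "a \<in> {1..r}" "b \<in> {1..r}" "L a = L b"
      then have "r + 1 - a = r + 1 - b" by (simp add: L_def)
      then show "a = b" using ab by auto
    qed
    define f where "f = (dl (pl r (en B) L) :: (nat \<Rightarrow> ubas) \<Rightarrow> 'f)"
    define w where "w = pl r (en A) (L \<circ> p)"
    have cA: "card A = r" "A \<subseteq> {1..n}" using A by (auto simp: subs_def)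
    have fA: "finite A" using cA(2) finite_subset by blast
    have injA: "inj_on (en A) {1..r}" "en A ` {1..r} = A" using en_inj[OF fA] en_image[OF fA] cA by simp_all
    have injB: "inj_on (en B) {1..r}" "en B ` {1..r} = B" using en_inj[OF fB] en_image[OF fB] cB by simp_all
    have w: "w \<in> words d n" unfolding w_def
    proof (rule pl_words[OF injA(1)])
      show "en A ` {1..r} \<subseteq> {1..n}" using injA(2) cA(2) by simp
      fix i assume "i \<in> {1..r}"
      then have "p i \<in> {1..r}" using permutes_in_image[OF p] by blast
      then show "(L \<circ> p) i \<in> ubasis d n" using L by simp
    qed
    have cnt: "cnt n (pl r (en B) L) = r"
      by (rule pl_cnt[OF injB(1)]) (use injB(2) cB(2) L0 in auto)
    have sf: "supp_on (\<lambda>w. cnt n w = r) f" using cnt by (auto simp: f_def supp_on_def dl_def)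
    obtain K where K: "K \<noteq> 0" "\<And>m. act (Cel n r A B m p) f w = K * (\<Prod>i\<in>{1..r}. \<chi> (col d (L (p i))) ^ m i)"
      using pure_action[OF A B p L] w unfolding f_def w_def by (auto simp: dl_def)
    let ?M = "{1..r} \<rightarrow>\<^sub>E {0..<d}"
    let ?R = "(\<lambda>m. (r, A, B, m, p)) ` ?M"
    \<comment> \<open>Four reasons for a term outside \<open>?R\<close> to vanish at
      \<open>w\<close>: its coefficient is 0, its rank is smaller, its right-hand set has larger
      weight or the same weight but differs from \<open>B\<close>, or its image is a basis word
      other than \<open>w\<close>.\<close>
    have zero: "c \<beta> * act (CX n \<beta>) f w = 0" if \<beta>: "\<beta> \<in> Cidx d n - ?R" for \<beta>
    proof (cases "\<beta> \<in> S")
      case False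
      then show ?thesis using \<beta> by (simp add: S_def)
    next
      case True
      obtain k A' B' m' p' where b: "\<beta> = (k, A', B', m', p')" by (cases \<beta>)
      have A': "A' \<in> subs n k" and B': "B' \<in> subs n k" and p': "p' permutes {1..k}" and m': "m' \<in> {1..k} \<rightarrow>\<^sub>E {0..<d}"
        using \<beta> unfolding b Cidx_def by auto
      have "act (CX n \<beta>) f w = 0"
      proof (cases "k = r")
        case False
        then have "k < r" using rmax[OF True] b by simp
        then show ?thesis unfolding b CX_def using lower_level_zero[OF A' B' p' _ sf w] by simp
      next
        case k: True
        have "\<beta> \<in> S'" using True b k by (simp add: S'_def)
        then have le: "(\<Sum>b\<in>B. 2 ^ b) \<le> (\<Sum>b\<in>B'. (2::nat) ^ b)" using \<gamma>_min[of \<beta>] by (simp add: wt_def g b)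
        show ?thesis
        proof (cases "B' = B")
          case False
          then show ?thesis unfolding b CX_def f_def
            using other_B_zero[OF A'[unfolded k] B'[unfolded k] B p'[unfolded k] _ le L0 w] k by simp
        next
          case BB: True
          obtain K' where K': "act (Cel n r A' B m' p') f w = K' * dl (pl r (en A') (L \<circ> p')) w"
            using pure_action[OF A'[unfolded k] B p'[unfolded k] L] w unfolding f_def by blast
          have "\<not> (A' = A \<and> p' = p)" using \<beta> m' unfolding b k BB by blast
          then have "pl r (en A') (L \<circ> p') \<noteq> w"
            using pl_inj[OF A'[unfolded k] A p'[unfolded k] p _ Linj] L0 unfolding w_def by blast
          then show ?thesis unfolding b CX_def using K' k BB by (simp add: dl_def)
        qed
      qed
      then show ?thesis by simp
    qed
    have Rsub: "?R \<subseteq> Cidx d n" using A B p rn by (auto simp: Cidx_def)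
    have "0 = (\<Sum>\<beta>\<in>Cidx d n. c \<beta> * act (CX n \<beta>) f w)" using rel[OF w] by simp
    also have "\<dots> = (\<Sum>\<beta>\<in>?R. c \<beta> * act (CX n \<beta>) f w)"
      by (rule sum.mono_neutral_right[OF finite_Cidx Rsub]) (use zero in blast)
    also have "\<dots> = (\<Sum>m\<in>?M. c (r, A, B, m, p) * act (Cel n r A B m p) f w)"
      by (subst sum.reindex) (auto simp: inj_on_def CX_def)
    also have "\<dots> = K * (\<Sum>m\<in>?M. c (r, A, B, m, p) * (\<Prod>i\<in>{1..r}. x i ^ m i))"
      unfolding K(2) sum_distrib_left
    proof (rule sum.cong[OF refl])
      fix m
      have "(\<Prod>i\<in>{1..r}. \<chi> (col d (L (p i))) ^ m i) = (\<Prod>i\<in>{1..r}. x i ^ m i)"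
        by (rule prod.cong[OF refl]) (simp only: Lp)
      then show "c (r, A, B, m, p) * (K * (\<Prod>i\<in>{1..r}. \<chi> (col d (L (p i))) ^ m i))
        = K * (c (r, A, B, m, p) * (\<Prod>i\<in>{1..r}. x i ^ m i))" by (simp only: mult.left_commute)
    qed
    finally show ?thesis using K(1) by simp
  qed
  have "card (\<chi> ` {1..d}) = d" using card_image[OF \<chi>_inj] by simp
  then have "c (r, A, B, m0, p) = 0"
    by (intro monomials_independent[of "{1..r}" "\<chi> ` {1..d}" d "\<lambda>m. c (r, A, B, m, p)", OF _ _ _ key m0])
       simp_all
  then show False using G(2) g by simp
qed

end

section \<open>Calculations modulo the relations\<close>

lemma tp_range: "(i :: nat) \<in> {1..<n} \<Longrightarrow> k \<in> {1..n} \<Longrightarrow> tp i (i + 1) k \<in> {1..n}"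
  by (auto simp: transpose_def)

lemma scal_comm: "x * scal c = scal c * (x :: 'x list \<Rightarrow>\<^sub>0 'a::comm_ring_1)"
proof -
  have "x * scal c = (\<Sum>l\<in>Poly_Mapping.keys x. Poly_Mapping.single l (c * Poly_Mapping.lookup x l))"
    by (subst (1) pm_single_split[of x]) (simp add: sum_distrib_right mult.commute)
  also have "\<dots> = scal c * x"
    by (subst (3) pm_single_split[of x]) (simp add: sum_distrib_left)
  finally show ?thesis .
qed

lemma scal_left_comm: "x * (scal c * y) = scal c * (x * (y :: 'x list \<Rightarrow>\<^sub>0 'a::comm_ring_1))"
  by (simp add: mult.assoc[symmetric] scal_comm)

lemma scal_1: "scal 1 = (1 :: 'x list \<Rightarrow>\<^sub>0 'a::comm_ring_1)"
  by (metis scal_def single_one zero_list_def)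
lemma scal_0: "scal 0 = (0 :: 'x list \<Rightarrow>\<^sub>0 'a::comm_ring_1)"
  by (simp add: scal_def)
lemma scal_add: "scal (a + b) = scal a + (scal b :: 'x list \<Rightarrow>\<^sub>0 'a::comm_ring_1)"
  by (simp add: scal_def single_add)
lemma scal_mult: "scal (a * b) = scal a * (scal b :: 'x list \<Rightarrow>\<^sub>0 'a::comm_ring_1)"
  by (simp add: scal_def mult_single plus_list_def)

definition wd :: "gen list \<Rightarrow> 'k::field_char_0 free" where "wd l = Poly_Mapping.single l 1"

lemma wd_Nil: "wd [] = 1"
  unfolding wd_def using scal_1 unfolding scal_def .
lemma wd_append: "wd (l @ l') = wd l * wd l'"
  by (simp add: wd_def mult_single plus_list_def)
lemma wd_Cons: "wd (g # l) = wd [g] * wd l"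
  using wd_append[of "[g]" l] by simp
lemma wd_gens: "wd [GT i] = gT i" "wd [GF i] = gF i" "wd [GN] = gN"
  by (simp_all add: wd_def gT_def gF_def gN_def)

abbreviation tw :: "nat list \<Rightarrow> 'k::field_char_0 free" where "tw js \<equiv> prod_list (map gT js)"

text \<open>\<open>J\<close> is an ideal of the free algebra on all generators and contains those
  outside \<open>gens n\<close>. Rewriting modulo \<open>J\<close> therefore carries no membership
  conditions on the factors.\<close>

locale RYmod =
  fixes d n :: nat and J :: "'k::field_char_0 free set"
  assumes n1: "1 \<le> n" and d1: "1 \<le> d"
    and J_0: "0 \<in> J" and J_add: "x \<in> J \<Longrightarrow> y \<in> J \<Longrightarrow> x + y \<in> J"
    and J_left: "x \<in> J \<Longrightarrow> a * x \<in> J" and J_right: "x \<in> J \<Longrightarrow> x * a \<in> J"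
    and J_rel: "x \<in> relators d n \<Longrightarrow> x \<in> J"
    and J_out: "g \<notin> gens n \<Longrightarrow> wd [g] \<in> J"
begin

section \<open>Congruences, spans and subalgebras modulo the ideal\<close>

definition cong :: "'k free \<Rightarrow> 'k free \<Rightarrow> bool" (infix "\<approx>" 50) where "x \<approx> y \<longleftrightarrow> x - y \<in> J"

lemma J_minus: "x \<in> J \<Longrightarrow> - x \<in> J" using J_left[of x "-1"] by simp
lemma c_refl [simp, intro]: "x \<approx> x" by (simp add: cong_def J_0)
lemma c_sym: "x \<approx> y \<Longrightarrow> y \<approx> x" unfolding cong_def using J_minus[of "x - y"] by simp
lemma c_trans [trans]: "x \<approx> y \<Longrightarrow> y \<approx> z \<Longrightarrow> x \<approx> z"
  unfolding cong_def using J_add[of "x - y" "y - z"] by simp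
lemma c_eq1 [trans]: "x = y \<Longrightarrow> y \<approx> z \<Longrightarrow> x \<approx> z" by simp
lemma c_eq2 [trans]: "x \<approx> y \<Longrightarrow> y = z \<Longrightarrow> x \<approx> z" by simp
lemma c_l: "x \<approx> y \<Longrightarrow> a * x \<approx> a * y"
  unfolding cong_def using J_left[of "x - y" a] by (simp add: right_diff_distrib)
lemma c_r: "x \<approx> y \<Longrightarrow> x * a \<approx> y * a"
  unfolding cong_def using J_right[of "x - y" a] by (simp add: left_diff_distrib)
lemma c_mult: "x \<approx> y \<Longrightarrow> x' \<approx> y' \<Longrightarrow> x * x' \<approx> y * y'"
  using c_trans[OF c_r[of x y x'] c_l[of x' y' y]] .
lemma c_pow: "x \<approx> y \<Longrightarrow> x ^ k \<approx> y ^ k"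
  by (induction k) (auto intro: c_mult)
lemma c_relator: "x - y \<in> relators d n \<Longrightarrow> x \<approx> y"
  unfolding cong_def by (rule J_rel)

lemma TT: "\<lbrakk>i \<in> {1..<n}; k \<in> {1..<n}; k > i + 1 \<or> i > k + 1\<rbrakk> \<Longrightarrow> gT i * gT k \<approx> gT k * gT i"
  by (intro c_relator relators.T_comm)
lemma braid: "\<lbrakk>i \<in> {1..<n}; i + 1 \<in> {1..<n}\<rbrakk> \<Longrightarrow> gT i * gT (i + 1) * gT i \<approx> gT (i + 1) * gT i * gT (i + 1)"
  by (intro c_relator relators.braid) auto
lemma FF: "\<lbrakk>i \<in> {1..n}; k \<in> {1..n}\<rbrakk> \<Longrightarrow> gF i * gF k \<approx> gF k * gF i"
  by (intro c_relator relators.F_comm)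
lemma F_pow: "i \<in> {1..n} \<Longrightarrow> gF i ^ d \<approx> 1"
  by (intro c_relator relators.F_order)
lemma TF: "\<lbrakk>i \<in> {1..<n}; k \<in> {1..n}\<rbrakk> \<Longrightarrow> gT i * gF k \<approx> gF (tp i (i + 1) k) * gT i"
  by (intro c_relator relators.T_F)
lemma FT: "\<lbrakk>i \<in> {1..<n}; k \<in> {1..n}\<rbrakk> \<Longrightarrow> gF k * gT i \<approx> gT i * gF (tp i (i + 1) k)"
proof -
  assume i: "i \<in> {1..<n}" "k \<in> {1..n}"
  then have "tp i (i + 1) k \<in> {1..n}" by (auto simp: transpose_def)
  from c_sym[OF TF[OF i(1) this]] show ?thesis by simp
qed

text \<open>The coefficient of \<open>T_i\<close> on the right of the quadratic relation. It
  involves only \<open>F\<close>s, which can be pushed through words in the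
  \<open>T\<close>s.\<close>

definition zq :: "nat \<Rightarrow> 'k free" where "zq i = scal (uvar - 1) * gF i ^ ((d\<^sup>2 - d) div 2) * gE d i"

lemma T_sq: "i \<in> {1..<n} \<Longrightarrow> gT i * gT i \<approx> scal uvar + zq i * gT i"
  unfolding zq_def using c_relator[OF relators.quadratic, of i] by (simp add: power2_eq_square mult.assoc)

text \<open>The linear span of \<open>S\<close> enlarged by \<open>J\<close>, so that congruent
  elements may replace each other inside a span.\<close>

inductive_set spn :: "'k free set \<Rightarrow> 'k free set" for S where
  spn_base: "x \<in> S \<Longrightarrow> x \<in> spn S"
| spn_J: "x \<in> J \<Longrightarrow> x \<in> spn S"
| spn_add: "x \<in> spn S \<Longrightarrow> y \<in> spn S \<Longrightarrow> x + y \<in> spn S"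
| spn_scal: "x \<in> spn S \<Longrightarrow> scal c * x \<in> spn S"

lemma spn_cong: "x \<approx> y \<Longrightarrow> y \<in> spn S \<Longrightarrow> x \<in> spn S"
  using spn_add[OF spn_J, of "x - y" y S] by (simp add: cong_def)

lemma spn_map:
  assumes "\<And>x. x \<in> S \<Longrightarrow> a * x * b \<in> spn S'" "x \<in> spn S"
  shows "a * x * b \<in> spn S'"
  using assms(2)
proof induction
  case (spn_base x) then show ?case by (rule assms(1))
next
  case (spn_J x) then show ?case by (intro spn.spn_J J_left J_right)
next
  case (spn_add x y) then show ?case by (simp add: distrib_left distrib_right spn.spn_add)
next
  case (spn_scal x c)
  have "a * (scal c * x) * b = scal c * (a * x * b)" by (simp add: scal_left_comm mult.assoc)
  then show ?case using spn.spn_scal[OF spn_scal.IH] by simp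
qed

lemma spn_map_left: "(\<And>x. x \<in> S \<Longrightarrow> a * x \<in> spn S') \<Longrightarrow> x \<in> spn S \<Longrightarrow> a * x \<in> spn S'"
  using spn_map[of S a 1 S' x] by simp
lemma spn_map_right: "(\<And>x. x \<in> S \<Longrightarrow> x * b \<in> spn S') \<Longrightarrow> x \<in> spn S \<Longrightarrow> x * b \<in> spn S'"
  using spn_map[of S 1 b S' x] by simp
lemma spn_mono: "(\<And>x. x \<in> S \<Longrightarrow> x \<in> spn S') \<Longrightarrow> x \<in> spn S \<Longrightarrow> x \<in> spn S'"
  using spn_map[of S 1 1 S' x] by simp
lemma spn_sum: "(\<And>a. a \<in> A \<Longrightarrow> f a \<in> spn S) \<Longrightarrow> sum f A \<in> spn S"
  by (induction A rule: infinite_finite_induct) (auto intro: spn.intros J_0)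

definition alg :: "gen set \<Rightarrow> 'k free set" where "alg G = spn (wd ` lists G)"

lemma alg_1: "1 \<in> alg G"
  unfolding alg_def by (rule spn_base) (metis wd_Nil imageI lists.Nil)
lemma alg_gen: "g \<in> G \<Longrightarrow> wd [g] \<in> alg G"
  unfolding alg_def by (rule spn_base) auto

text \<open>The pattern of the normal forms below: once single generators map the spanning set into
  its span, the span is a left module over the subalgebra they generate.\<close>

lemma left_closed:
  assumes S: "\<And>g x. g \<in> G \<Longrightarrow> x \<in> S \<Longrightarrow> wd [g] * x \<in> spn S" and x: "x \<in> spn S" and a: "a \<in> alg G"
  shows "a * x \<in> spn S"
proof -
  have w: "wd l * x \<in> spn S" if "l \<in> lists G" for l
    using that
  proof (induction l)
    case Nil then show ?case using x by (simp add: wd_Nil)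
  next
    case (Cons g l)
    have "wd [g] * (wd l * x) \<in> spn S" by (rule spn_map_left[OF S Cons.IH]) (use Cons.hyps in auto)
    then show ?case by (subst wd_Cons) (simp add: mult.assoc)
  qed
  show ?thesis
    by (rule spn_map_right[OF _ a[unfolded alg_def]]) (use w in blast)
qed

lemma right_closed:
  assumes S: "\<And>g x. g \<in> G \<Longrightarrow> x \<in> S \<Longrightarrow> x * wd [g] \<in> spn S" and x: "x \<in> spn S" and a: "a \<in> alg G"
  shows "x * a \<in> spn S"
proof -
  have w: "x * wd l \<in> spn S" if "l \<in> lists G" for l
    using that
  proof (induction l rule: rev_induct)
    case Nil then show ?case using x by (simp add: wd_Nil)
  next
    case (snoc g l)
    have "(x * wd l) * wd [g] \<in> spn S" by (rule spn_map_right[OF S snoc.IH]) (use snoc.prems in auto)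
    then show ?case by (simp add: wd_append mult.assoc)
  qed
  show ?thesis
    by (rule spn_map_left[OF _ a[unfolded alg_def]]) (use w in blast)
qed

lemma alg_mult: "x \<in> alg G \<Longrightarrow> y \<in> alg G \<Longrightarrow> x * y \<in> alg G"
proof -
  assume x: "x \<in> alg G" and y: "y \<in> alg G"
  have "x * y \<in> spn (wd ` lists G)"
  proof (rule left_closed[OF _ y[unfolded alg_def] x])
    fix g and z :: "'k free" assume "g \<in> G" "z \<in> wd ` lists G"
    then obtain l where "l \<in> lists G" "z = wd l" by blast
    then have "wd [g] * z = wd (g # l)" by (simp only: wd_Cons[of g l])
    moreover have "g # l \<in> lists G" using \<open>g \<in> G\<close> \<open>l \<in> lists G\<close> by simp
    ultimately show "wd [g] * z \<in> spn (wd ` lists G)" using spn_base by simp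
  qed
  then show ?thesis by (simp add: alg_def)
qed

lemma alg_scal: "scal c \<in> alg G"
  using spn_scal[of 1 "wd ` lists G" c] alg_1[of G] by (simp add: alg_def)
lemma alg_sum: "(\<And>a. a \<in> A \<Longrightarrow> f a \<in> alg G) \<Longrightarrow> sum f A \<in> alg G"
  unfolding alg_def by (rule spn_sum)
lemma alg_pow: "x \<in> alg G \<Longrightarrow> x ^ k \<in> alg G"
  by (induction k) (simp_all add: alg_1 alg_mult)
lemma alg_prod_list: "(\<And>x. x \<in> set xs \<Longrightarrow> x \<in> alg G) \<Longrightarrow> prod_list xs \<in> alg G"
  by (induction xs) (simp_all add: alg_1 alg_mult)
lemma alg_tw: "(\<And>i. i \<in> set js \<Longrightarrow> GT i \<in> G) \<Longrightarrow> tw js \<in> alg G"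
  using alg_gen by (intro alg_prod_list) (auto simp: wd_gens[symmetric])

definition GFs :: "gen set" where "GFs = GF ` {1..n}"

lemma zq_alg: "i \<in> {1..<n} \<Longrightarrow> zq i \<in> alg GFs"
proof -
  assume i: "i \<in> {1..<n}"
  have f: "gF i \<in> alg GFs" "gF (i + 1) \<in> alg GFs"
    unfolding wd_gens[symmetric] using i by (auto simp: GFs_def intro!: alg_gen)
  show ?thesis unfolding zq_def gE_def
    by (intro alg_mult alg_scal alg_pow f alg_sum)
qed

lemma F_tw:
  assumes "set js \<subseteq> {1..<n}" "k \<in> {1..n}"
  shows "\<exists>k'\<in>{1..n}. gF k * tw js \<approx> tw js * gF k'"
  using assms
proof (induction js arbitrary: k)
  case Nil then show ?case by (intro bexI[of _ k]) simp_all
next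
  case (Cons a js)
  have a: "a \<in> {1..<n}" using Cons.prems by simp
  obtain k' where k': "k' \<in> {1..n}" "gF (tp a (a + 1) k) * tw js \<approx> tw js * gF k'"
    using Cons.IH[OF _ tp_range[OF a Cons.prems(2)]] Cons.prems by auto
  have "gF k * tw (a # js) = (gF k * gT a) * tw js" by (simp add: mult.assoc)
  also have "\<dots> \<approx> (gT a * gF (tp a (a + 1) k)) * tw js" by (intro c_r FT a Cons.prems)
  also have "\<dots> = gT a * (gF (tp a (a + 1) k) * tw js)" by (simp add: mult.assoc)
  also have "\<dots> \<approx> gT a * (tw js * gF k')" by (intro c_l k')
  also have "\<dots> = tw (a # js) * gF k'" by (simp add: mult.assoc)
  finally show ?case using k'(1) by blast
qed

lemma tw_F:
  assumes "set js \<subseteq> {1..<n}" "k \<in> {1..n}"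
  shows "\<exists>k'\<in>{1..n}. tw js * gF k \<approx> gF k' * tw js"
  using assms
proof (induction js arbitrary: k rule: rev_induct)
  case Nil then show ?case by (intro bexI[of _ k]) simp_all
next
  case (snoc a js)
  have a: "a \<in> {1..<n}" using snoc.prems by simp
  obtain k' where k': "k' \<in> {1..n}" "tw js * gF (tp a (a + 1) k) \<approx> gF k' * tw js"
    using snoc.IH[OF _ tp_range[OF a snoc.prems(2)]] snoc.prems by auto
  have "tw (js @ [a]) * gF k = tw js * (gT a * gF k)" by (simp add: mult.assoc)
  also have "\<dots> \<approx> tw js * (gF (tp a (a + 1) k) * gT a)" by (intro c_l TF a snoc.prems)
  also have "\<dots> = (tw js * gF (tp a (a + 1) k)) * gT a" by (simp add: mult.assoc)
  also have "\<dots> \<approx> gF k' * tw js * gT a" by (intro c_r k')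
  also have "\<dots> = gF k' * tw (js @ [a])" by (simp add: mult.assoc)
  finally show ?case using k'(1) by blast
qed

lemma T_tw_comm:
  assumes "i \<in> {1..<n}" "\<And>k. k \<in> set js \<Longrightarrow> k \<in> {1..<n} \<and> (k > i + 1 \<or> i > k + 1)"
  shows "gT i * tw js \<approx> tw js * gT i"
  using assms(2)
proof (induction js)
  case Nil then show ?case by simp
next
  case (Cons a js)
  have a: "a \<in> {1..<n}" "a > i + 1 \<or> i > a + 1" using Cons.prems by auto
  have IH: "gT i * tw js \<approx> tw js * gT i" by (rule Cons.IH) (use Cons.prems in auto)
  have "gT i * tw (a # js) = (gT i * gT a) * tw js" by (simp add: mult.assoc)
  also have "\<dots> \<approx> (gT a * gT i) * tw js" by (intro c_r TT assms(1) a)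
  also have "\<dots> = gT a * (gT i * tw js)" by (simp add: mult.assoc)
  also have "\<dots> \<approx> gT a * (tw js * gT i)" by (intro c_l IH)
  finally show ?case by (simp add: mult.assoc)
qed

section \<open>Sliding generators through chains, and coset decompositions\<close>

lemma T_down_split:
  assumes "i \<le> k" "k \<le> a" shows "T_down a i = T_down a k * T_down k i"
proof -
  have "[i..<a] = [i..<k] @ [k..<a]" using assms upt_add_eq_append[of i k "a - k"] by simp
  then show ?thesis by (simp add: T_down_def)
qed

lemma T_down_Suc: "i \<le> a \<Longrightarrow> T_down (Suc a) i = gT a * T_down a i"
  by (simp add: T_down_def)
lemma T_down_step: "i < a \<Longrightarrow> T_down a i = T_down a (Suc i) * gT i"
  by (simp add: T_down_def upt_conv_Cons)
lemma T_down_refl [simp]: "T_down a a = 1"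
  by (simp add: T_down_def)

text \<open>\<open>T_k\<close> commutes with the factors above \<open>k + 1\<close>, turns into
  \<open>T_{k+1}\<close> by one braid relation, and commutes with the factors below
  \<open>k\<close>.\<close>

lemma slide:
  assumes "1 \<le> i" "i \<le> k" "Suc k < a" "a \<le> n"
  shows "gT k * T_down a i \<approx> T_down a i * gT (Suc k)"
proof -
  have k: "k \<in> {1..<n}" "k + 1 \<in> {1..<n}" using assms by auto
  have s: "(T_down a i :: 'k free) = T_down a (k + 2) * gT (k + 1) * gT k * T_down k i"
  proof -
    have "(T_down a i :: 'k free) = T_down a (k + 2) * T_down (k + 2) i" using assms by (intro T_down_split) auto
    also have "(T_down (k + 2) i :: 'k free) = gT (k + 1) * (gT k * T_down k i)"
    proof -
      have "T_down (Suc (Suc k)) i = gT (Suc k) * (T_down (Suc k) i :: 'k free)" using assms by (intro T_down_Suc) simp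
      also have "T_down (Suc k) i = gT k * (T_down k i :: 'k free)" using assms by (intro T_down_Suc) simp
      finally show ?thesis by simp
    qed
    finally show ?thesis by (simp add: mult.assoc)
  qed
  have 1: "gT k * T_down a (k + 2) \<approx> T_down a (k + 2) * gT k"
    unfolding T_down_def using assms by (intro T_tw_comm k) auto
  have 2: "gT (k + 1) * T_down k i \<approx> T_down k i * gT (k + 1)"
    unfolding T_down_def using assms by (intro T_tw_comm k) auto
  have "(gT k * T_down a i :: 'k free) = (gT k * T_down a (k + 2)) * (gT (k + 1) * gT k * T_down k i)"
    unfolding s by (simp add: mult.assoc)
  also have "\<dots> \<approx> (T_down a (k + 2) * gT k) * (gT (k + 1) * gT k * T_down k i)" by (intro c_r 1)
  also have "\<dots> = T_down a (k + 2) * (gT k * gT (k + 1) * gT k) * T_down k i" by (simp add: mult.assoc)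
  also have "\<dots> \<approx> T_down a (k + 2) * (gT (k + 1) * gT k * gT (k + 1)) * T_down k i" by (intro c_r c_l braid k)
  also have "\<dots> = T_down a (k + 2) * gT (k + 1) * gT k * (gT (k + 1) * T_down k i)" by (simp add: mult.assoc)
  also have "\<dots> \<approx> T_down a (k + 2) * gT (k + 1) * gT k * (T_down k i * gT (k + 1))" by (intro c_l 2)
  also have "\<dots> = T_down a i * gT (Suc k)" unfolding s by (simp add: mult.assoc)
  finally show ?thesis .
qed

text \<open>Generators of parabolic subalgebras, here for the positions \<open>i, ..., n\<close> and
  next for \<open>1, ..., m\<close>. Each contains all the \<open>F\<close>s, so these can be moved
  freely.\<close>

definition G_from :: "nat \<Rightarrow> gen set" where "G_from i = GT ` {i..<n} \<union> GFs"
definition G_upto :: "nat \<Rightarrow> gen set" where "G_upto m = GT ` {1..<m} \<union> GFs"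

lemma F_alg: "k \<in> {1..n} \<Longrightarrow> GFs \<subseteq> G \<Longrightarrow> gF k \<in> alg G"
  unfolding wd_gens[symmetric] by (rule alg_gen) (auto simp: GFs_def)
lemma T_alg: "GT k \<in> G \<Longrightarrow> gT k \<in> alg G"
  unfolding wd_gens[symmetric] by (rule alg_gen)

lemma GFs_sub: "GFs \<subseteq> G_from i" "GFs \<subseteq> G_upto i"
  by (auto simp: G_from_def G_upto_def)

lemma left_F:
  assumes "set js \<subseteq> {1..<n}" "GFs \<subseteq> G" "z \<in> alg GFs" "y \<in> alg G"
  shows "z * (tw js * y) \<in> spn {tw js * y |y. y \<in> alg G}"
proof (rule left_closed[OF _ _ assms(3)])
  show "tw js * y \<in> spn {tw js * y |y. y \<in> alg G}" using assms(4) by (intro spn_base) blast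
  fix g x assume "g \<in> GFs" "x \<in> {tw js * y |y. y \<in> alg G}"
  then obtain k y where k: "k \<in> {1..n}" "g = GF k" and y: "y \<in> alg G" "x = tw js * y" by (auto simp: GFs_def)
  obtain k' where k': "k' \<in> {1..n}" "gF k * tw js \<approx> tw js * gF k'" using F_tw[OF assms(1) k(1)] by blast
  have "gF k * x \<approx> tw js * (gF k' * y)"
    unfolding y(2) mult.assoc[symmetric] by (intro c_r k')
  moreover have "tw js * (gF k' * y) \<in> spn {tw js * y |y. y \<in> alg G}"
    using alg_mult[OF F_alg[OF k'(1) assms(2)] y(1)] by (intro spn_base) blast
  ultimately show "wd [g] * x \<in> spn {tw js * y |y. y \<in> alg G}" unfolding k(2) wd_gens by (rule spn_cong)
qed

lemma right_F:
  assumes "set js \<subseteq> {1..<n}" "GFs \<subseteq> G" "z \<in> alg GFs" "y \<in> alg G"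
  shows "y * tw js * z \<in> spn {y * tw js |y. y \<in> alg G}"
proof (rule right_closed[OF _ _ assms(3)])
  show "y * tw js \<in> spn {y * tw js |y. y \<in> alg G}" using assms(4) by (intro spn_base) blast
  fix g x assume "g \<in> GFs" "x \<in> {y * tw js |y. y \<in> alg G}"
  then obtain k y where k: "k \<in> {1..n}" "g = GF k" and y: "y \<in> alg G" "x = y * tw js" by (auto simp: GFs_def)
  obtain k' where k': "k' \<in> {1..n}" "tw js * gF k \<approx> gF k' * tw js" using tw_F[OF assms(1) k(1)] by blast
  have "x * gF k \<approx> (y * gF k') * tw js"
    unfolding y(2) mult.assoc by (intro c_l k')
  moreover have "(y * gF k') * tw js \<in> spn {y * tw js |y. y \<in> alg G}"
    using alg_mult[OF y(1) F_alg[OF k'(1) assms(2)]] by (intro spn_base) blast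
  ultimately show "x * wd [g] \<in> spn {y * tw js |y. y \<in> alg G}" unfolding k(2) wd_gens by (rule spn_cong)
qed

text \<open>The chains \<open>T_down a i\<close> correspond to the minimal representatives of the
  left cosets of the symmetric group on \<open>i + 1, ..., n\<close> in the one on
  \<open>i, ..., n\<close>. A generator on the left lengthens the chain, shortens it through the
  quadratic relation, or slides to its right.\<close>

lemma coset_left:
  assumes "1 \<le> i" "i \<le> n" "x \<in> alg (G_from i)"
  shows "x \<in> spn {T_down a i * y |a y. a \<in> {i..n} \<and> y \<in> alg (G_from (Suc i))}" (is "_ \<in> spn ?S")
proof -
  have "x * 1 \<in> spn ?S"
  proof (rule left_closed[OF _ _ assms(3)])
    have "1 = T_down i i * (1 :: 'k free)" by simp
    then have "1 \<in> ?S" using assms(2) alg_1 by (smt (verit) atLeastAtMost_iff le_refl mem_Collect_eq)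
    then show "1 \<in> spn ?S" by (rule spn_base)
  next
    fix g s assume g: "g \<in> G_from i" and "s \<in> ?S"
    then obtain a y where a: "a \<in> {i..n}" and y: "y \<in> alg (G_from (Suc i))" and s: "s = T_down a i * y" by blast
    have mem: "T_down b i * y' \<in> spn ?S" if "b \<in> {i..n}" "y' \<in> alg (G_from (Suc i))" for b y'
      using that by (intro spn_base) blast
    have range: "set (rev [i..<a]) \<subseteq> {1..<n}" using assms a by auto
    have F: "z * s \<in> spn ?S" if z: "z \<in> alg GFs" for z
    proof -
      have "z * (tw (rev [i..<a]) * y) \<in> spn {tw (rev [i..<a]) * y |y. y \<in> alg (G_from (Suc i))}"
        by (rule left_F[OF range GFs_sub(1) z y])
      then show ?thesis unfolding s T_down_def[symmetric]
        by (rule spn_mono[rotated]) (use mem a in blast)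
    qed
    consider k where "g = GF k" "k \<in> {1..n}" | k where "g = GT k" "k \<in> {i..<n}"
      using g by (auto simp: G_from_def GFs_def)
    then show "wd [g] * s \<in> spn ?S"
    proof cases
      case 1
      then show ?thesis using F[OF F_alg[of k GFs]] by (simp add: wd_gens)
    next
      case 2
      consider "a < k" | "k = a" | "Suc k = a" | "Suc k < a" by linarith
      then have "gT k * s \<in> spn ?S"
      proof cases
        case 1
        have k: "k \<in> {1..<n}" using 2 assms by auto
        have "gT k * T_down a i \<approx> T_down a i * gT k"
          unfolding T_down_def using 1 2 assms by (intro T_tw_comm k) auto
        then have "gT k * s \<approx> T_down a i * (gT k * y)" unfolding s mult.assoc[symmetric] by (rule c_r)
        moreover have "gT k * y \<in> alg (G_from (Suc i))"
          using 1 2 a by (intro alg_mult y T_alg) (auto simp: G_from_def)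
        ultimately show ?thesis using mem[OF a] spn_cong by blast
      next
        case k: 2
        have "gT k * s = T_down (Suc a) i * y" unfolding s k using a by (simp add: T_down_Suc mult.assoc)
        then show ?thesis using mem[of "Suc a" y] y 2 k a by simp
      next
        case k: 3
        have ki: "i \<le> k" and kn: "k \<in> {1..<n}" using 2 assms by auto
        have Td: "T_down a i = gT k * T_down k i" unfolding k[symmetric] by (rule T_down_Suc[OF ki])
        have "gT k * s = (gT k * gT k) * (T_down k i * y)" unfolding s Td by (simp add: mult.assoc)
        also have "\<dots> \<approx> (scal uvar + zq k * gT k) * (T_down k i * y)" by (intro c_r T_sq kn)
        also have "\<dots> = scal uvar * (T_down k i * y) + zq k * s" unfolding s Td by (simp add: distrib_right mult.assoc)
        finally have "gT k * s \<approx> scal uvar * (T_down k i * y) + zq k * s" .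
        moreover have "scal uvar * (T_down k i * y) + zq k * s \<in> spn ?S"
          using ki k a y by (intro spn_add spn_scal F zq_alg kn mem) auto
        ultimately show ?thesis by (rule spn_cong)
      next
        case k: 4
        have "gT k * T_down a i \<approx> T_down a i * gT (Suc k)" using k 2 assms a by (intro slide) auto
        then have "gT k * s \<approx> T_down a i * (gT (Suc k) * y)" unfolding s mult.assoc[symmetric] by (rule c_r)
        moreover have "gT (Suc k) * y \<in> alg (G_from (Suc i))"
          using k 2 a by (intro alg_mult y T_alg) (auto simp: G_from_def)
        ultimately show ?thesis using mem[OF a] spn_cong by blast
      qed
      then show ?thesis unfolding 2 wd_gens .
    qed
  qed
  then show ?thesis by simp
qed

text \<open>The mirror image of \<open>coset_left\<close>: representatives of the right cosets of
  the symmetric group on \<open>1, ..., m - 1\<close> in the one on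
  \<open>1, ..., m\<close>.\<close>

lemma coset_right:
  assumes "1 \<le> m" "m \<le> n" "x \<in> alg (G_upto m)"
  shows "x \<in> spn {y * T_down m b |b y. b \<in> {1..m} \<and> y \<in> alg (G_upto (m - 1))}" (is "_ \<in> spn ?S")
proof -
  have "1 * x \<in> spn ?S"
  proof (rule right_closed[OF _ _ assms(3)])
    have "1 = (1 :: 'k free) * T_down m m" by simp
    then have "1 \<in> ?S" using assms(1) alg_1 by (smt (verit) atLeastAtMost_iff le_refl mem_Collect_eq)
    then show "1 \<in> spn ?S" by (rule spn_base)
  next
    fix g s assume g: "g \<in> G_upto m" and "s \<in> ?S"
    then obtain b y where b: "b \<in> {1..m}" and y: "y \<in> alg (G_upto (m - 1))" and s: "s = y * T_down m b" by blast
    have mem: "y' * T_down m c \<in> spn ?S" if "c \<in> {1..m}" "y' \<in> alg (G_upto (m - 1))" for c y'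
      using that by (intro spn_base) blast
    have range: "set (rev [c..<m]) \<subseteq> {1..<n}" if "1 \<le> c" for c using assms that by auto
    have F: "y * T_down m c * z \<in> spn {y * T_down m c |y. y \<in> alg (G_upto (m - 1))}" if z: "z \<in> alg GFs" and c: "1 \<le> c" for z c
      using right_F[OF range[OF c] GFs_sub(2) z y] unfolding T_down_def[symmetric] .
    consider k where "g = GF k" "k \<in> {1..n}" | k where "g = GT k" "k \<in> {1..<m}"
      using g by (auto simp: G_upto_def GFs_def)
    then show "s * wd [g] \<in> spn ?S"
    proof cases
      case 1
      have "s * gF k \<in> spn {y * T_down m b |y. y \<in> alg (G_upto (m - 1))}"
        unfolding s using 1 b by (intro F F_alg) auto
      then show ?thesis unfolding 1 wd_gens by (rule spn_mono[rotated]) (use mem b in blast)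
    next
      case 2
      have kn: "k \<in> {1..<n}" using 2 assms by auto
      consider "Suc k < b" | "Suc k = b" | "k = b" | "b < k" by linarith
      then have "s * gT k \<in> spn ?S"
      proof cases
        case 1
        have "gT k * T_down m b \<approx> T_down m b * gT k"
          unfolding T_down_def using 1 2 assms by (intro T_tw_comm kn) auto
        then have "s * gT k \<approx> (y * gT k) * T_down m b" unfolding s mult.assoc by (rule c_l[OF c_sym])
        moreover have "y * gT k \<in> alg (G_upto (m - 1))"
          using 1 2 b by (intro alg_mult y T_alg) (auto simp: G_upto_def)
        ultimately show ?thesis using mem[OF b] spn_cong by blast
      next
        case k: 2
        have "s * gT k = y * T_down m k" unfolding s using k b by (simp add: mult.assoc T_down_step[of k m])
        then show ?thesis using mem[of k y] y 2 by simp
      next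
        case k: 3
        have Td: "T_down m b = T_down m (Suc b) * gT k" using k 2 by (simp add: T_down_step[of b m])
        have "s * gT k = (y * T_down m (Suc b)) * (gT k * gT k)" unfolding s Td by (simp add: mult.assoc)
        also have "\<dots> \<approx> (y * T_down m (Suc b)) * (scal uvar + zq k * gT k)" by (intro c_l T_sq kn)
        also have "\<dots> = scal uvar * (y * T_down m (Suc b)) + y * T_down m (Suc b) * zq k * gT k"
          by (simp add: distrib_left scal_comm mult.assoc)
        finally have "s * gT k \<approx> scal uvar * (y * T_down m (Suc b)) + y * T_down m (Suc b) * zq k * gT k" .
        moreover have "y * T_down m (Suc b) * zq k * gT k \<in> spn ?S"
        proof (rule spn_map_right[OF _ F[OF zq_alg[OF kn]]])
          fix x assume "x \<in> {y * T_down m (Suc b) |y. y \<in> alg (G_upto (m - 1))}"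
          then obtain y' where "y' \<in> alg (G_upto (m - 1))" "x = y' * T_down m (Suc b)" by blast
          then show "x * gT k \<in> spn ?S" using mem[OF b, of y'] by (simp add: Td mult.assoc)
        qed simp
        ultimately show ?thesis
          using k 2 b y by (elim spn_cong) (intro spn_add spn_scal mem, auto)
      next
        case k: 4
        have "gT (k - 1) * T_down m b \<approx> T_down m b * gT (Suc (k - 1))" using k 2 assms b by (intro slide) auto
        then have "gT (k - 1) * T_down m b \<approx> T_down m b * gT k" using k by simp
        then have "s * gT k \<approx> (y * gT (k - 1)) * T_down m b" unfolding s mult.assoc by (rule c_l[OF c_sym])
        moreover have "y * gT (k - 1) \<in> alg (G_upto (m - 1))"
        proof (intro alg_mult y T_alg)
          have "k - 1 \<in> {1..<m - 1}" using k 2 b by auto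
          then show "GT (k - 1) \<in> G_upto (m - 1)" by (simp add: G_upto_def)
        qed
        ultimately show ?thesis using mem[OF b] spn_cong by blast
      qed
      then show ?thesis unfolding 2 wd_gens .
    qed
  qed
  then show ?thesis by simp
qed

definition Tup :: "nat \<Rightarrow> 'k free" where "Tup a = tw [1..<a]"

lemma Tup_Suc: "1 \<le> a \<Longrightarrow> Tup (Suc a) = Tup a * gT a"
  by (simp add: Tup_def)

lemma slide_up:
  assumes "1 \<le> k" "Suc k < a" "a \<le> n"
  shows "Tup a * gT k \<approx> gT (Suc k) * Tup a"
proof -
  have k: "k \<in> {1..<n}" "k + 1 \<in> {1..<n}" using assms by auto
  have "[1..<a] = [1..<k] @ [k, k + 1] @ [k + 2..<a]"
    using assms upt_add_eq_append[of 1 k "a - k"] by (simp add: upt_conv_Cons)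
  then have s: "Tup a = tw [1..<k] * gT k * gT (k + 1) * tw [k + 2..<a]"
    by (simp add: Tup_def mult.assoc)
  have 1: "gT k * tw [k + 2..<a] \<approx> tw [k + 2..<a] * gT k"
    using assms by (intro T_tw_comm k) auto
  have 2: "gT (k + 1) * tw [1..<k] \<approx> tw [1..<k] * gT (k + 1)"
    using assms by (intro T_tw_comm k) auto
  have "Tup a * gT k = tw [1..<k] * gT k * gT (k + 1) * (tw [k + 2..<a] * gT k)" unfolding s by (simp add: mult.assoc)
  also have "\<dots> \<approx> tw [1..<k] * gT k * gT (k + 1) * (gT k * tw [k + 2..<a])" by (intro c_l c_sym[OF 1])
  also have "\<dots> = tw [1..<k] * (gT k * gT (k + 1) * gT k) * tw [k + 2..<a]" by (simp add: mult.assoc)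
  also have "\<dots> \<approx> tw [1..<k] * (gT (k + 1) * gT k * gT (k + 1)) * tw [k + 2..<a]" by (intro c_l c_r braid k)
  also have "\<dots> = (tw [1..<k] * gT (k + 1)) * (gT k * gT (k + 1) * tw [k + 2..<a])" by (simp add: mult.assoc)
  also have "\<dots> \<approx> (gT (k + 1) * tw [1..<k]) * (gT k * gT (k + 1) * tw [k + 2..<a])" by (intro c_r c_sym[OF 2])
  also have "\<dots> = gT (Suc k) * Tup a" unfolding s by (simp add: mult.assoc)
  finally show ?thesis .
qed

text \<open>Representatives \<open>T_1 ... T_{a-1}\<close> of right cosets for the positions
  \<open>2, ..., n\<close>. This form is made for multiplication by \<open>N\<close> from the left:
  \<open>N\<close> passes the factor from \<open>alg (G_from 2)\<close> and then stands in front of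
  \<open>T_1 ... T_{a-1}\<close>, as in the relation between two \<open>N\<close>s.\<close>

lemma coset_up:
  assumes "x \<in> alg (G_from 1)"
  shows "x \<in> spn {y * Tup a |a y. a \<in> {1..n} \<and> y \<in> alg (G_from 2)}" (is "_ \<in> spn ?S")
proof -
  have "1 * x \<in> spn ?S"
  proof (rule right_closed[OF _ _ assms])
    have "1 = (1 :: 'k free) * Tup 1" by (simp add: Tup_def)
    then have "1 \<in> ?S" using n1 alg_1 by (smt (verit) atLeastAtMost_iff le_refl mem_Collect_eq)
    then show "1 \<in> spn ?S" by (rule spn_base)
  next
    fix g s assume g: "g \<in> G_from 1" and "s \<in> ?S"
    then obtain a y where a: "a \<in> {1..n}" and y: "y \<in> alg (G_from 2)" and s: "s = y * Tup a" by blast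
    have mem: "y' * Tup c \<in> spn ?S" if "c \<in> {1..n}" "y' \<in> alg (G_from 2)" for c y'
      using that by (intro spn_base) blast
    have range: "set [1..<c] \<subseteq> {1..<n}" if "c \<le> n" for c using that by auto
    have F: "y * Tup c * z \<in> spn {y * Tup c |y. y \<in> alg (G_from 2)}" if z: "z \<in> alg GFs" and c: "c \<le> n" for z c
      using right_F[OF range[OF c] GFs_sub(1) z y] unfolding Tup_def[symmetric] .
    consider k where "g = GF k" "k \<in> {1..n}" | k where "g = GT k" "k \<in> {1..<n}"
      using g by (auto simp: G_from_def GFs_def)
    then show "s * wd [g] \<in> spn ?S"
    proof cases
      case 1
      have "s * gF k \<in> spn {y * Tup a |y. y \<in> alg (G_from 2)}"
        unfolding s using 1 a by (intro F F_alg) auto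
      then show ?thesis unfolding 1 wd_gens by (rule spn_mono[rotated]) (use mem a in blast)
    next
      case 2
      consider "a < k" | "a = k" | "Suc k = a" | "Suc k < a" by linarith
      then have "s * gT k \<in> spn ?S"
      proof cases
        case 1
        have "gT k * Tup a \<approx> Tup a * gT k"
          unfolding Tup_def using 1 2 by (intro T_tw_comm) auto
        then have "s * gT k \<approx> (y * gT k) * Tup a" unfolding s mult.assoc by (rule c_l[OF c_sym])
        moreover have "y * gT k \<in> alg (G_from 2)"
          using 1 2 a by (intro alg_mult y T_alg) (auto simp: G_from_def)
        ultimately show ?thesis using mem[OF a] spn_cong by blast
      next
        case k: 2
        have a1: "1 \<le> a" using a by simp
        have "s * gT k = y * Tup (Suc a)" unfolding s k Tup_Suc[OF a1[unfolded k]] by (rule mult.assoc)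
        then show ?thesis using mem[of "Suc a" y] y 2 k by simp
      next
        case k: 3
        have Td: "Tup a = Tup k * gT k" using Tup_Suc[of k] k 2 by auto
        have "s * gT k = (y * Tup k) * (gT k * gT k)" unfolding s Td by (simp add: mult.assoc)
        also have "\<dots> \<approx> (y * Tup k) * (scal uvar + zq k * gT k)" by (intro c_l T_sq 2)
        also have "\<dots> = scal uvar * (y * Tup k) + y * Tup k * zq k * gT k"
          by (simp add: distrib_left scal_comm mult.assoc)
        finally have "s * gT k \<approx> scal uvar * (y * Tup k) + y * Tup k * zq k * gT k" .
        moreover have "y * Tup k * zq k * gT k \<in> spn ?S"
        proof (rule spn_map_right[OF _ F[OF zq_alg[OF 2(2)]]])
          fix x assume "x \<in> {y * Tup k |y. y \<in> alg (G_from 2)}"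
          then obtain y' where "y' \<in> alg (G_from 2)" "x = y' * Tup k" by blast
          then show "x * gT k \<in> spn ?S" using mem[OF a, of y'] by (simp add: Td mult.assoc)
        qed (use 2 in simp)
        ultimately show ?thesis
          using k 2 a y by (elim spn_cong) (intro spn_add spn_scal mem, auto)
      next
        case k: 4
        have "Tup a * gT k \<approx> gT (Suc k) * Tup a" using k 2 a by (intro slide_up) auto
        then have "s * gT k \<approx> (y * gT (Suc k)) * Tup a" unfolding s mult.assoc by (intro c_l)
        moreover have "y * gT (Suc k) \<in> alg (G_from 2)"
          using k 2 a by (intro alg_mult y T_alg) (auto simp: G_from_def)
        ultimately show ?thesis using mem[OF a] spn_cong by blast
      qed
      then show ?thesis unfolding 2 wd_gens .
    qed
  qed
  then show ?thesis by simp
qed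

section \<open>Powers of \<open>N\<close>\<close>

lemma FN: "\<lbrakk>1 \<le> i; i < n\<rbrakk> \<Longrightarrow> gF i * gN \<approx> gN * gF (i + 1)"
  by (intro c_relator relators.F_N) auto
lemma NF1: "gN * gF 1 \<approx> gN" by (intro c_relator relators.N_F1)
lemma FnN: "gF n * gN \<approx> gN" by (intro c_relator relators.Fn_N)
lemma TN: "\<lbrakk>1 \<le> i; i + 1 < n\<rbrakk> \<Longrightarrow> gT i * gN \<approx> gN * gT (i + 1)"
  by (intro c_relator relators.T_N) auto

lemma TNk: "\<lbrakk>1 \<le> i; i + k < n\<rbrakk> \<Longrightarrow> gT i * gN ^ k \<approx> gN ^ k * gT (i + k)"
proof (induction k)
  case 0 then show ?case by simp
next
  case (Suc k)
  have 1: "gT i * gN ^ k \<approx> gN ^ k * gT (i + k)" using Suc by simp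
  have 2: "gT (i + k) * gN \<approx> gN * gT (i + k + 1)" using Suc.prems by (intro TN) auto
  have "gT i * gN ^ Suc k = (gT i * gN ^ k) * (gN :: 'k free)" by (simp add: power_Suc2 mult.assoc del: power_Suc)
  also have "\<dots> \<approx> (gN ^ k * gT (i + k)) * gN" by (intro c_r 1)
  also have "\<dots> = gN ^ k * (gT (i + k) * gN)" by (simp add: mult.assoc)
  also have "\<dots> \<approx> gN ^ k * (gN * gT (i + k + 1))" by (intro c_l 2)
  also have "\<dots> = gN ^ Suc k * gT (i + Suc k)" by (simp add: power_Suc2 mult.assoc del: power_Suc)
  finally show ?case .
qed

lemma FNk: "\<lbrakk>1 \<le> i; i + k \<le> n\<rbrakk> \<Longrightarrow> gF i * gN ^ k \<approx> gN ^ k * gF (i + k)"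
proof (induction k)
  case 0 then show ?case by simp
next
  case (Suc k)
  have 1: "gF i * gN ^ k \<approx> gN ^ k * gF (i + k)" using Suc by simp
  have 2: "gF (i + k) * gN \<approx> gN * gF (i + k + 1)" using Suc.prems by (intro FN) auto
  have "gF i * gN ^ Suc k = (gF i * gN ^ k) * (gN :: 'k free)" by (simp add: power_Suc2 mult.assoc del: power_Suc)
  also have "\<dots> \<approx> (gN ^ k * gF (i + k)) * gN" by (intro c_r 1)
  also have "\<dots> = gN ^ k * (gF (i + k) * gN)" by (simp add: mult.assoc)
  also have "\<dots> \<approx> gN ^ k * (gN * gF (i + k + 1))" by (intro c_l 2)
  also have "\<dots> = gN ^ Suc k * gF (i + Suc k)" by (simp add: power_Suc2 mult.assoc del: power_Suc)
  finally show ?case .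
qed

text \<open>Passing through \<open>N^(n-i)\<close> turns \<open>F_i\<close> into \<open>F_n\<close>,
  which the next \<open>N\<close> absorbs. On the other side \<open>F_i\<close> becomes
  \<open>F_1\<close> after passing \<open>N^(i-1)\<close>.\<close>

lemma F_absorb_left:
  assumes "n - k < i" "i \<le> n" "k \<le> n"
  shows "gF i * gN ^ k \<approx> gN ^ k"
proof -
  define t where "t = n - i"
  have t: "i + t = n" "Suc t \<le> k" using assms by (auto simp: t_def)
  have 1: "gF i * gN ^ t \<approx> gN ^ t * gF (i + t)" using assms t by (intro FNk) auto
  have s: "(gN ^ k :: 'k free) = gN ^ t * gN * gN ^ (k - Suc t)"
    using t power_add[of "gN :: 'k free" "Suc t" "k - Suc t"] by (simp add: power_Suc2 del: power_Suc)
  have "(gF i * gN ^ k :: 'k free) = (gF i * gN ^ t) * (gN * gN ^ (k - Suc t))" unfolding s by (simp add: mult.assoc)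
  also have "\<dots> \<approx> (gN ^ t * gF n) * (gN * gN ^ (k - Suc t))" by (intro c_r) (use 1 t in simp)
  also have "\<dots> = gN ^ t * (gF n * gN) * gN ^ (k - Suc t)" by (simp add: mult.assoc)
  also have "\<dots> \<approx> gN ^ t * gN * gN ^ (k - Suc t)" by (intro c_r c_l FnN)
  also have "\<dots> = gN ^ k" unfolding s ..
  finally show ?thesis .
qed

lemma F_absorb_right:
  assumes "1 \<le> i" "i \<le> k" "k \<le> n"
  shows "gN ^ k * gF i \<approx> gN ^ k"
proof -
  define t where "t = i - 1"
  have t: "i = 1 + t" "Suc t \<le> k" "1 + t \<le> n" using assms by (auto simp: t_def)
  have 1: "gN ^ t * gF (1 + t) \<approx> gF 1 * gN ^ t" using t by (intro c_sym[OF FNk]) auto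
  have s: "(gN ^ k :: 'k free) = gN ^ (k - Suc t) * gN * gN ^ t"
    using t power_add[of "gN :: 'k free" "k - Suc t" "Suc t"] by (simp add: mult.assoc)
  have "(gN ^ k * gF i :: 'k free) = gN ^ (k - Suc t) * gN * (gN ^ t * gF (1 + t))" unfolding s t(1) by (simp add: mult.assoc)
  also have "\<dots> \<approx> gN ^ (k - Suc t) * gN * (gF 1 * gN ^ t)" by (intro c_l 1)
  also have "\<dots> = gN ^ (k - Suc t) * (gN * gF 1) * gN ^ t" by (simp add: mult.assoc)
  also have "\<dots> \<approx> gN ^ (k - Suc t) * gN * gN ^ t" by (intro c_r c_l NF1)
  also have "\<dots> = gN ^ k" unfolding s ..
  finally show ?thesis .
qed

lemma T_absorb_left:
  assumes "i \<in> {1..<n}" "n - k < i" "k \<le> n"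
  shows "gT i * gN ^ k \<approx> scal uvar * gN ^ k"
proof -
  have s: "(gN ^ k :: 'k free) = gN ^ (n - i + 1) * gN ^ (k - (n - i + 1))"
    using assms by (subst power_add[symmetric]) (intro arg_cong2[where f = "(^)"] refl, auto)
  have "gT i * gN ^ (n - i + 1) \<approx> scal uvar * gN ^ (n - i + 1)" by (intro c_relator relators.T_Npow assms)
  then have "gT i * gN ^ (n - i + 1) * gN ^ (k - (n - i + 1)) \<approx> scal uvar * gN ^ (n - i + 1) * gN ^ (k - (n - i + 1))" by (rule c_r)
  then show ?thesis unfolding mult.assoc s[symmetric] .
qed

lemma T_absorb_right:
  assumes "i \<in> {1..<n}" "i < k"
  shows "gN ^ k * gT i \<approx> scal uvar * gN ^ k"
proof -
  have s: "(gN ^ k :: 'k free) = gN ^ (k - (i + 1)) * gN ^ (i + 1)"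
    using assms by (subst power_add[symmetric]) (intro arg_cong2[where f = "(^)"] refl, auto)
  have "gN ^ (i + 1) * gT i \<approx> scal uvar * gN ^ (i + 1)" by (intro c_relator relators.Npow_T assms)
  then have h: "gN ^ (k - (i + 1)) * (gN ^ (i + 1) * gT i) \<approx> gN ^ (k - (i + 1)) * (scal uvar * gN ^ (i + 1))" by (rule c_l)
  have 1: "gN ^ (k - (i + 1)) * (gN ^ (i + 1) * gT i) = (gN ^ k * gT i :: 'k free)" unfolding s by (simp only: mult.assoc)
  have 2: "gN ^ (k - (i + 1)) * (scal uvar * gN ^ (i + 1)) = (scal uvar * gN ^ k :: 'k free)" unfolding s by (rule scal_left_comm)
  show ?thesis using h unfolding 1 2 .
qed

lemma tw_absorb_left:
  assumes "\<And>i. i \<in> set js \<Longrightarrow> i \<in> {1..<n} \<and> n - k < i" "k \<le> n"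
  shows "tw js * gN ^ k \<approx> scal (uvar ^ length js) * gN ^ k"
  using assms(1)
proof (induction js)
  case Nil then show ?case by (simp add: scal_1)
next
  case (Cons i js)
  have i: "i \<in> {1..<n}" "n - k < i" using Cons.prems by auto
  have IH: "tw js * gN ^ k \<approx> scal (uvar ^ length js) * gN ^ k" by (rule Cons.IH) (use Cons.prems in auto)
  have "tw (i # js) * gN ^ k = gT i * (tw js * (gN ^ k :: 'k free))" by (simp add: mult.assoc)
  also have "\<dots> \<approx> gT i * (scal (uvar ^ length js) * gN ^ k)" by (intro c_l IH)
  also have "\<dots> = scal (uvar ^ length js) * (gT i * gN ^ k)" by (rule scal_left_comm)
  also have "\<dots> \<approx> scal (uvar ^ length js) * (scal uvar * gN ^ k)" by (intro c_l T_absorb_left i assms(2))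
  also have "\<dots> = scal (uvar ^ length (i # js)) * gN ^ k" by (simp add: scal_mult[symmetric] mult.assoc[symmetric] mult.commute)
  finally show ?case .
qed

section \<open>Reduction to products with a single power of \<open>N\<close>\<close>

lemma uvar_nz: "uvar \<noteq> (0 :: 'k ratfun)"
  by (simp add: uvar_def Zero_fract_def eq_fract)

text \<open>The last factors \<open>T\<^sub>r\<^sub>+\<^sub>1, \<dots>, T\<^sub>n\<^sub>-\<^sub>1\<close> of the relation \<open>N T\<^sub>1 \<cdots> T\<^sub>n\<^sub>-\<^sub>1 N = u\<^sup>n\<^sup>-\<^sup>1 N\<close> are
  absorbed by \<open>N\<^sup>n\<^sup>-\<^sup>r\<close>.\<close>

lemma N_Tup_N:
  assumes "1 \<le> k" "k \<le> n"
  shows "gN * Tup (n - k + 1) * gN ^ k \<approx> scal (uvar ^ (n - k)) * gN ^ k"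
proof -
  let ?l = "[n - k + 1..<n]"
  have sp: "[1..<n] = [1..<n - k + 1] @ ?l"
    using assms upt_add_eq_append[of 1 "n - k + 1" "k - 1"] by simp
  have len: "length ?l = k - 1" using assms by simp
  have s: "(gN ^ k :: 'k free) = gN * gN ^ (k - 1)" using assms by (simp add: power_Suc[symmetric] del: power_Suc)
  \<comment> \<open>The scalar \<open>u^(k-1)\<close> pays for inserting the missing factors
    \<open>T_{n-k+1}, ..., T_{n-1}\<close> in front of \<open>gN ^ k\<close>; being invertible, it
    is cancelled at the end.\<close>
  have "scal (uvar ^ (k - 1)) * (gN * Tup (n - k + 1) * gN ^ k) = gN * Tup (n - k + 1) * (scal (uvar ^ (k - 1)) * (gN ^ k :: 'k free))"
    by (simp add: scal_left_comm)
  also have "\<dots> \<approx> gN * Tup (n - k + 1) * (tw ?l * gN ^ k)"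
    by (intro c_l c_sym[OF tw_absorb_left[of ?l k, unfolded len]]) (use assms in auto)
  also have "\<dots> = (gN * tw [1..<n] * gN) * gN ^ (k - 1)"
    unfolding sp Tup_def s by (simp add: mult.assoc)
  also have "\<dots> \<approx> (scal (uvar ^ (n - 1)) * gN) * gN ^ (k - 1)"
    by (intro c_r c_relator relators.N_T_N)
  also have "\<dots> = scal (uvar ^ (n - 1)) * gN ^ k" unfolding s by (simp add: mult.assoc)
  finally have "scal (uvar ^ (k - 1)) * (gN * Tup (n - k + 1) * gN ^ k) \<approx> scal (uvar ^ (n - 1)) * gN ^ k" .
  then have c: "scal (inverse (uvar ^ (k - 1))) * (scal (uvar ^ (k - 1)) * (gN * Tup (n - k + 1) * gN ^ k))
    \<approx> scal (inverse (uvar ^ (k - 1))) * (scal (uvar ^ (n - 1)) * gN ^ k)" by (rule c_l)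
  have u: "inverse (uvar ^ (k - 1)) * uvar ^ (k - 1) = (1 :: 'k ratfun)" using uvar_nz by simp
  have "n - 1 = (k - 1) + (n - k)" using assms by simp
  then have u2: "inverse (uvar ^ (k - 1)) * uvar ^ (n - 1) = (uvar :: 'k ratfun) ^ (n - k)"
    using u by (simp only: power_add mult.assoc[symmetric] mult_1)
  show ?thesis using c unfolding mult.assoc[symmetric] scal_mult[symmetric] u u2 scal_1 by (simp only: mult_1 mult.assoc)
qed

lemma Tup_Nk: "\<lbrakk>1 \<le> a; a + k \<le> n\<rbrakk> \<Longrightarrow> \<exists>y\<in>alg (G_from 1). Tup a * gN ^ k \<approx> gN ^ k * y"
proof (induction a rule: dec_induct)
  case base then show ?case using alg_1 by (intro bexI[of _ 1]) (auto simp: Tup_def)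
next
  case (step a)
  then obtain y where y: "y \<in> alg (G_from 1)" "Tup a * gN ^ k \<approx> gN ^ k * y" by auto
  have "Tup (Suc a) * gN ^ k = Tup a * (gT a * gN ^ k)" using step by (simp add: Tup_Suc mult.assoc)
  also have "\<dots> \<approx> Tup a * (gN ^ k * gT (a + k))" using step by (intro c_l TNk) auto
  also have "\<dots> = (Tup a * gN ^ k) * gT (a + k)" by (simp add: mult.assoc)
  also have "\<dots> \<approx> (gN ^ k * y) * gT (a + k)" by (intro c_r y)
  also have "\<dots> = gN ^ k * (y * gT (a + k))" by (simp add: mult.assoc)
  finally have "Tup (Suc a) * gN ^ k \<approx> gN ^ k * (y * gT (a + k))" .
  moreover have "y * gT (a + k) \<in> alg (G_from 1)"
    using step by (intro alg_mult y T_alg) (auto simp: G_from_def)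
  ultimately show ?case by blast
qed

text \<open>Read from right to left, the relations let \<open>N\<close> pass every generator of
  index at least 2 while lowering the index by one; \<open>F_1\<close> is absorbed.\<close>

lemma N_alg2:
  assumes "z \<in> alg (G_from 2)"
  shows "gN * z \<in> spn {z * gN |z. z \<in> alg (G_from 1)}" (is "_ \<in> spn ?S")
proof (rule right_closed[OF _ _ assms])
  show "gN \<in> spn ?S" using alg_1[of "G_from 1"] by (intro spn_base) (metis (mono_tags, lifting) mem_Collect_eq mult_1)
  fix g x assume g: "g \<in> G_from 2" and "x \<in> ?S"
  then obtain z where z: "z \<in> alg (G_from 1)" "x = z * gN" by blast
  have *: "gN * wd [g] \<approx> wd [h] * gN \<and> h \<in> G_from 1 \<Longrightarrow> x * wd [g] \<in> spn ?S" for h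
  proof -
    assume h: "gN * wd [g] \<approx> wd [h] * gN \<and> h \<in> G_from 1"
    then have "x * wd [g] \<approx> (z * wd [h]) * gN" unfolding z(2) mult.assoc by (intro c_l) blast
    moreover have "z * wd [h] \<in> alg (G_from 1)" using h by (intro alg_mult z alg_gen) blast
    ultimately show ?thesis by (elim spn_cong) (intro spn_base, blast)
  qed
  consider k where "g = GF k" "k = 1" | k where "g = GF k" "k \<in> {2..n}" | k where "g = GT k" "k \<in> {2..<n}"
    using g by (force simp: G_from_def GFs_def)
  then show "x * wd [g] \<in> spn ?S"
  proof cases
    case 1
    have "x * gF 1 \<approx> z * gN" unfolding z(2) mult.assoc by (intro c_l NF1)
    then show ?thesis unfolding 1 wd_gens using z(1) by (elim spn_cong) (intro spn_base, blast)
  next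
    case 2
    then have "gF (k - 1) * gN \<approx> gN * gF k" using FN[of "k - 1"] by auto
    then have "gN * wd [g] \<approx> wd [GF (k - 1)] * gN" unfolding 2 wd_gens by (rule c_sym)
    moreover have "k - 1 \<in> {1..n}" using 2 by auto
    then have "GF (k - 1) \<in> G_from 1" by (auto simp: G_from_def GFs_def)
    ultimately show ?thesis using * by blast
  next
    case 3
    then have "gT (k - 1) * gN \<approx> gN * gT k" using TN[of "k - 1"] by auto
    then have "gN * wd [g] \<approx> wd [GT (k - 1)] * gN" unfolding 3 wd_gens by (rule c_sym)
    moreover have "k - 1 \<in> {1..<n}" using 3 by auto
    then have "GT (k - 1) \<in> G_from 1" by (auto simp: G_from_def)
    ultimately show ?thesis using * by blast
  qed
qed

text \<open>The Yokonuma-Hecke part, generated by all \<open>T\<close>s and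
  \<open>F\<close>s.\<close>

abbreviation "H \<equiv> alg (G_from 1)"

text \<open>The point is closure under \<open>N\<close> from the left. With
  \<open>x = z T_1 ... T_{a-1}\<close> from \<open>coset_up\<close>, \<open>N\<close> passes
  \<open>z\<close>. If \<open>a + k \<le> n\<close>, the remaining \<open>T\<close>s pass
  \<open>N^k\<close> and the power becomes \<open>k + 1\<close>; otherwise the top \<open>T\<close>s
  are absorbed by \<open>N^k\<close>, and \<open>N T_1 ... T_{n-k} N^k\<close> is a multiple of
  \<open>N^k\<close>.\<close>

lemma span_HNH: "x \<in> spn {x * gN ^ k * y |x k y. x \<in> H \<and> k \<le> n \<and> y \<in> H}" (is "_ \<in> spn ?S")
proof -
  have mem: "x * gN ^ k * y \<in> spn ?S" if "x \<in> H" "k \<le> n" "y \<in> H" for x k y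
    using that by (intro spn_base) blast
  have N: "gN * (x * gN ^ k * y) \<in> spn ?S" if x: "x \<in> H" and k: "k \<le> n" and y: "y \<in> H" for x k y
  proof -
    have "gN * x * (gN ^ k * y) \<in> spn ?S"
    proof (rule spn_map[OF _ coset_up[OF x]])
      fix s assume "s \<in> {y * Tup a |a y. a \<in> {1..n} \<and> y \<in> alg (G_from 2)}"
      then obtain a z where a: "a \<in> {1..n}" and z: "z \<in> alg (G_from 2)" and s: "s = z * Tup a" by blast
      have "1 * (gN * z) * (Tup a * gN ^ k * y) \<in> spn ?S"
      proof (rule spn_map[OF _ N_alg2[OF z]])
        fix v assume "v \<in> {z * gN |z. z \<in> H}"
        then obtain z' where z': "z' \<in> H" and v: "v = z' * gN" by blast
        show "1 * v * (Tup a * gN ^ k * y) \<in> spn ?S"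
        proof (cases "a + k \<le> n")
          case True
          then obtain y' where y': "y' \<in> H" "Tup a * gN ^ k \<approx> gN ^ k * y'" using Tup_Nk a by auto
          have "1 * v * (Tup a * gN ^ k * y) = z' * gN * ((Tup a * gN ^ k) * y)" unfolding v by (simp add: mult.assoc)
          also have "\<dots> \<approx> z' * gN * ((gN ^ k * y') * y)" by (intro c_l c_r y')
          also have "\<dots> = z' * gN ^ Suc k * (y' * y)" by (simp add: mult.assoc)
          finally show ?thesis
            using True a by (elim spn_cong) (intro mem z' alg_mult y' y, auto)
        next
          case False
          have k1: "1 \<le> k" "n - k + 1 \<le> a" using False a by auto
          let ?l = "[n - k + 1..<a]"
          have Ta: "Tup a = Tup (n - k + 1) * tw ?l"
            using k1 upt_add_eq_append[of 1 "n - k + 1" "a - (n - k + 1)"] unfolding Tup_def by simp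
          have 1: "tw ?l * gN ^ k \<approx> scal (uvar ^ length ?l) * gN ^ k"
            using a k by (intro tw_absorb_left) auto
          have "1 * v * (Tup a * gN ^ k * y) = z' * gN * Tup (n - k + 1) * (tw ?l * gN ^ k) * y"
            unfolding v Ta by (simp add: mult.assoc)
          also have "\<dots> \<approx> z' * gN * Tup (n - k + 1) * (scal (uvar ^ length ?l) * gN ^ k) * y"
            by (intro c_r c_l 1)
          also have "\<dots> = scal (uvar ^ length ?l) * (z' * (gN * Tup (n - k + 1) * gN ^ k) * y)"
            by (simp only: scal_left_comm mult.assoc)
          also have "\<dots> \<approx> scal (uvar ^ length ?l) * (z' * (scal (uvar ^ (n - k)) * gN ^ k) * y)"
            by (intro c_r c_l N_Tup_N k1 k)
          also have "\<dots> = scal (uvar ^ length ?l) * (scal (uvar ^ (n - k)) * (z' * gN ^ k * y))"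
            by (simp only: scal_left_comm[of z'] mult.assoc)
          finally show ?thesis
            by (elim spn_cong) (intro spn_scal mem z' k y)
        qed
      qed
      then show "gN * s * (gN ^ k * y) \<in> spn ?S" unfolding s by (simp add: mult.assoc)
    qed
    then show ?thesis by (simp add: mult.assoc)
  qed
  have w: "wd l \<in> spn ?S" for l
  proof (induction l)
    case Nil
    have "1 * gN ^ 0 * 1 \<in> spn ?S" by (intro mem alg_1) simp
    then show ?case by (simp add: wd_Nil)
  next
    case (Cons g l)
    have "wd [g] * s \<in> spn ?S" if sS: "s \<in> ?S" for s
    proof -
      obtain x k y where s: "s = x * gN ^ k * y" "x \<in> H" "k \<le> n" "y \<in> H" using sS by blast
      consider "g = GN" | "g \<in> G_from 1" | "g \<notin> gens n"
        by (auto simp: gens_def G_from_def GFs_def)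
      then show ?thesis
      proof cases
        case 1
        then show ?thesis using N s by (simp add: wd_gens)
      next
        case 2
        have "wd [g] * x \<in> H" using 2 by (intro alg_mult alg_gen s)
        then show ?thesis unfolding s(1) using mem[of "wd [g] * x" k y] s by (simp add: mult.assoc)
      next
        case 3
        then show ?thesis by (intro spn_J J_right J_out)
      qed
    qed
    from spn_map_left[OF this Cons.IH] show ?case by (subst wd_Cons)
  qed
  have "x = (\<Sum>l\<in>Poly_Mapping.keys x. scal (Poly_Mapping.lookup x l) * wd l)"
    by (subst (1) pm_single_split[of x]) (simp add: wd_def)
  also have "\<dots> \<in> spn ?S" by (intro spn_sum spn_scal w)
  finally show ?thesis .
qed

end

section \<open>A spanning set of the right size\<close>

text \<open>\<open>T_A\<close> with the list of elements and the starting position left free, as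
  needed for an induction on positions.\<close>

fun Tch :: "nat \<Rightarrow> nat list \<Rightarrow> 'k::field_char_0 free" where
  "Tch i [] = 1"
| "Tch i (a # as) = T_down a i * Tch (Suc i) as"

lemma Tch_eq: "Tch i as = prod_list (map (\<lambda>l. T_down (as ! (l - i)) l) [i..<i + length as])"
proof (induction as arbitrary: i)
  case (Cons a as)
  have e1: "[i..<i + length (a # as)] = i # [Suc i..<Suc i + length as]"
    using upt_conv_Cons[of i "i + length (a # as)"] by simp
  have e2: "map (\<lambda>l. T_down ((a # as) ! (l - i)) l :: 'a free) [Suc i..<Suc i + length as]
      = map (\<lambda>l. T_down (as ! (l - Suc i)) l) [Suc i..<Suc i + length as]"
    by (rule map_cong) (auto simp: nth_Cons' )
  show ?case
    by (simp only: Tch.simps Cons.IH e1 e2 list.map prod_list.Cons diff_self_eq_0 nth_Cons_0)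
qed simp

lemma Tch_T_set:
  assumes "sorted_wrt (<) as"
  shows "Tch 1 as = T_set (set as)"
proof -
  have "sorted_list_of_set (set as) = as"
    using sorted_list_of_set_unique[of "set as" as] assms by (simp add: strict_sorted_iff distinct_card)
  moreover have "card (set as) = length as" using assms by (simp add: distinct_card strict_sorted_iff)
  ultimately show ?thesis by (simp add: Tch_eq T_set_def)
qed

text \<open>Only the positions above \<open>k\<close> occur, since \<open>gN ^ k\<close> absorbs the
  \<open>F\<close>s in the positions \<open>1, ..., k\<close> from its right.\<close>

definition Fm :: "nat \<Rightarrow> nat \<Rightarrow> (nat \<Rightarrow> nat) \<Rightarrow> 'k::field_char_0 free" where
  "Fm n k m = prod_list (map (\<lambda>i. gF i ^ m i) [k+1..<n+1])"

text \<open>A product of the representatives from \<open>coset_right\<close> for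
  \<open>m = k + 1, ..., k + t\<close>, with lower ends chosen independently of each other.\<close>

definition Rch :: "nat \<Rightarrow> nat \<Rightarrow> (nat \<Rightarrow> nat) \<Rightarrow> 'k::field_char_0 free" where
  "Rch k t b = prod_list (map (\<lambda>i. T_down (k + i) (b i)) [1..<t+1])"

text \<open>The \<open>n - r + i\<close> choices for \<open>b i\<close> multiply to
  \<open>binom(n,r) r!\<close>, so the index set has as many elements as
  \<open>Cidx\<close>.\<close>

definition Gidx :: "nat \<Rightarrow> nat \<Rightarrow> (nat \<times> nat set \<times> (nat \<Rightarrow> nat) \<times> (nat \<Rightarrow> nat)) set" where
  "Gidx d n = (SIGMA r:{0..n}. subs n r \<times> ({n-r+1..n} \<rightarrow>\<^sub>E {0..<d}) \<times> (\<Pi>\<^sub>E i\<in>{1..r}. {1..n-r+i}))"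

definition GX :: "nat \<Rightarrow> nat \<times> nat set \<times> (nat \<Rightarrow> nat) \<times> (nat \<Rightarrow> nat) \<Rightarrow> 'k::field_char_0 free" where
  "GX n = (\<lambda>(r, A, m, b). T_set A * gN ^ (n - r) * Fm n (n - r) m * Rch (n - r) r b)"

section \<open>Normal form on the left of a power of \<open>N\<close>\<close>

context RYmod
begin

lemma G_from_1: "G_from 1 = G_upto n"
  by (simp add: G_from_def G_upto_def)

text \<open>On the left of \<open>gN ^ k\<close> the generators in positions above
  \<open>n - k\<close> are absorbed, up to a scalar; an \<open>F_i\<close> in a lower position
  passes to the right as \<open>F_{i+k}\<close>.\<close>

lemma Nk_left:
  assumes "k \<le> n" "x \<in> alg (G_from (n - k + 1))"
  shows "x * gN ^ k \<in> spn {gN ^ k * y |y. y \<in> H}" (is "_ \<in> spn ?S")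
proof (rule left_closed[OF _ _ assms(2)])
  have "gN ^ k = gN ^ k * (1 :: 'k free)" by simp
  then show "gN ^ k \<in> spn ?S" using alg_1 by (intro spn_base) blast
  fix g s assume g: "g \<in> G_from (n - k + 1)" and "s \<in> ?S"
  then obtain y where y: "y \<in> H" "s = gN ^ k * y" by blast
  have mem: "gN ^ k * y \<in> spn ?S" if "y \<in> H" for y using that by (intro spn_base) blast
  consider i where "g = GF i" "i \<in> {1..n}" "n - k < i" | i where "g = GF i" "i \<in> {1..n}" "i \<le> n - k"
    | i where "g = GT i" "i \<in> {n-k+1..<n}"
    using g unfolding G_from_def GFs_def by auto (meson not_le)
  then show "wd [g] * s \<in> spn ?S"
  proof cases
    case 1
    have "gF i * s \<approx> gN ^ k * y" unfolding y(2) mult.assoc[symmetric] using 1 assms(1) by (intro c_r F_absorb_left) auto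
    then show ?thesis unfolding 1 wd_gens by (rule spn_cong) (rule mem[OF y(1)])
  next
    case 2
    have "gF i * s \<approx> gN ^ k * (gF (i + k) * y)" unfolding y(2) mult.assoc[symmetric] using 2 assms(1) by (intro c_r FNk) auto
    moreover have "gF (i + k) * y \<in> H" using 2 assms(1) by (intro alg_mult y F_alg GFs_sub) auto
    ultimately show ?thesis unfolding 2 wd_gens using mem spn_cong by blast
  next
    case 3
    have "gT i * s \<approx> scal uvar * gN ^ k * y" unfolding y(2) mult.assoc[symmetric] using 3 assms(1) by (intro c_r T_absorb_left) auto
    then have "gT i * s \<approx> scal uvar * (gN ^ k * y)" by (simp only: mult.assoc)
    then show ?thesis unfolding 3 wd_gens by (rule spn_cong) (intro spn_scal mem y(1))
  qed
qed

text \<open>The sorting move for the upper ends of two consecutive chains: the ends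
  \<open>a, b\<close> with \<open>b \<le> a\<close> become \<open>b - 1, a\<close>, at the price of
  a factor \<open>T_i\<close> on the right. It results from sliding the letters of the second chain
  through the first.\<close>

lemma T_down_swap:
  assumes "1 \<le> i" "Suc i \<le> b" "b \<le> a" "a \<le> n"
  shows "T_down a i * T_down b (Suc i) \<approx> T_down (b - 1) i * T_down a (Suc i) * gT i"
proof -
  have "T_down a i * T_down b (Suc i) \<approx> T_down (b - 1) i * T_down a i"
    using assms(2,3)
  proof (induction b rule: dec_induct)
    case base then show ?case by simp
  next
    case (step c)
    have IH: "T_down a i * T_down c (Suc i) \<approx> T_down (c - 1) i * T_down a i" using step by simp
    have c: "Suc (c - 1) = c" using step by simp
    have sl: "gT (c - 1) * T_down a i \<approx> T_down a i * gT (Suc (c - 1))"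
      using step assms by (intro slide) auto
    have "T_down a i * T_down (Suc c) (Suc i) = T_down a i * gT c * (T_down c (Suc i) :: 'k free)"
      using step by (simp add: T_down_Suc mult.assoc)
    also have "\<dots> \<approx> gT (c - 1) * T_down a i * T_down c (Suc i)" by (intro c_r c_sym[OF sl[unfolded c]])
    also have "\<dots> = gT (c - 1) * (T_down a i * T_down c (Suc i))" by (simp add: mult.assoc)
    also have "\<dots> \<approx> gT (c - 1) * (T_down (c - 1) i * T_down a i)" by (intro c_l IH)
    also have "\<dots> = (gT (c - 1) * T_down (c - 1) i) * T_down a i" by (simp add: mult.assoc)
    also have "gT (c - 1) * T_down (c - 1) i = (T_down (Suc c - 1) i :: 'k free)"
    proof -
      have "T_down (Suc (c - 1)) i = gT (c - 1) * (T_down (c - 1) i :: 'k free)"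
        by (rule T_down_Suc) (use step in simp)
      then show ?thesis unfolding c by simp
    qed
    finally show ?case .
  qed
  also have "T_down (b - 1) i * T_down a i = T_down (b - 1) i * T_down a (Suc i) * (gT i :: 'k free)"
    using assms by (simp add: T_down_step[of i a] mult.assoc)
  finally show ?thesis .
qed

text \<open>The partially sorted form: the chains start at \<open>i, ..., n - k\<close> and their
  upper ends increase. For \<open>i = 1\<close> this is \<open>T_A N^k y\<close> with a set
  \<open>A\<close> of size \<open>n - k\<close>.\<close>

definition Lset :: "nat \<Rightarrow> nat \<Rightarrow> 'k free set" where
  "Lset k i = {Tch i as * (gN ^ k * y) |as y. sorted_wrt (<) as \<and> set as \<subseteq> {i..n} \<and> i + length as = n - k + 1 \<and> y \<in> H}"

lemma Tch_T_comm:
  assumes "1 \<le> i" "i < n" "Suc (Suc i) \<le> l" "set as \<subseteq> {1..n}"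
  shows "gT i * Tch l as \<approx> Tch l as * gT i"
  using assms(3,4)
proof (induction as arbitrary: l)
  case Nil then show ?case by simp
next
  case (Cons a as)
  have 1: "gT i * T_down a l \<approx> T_down a l * gT i"
    unfolding T_down_def using assms(1,2) Cons.prems by (intro T_tw_comm) auto
  have 2: "gT i * Tch (Suc l) as \<approx> Tch (Suc l) as * gT i" using Cons by auto
  have "gT i * Tch l (a # as) = (gT i * T_down a l) * Tch (Suc l) as" by (simp add: mult.assoc)
  also have "\<dots> \<approx> (T_down a l * gT i) * Tch (Suc l) as" by (intro c_r 1)
  also have "\<dots> = T_down a l * (gT i * Tch (Suc l) as)" by (simp add: mult.assoc)
  also have "\<dots> \<approx> T_down a l * (Tch (Suc l) as * gT i)" by (intro c_l 2)
  finally show ?case by (simp add: mult.assoc)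
qed

lemma T_down_alg: "1 \<le> l \<Longrightarrow> i \<le> l \<Longrightarrow> a \<le> n \<Longrightarrow> T_down a l \<in> alg (G_from i)"
  unfolding T_down_def by (intro alg_tw) (auto simp: G_from_def)

lemma Tch_alg: "1 \<le> l \<Longrightarrow> i \<le> l \<Longrightarrow> set as \<subseteq> {1..n} \<Longrightarrow> Tch l as \<in> alg (G_from i)"
  by (induction as arbitrary: l) (auto intro!: alg_1 alg_mult T_down_alg)

text \<open>Downward induction on \<open>i\<close>, putting the chains of \<open>coset_left\<close>
  in front. If the upper end \<open>a\<close> breaks the order, \<open>T_down_swap\<close> replaces
  it by a smaller one, which explains the inner induction on \<open>a\<close>. The surplus
  \<open>T_i\<close> commutes with the remaining chains and leaves through \<open>N^k\<close> as
  \<open>T_{i+k}\<close>.\<close>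

lemma left_normal:
  assumes k: "k \<le> n" and "i \<le> n - k + 1" "1 \<le> i"
  shows "\<forall>x y. x \<in> alg (G_from i) \<longrightarrow> y \<in> H \<longrightarrow> x * (gN ^ k * y) \<in> spn (Lset k i)"
  using assms(2,3)
proof (induction i rule: inc_induct)
  case base
  show ?case
  proof (intro allI impI)
    fix x y assume x: "x \<in> alg (G_from (n - k + 1))" and y: "y \<in> H"
    have "1 * (x * gN ^ k) * y \<in> spn (Lset k (n - k + 1))"
    proof (rule spn_map[OF _ Nk_left[OF k x]])
      fix s assume "s \<in> {gN ^ k * y |y. y \<in> H}"
      then obtain z where z: "z \<in> H" "s = gN ^ k * z" by blast
      have "1 * s * y = Tch (n - k + 1) [] * (gN ^ k * (z * y))" unfolding z(2) by (simp add: mult.assoc)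
      moreover have "\<dots> \<in> Lset k (n - k + 1)" unfolding Lset_def using alg_mult[OF z(1) y] by fastforce
      ultimately show "1 * s * y \<in> spn (Lset k (n - k + 1))" using spn_base by simp
    qed
    then show "x * (gN ^ k * y) \<in> spn (Lset k (n - k + 1))" by (simp add: mult.assoc)
  qed
next
  case (step i)
  have i: "1 \<le> i" "i \<le> n" "i \<le> n - k" using step by auto
  have IH: "x * (gN ^ k * y) \<in> spn (Lset k (Suc i))" if "x \<in> alg (G_from (Suc i))" "y \<in> H" for x y
    using step.IH that by auto
  have mem: "Tch i as * (gN ^ k * y) \<in> spn (Lset k i)"
    if "sorted_wrt (<) as" "set as \<subseteq> {i..n}" "i + length as = n - k + 1" "y \<in> H" for as y
    unfolding Lset_def using that by (intro spn_base) blast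
  have inner: "\<forall>s\<in>Lset k (Suc i). T_down a i * s \<in> spn (Lset k i)" if "a \<in> {i..n}" for a
    using that
  proof (induction a rule: less_induct)
    case (less a)
    show ?case
    proof
      fix s assume "s \<in> Lset k (Suc i)"
      then obtain as y where as: "sorted_wrt (<) as" "set as \<subseteq> {Suc i..n}" "Suc i + length as = n - k + 1"
        and y: "y \<in> H" and s: "s = Tch (Suc i) as * (gN ^ k * y)" unfolding Lset_def by blast
      show "T_down a i * s \<in> spn (Lset k i)"
      proof (cases "\<forall>c\<in>set as. a < c")
        case True
        have "Tch i (a # as) * (gN ^ k * y) \<in> spn (Lset k i)"
          using True as less.prems y by (intro mem) auto
        then show ?thesis unfolding s by (simp add: mult.assoc)
      next
        case False
        then obtain b bs where ab: "as = b # bs" by (cases as) auto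
        have ba: "b \<le> a" using False as(1) unfolding ab by fastforce
        have b: "Suc i \<le> b" "b \<le> n" and a: "a \<le> n" "i \<le> a" using as(2) less.prems unfolding ab by auto
        \<comment> \<open>The list is non-empty here, which is just enough for \<open>T_i\<close> to
          pass \<open>gN ^ k\<close>.\<close>
        have ik: "i + k < n" using as(3) k unfolding ab by auto
        have bs: "set bs \<subseteq> {1..n}" using as(2) unfolding ab by auto
        have 1: "T_down a i * T_down b (Suc i) \<approx> T_down (b - 1) i * T_down a (Suc i) * gT i"
          using i b ba a by (intro T_down_swap) auto
        have 2: "gT i * Tch (Suc (Suc i)) bs \<approx> Tch (Suc (Suc i)) bs * gT i"
          using i ik bs by (intro Tch_T_comm) auto
        let ?x = "T_down a (Suc i) * Tch (Suc (Suc i)) bs" and ?y = "gT (i + k) * y"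
        have "T_down a i * s = (T_down a i * T_down b (Suc i)) * (Tch (Suc (Suc i)) bs * (gN ^ k * y))"
          unfolding s ab by (simp add: mult.assoc)
        also have "\<dots> \<approx> (T_down (b - 1) i * T_down a (Suc i) * gT i) * (Tch (Suc (Suc i)) bs * (gN ^ k * y))"
          by (intro c_r 1)
        also have "\<dots> = T_down (b - 1) i * T_down a (Suc i) * ((gT i * Tch (Suc (Suc i)) bs) * (gN ^ k * y))"
          by (simp add: mult.assoc)
        also have "\<dots> \<approx> T_down (b - 1) i * T_down a (Suc i) * ((Tch (Suc (Suc i)) bs * gT i) * (gN ^ k * y))"
          by (intro c_l c_r 2)
        also have "\<dots> = T_down (b - 1) i * ?x * ((gT i * gN ^ k) * y)" by (simp add: mult.assoc)
        also have "\<dots> \<approx> T_down (b - 1) i * ?x * ((gN ^ k * gT (i + k)) * y)"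
          by (intro c_l c_r TNk i ik)
        also have "\<dots> = T_down (b - 1) i * (?x * (gN ^ k * ?y))" by (simp add: mult.assoc)
        finally have eq: "T_down a i * s \<approx> T_down (b - 1) i * (?x * (gN ^ k * ?y))" .
        have x: "?x \<in> alg (G_from (Suc i))" using a bs by (intro alg_mult T_down_alg Tch_alg) auto
        have y': "?y \<in> H" using ik i by (intro alg_mult y T_alg) (auto simp: G_from_def)
        have lt: "b - 1 < a" "b - 1 \<in> {i..n}" using b ba by auto
        have "T_down (b - 1) i * (?x * (gN ^ k * ?y)) \<in> spn (Lset k i)"
          by (rule spn_map_left[OF _ IH[OF x y']]) (use less.IH[OF lt] in blast)
        then show ?thesis by (rule spn_cong[OF eq])
      qed
    qed
  qed
  show ?case
  proof (intro allI impI)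
    fix x y assume x: "x \<in> alg (G_from i)" and y: "y \<in> H"
    show "x * (gN ^ k * y) \<in> spn (Lset k i)"
    proof (rule spn_map_right[OF _ coset_left[OF i(1,2) x]])
      fix s assume "s \<in> {T_down a i * y |a y. a \<in> {i..n} \<and> y \<in> alg (G_from (Suc i))}"
      then obtain a z where a: "a \<in> {i..n}" and z: "z \<in> alg (G_from (Suc i))" and s: "s = T_down a i * z" by blast
      have "T_down a i * (z * (gN ^ k * y)) \<in> spn (Lset k i)"
        by (rule spn_map_left[OF _ IH[OF z y]]) (use inner[OF a] in blast)
      then show "s * (gN ^ k * y) \<in> spn (Lset k i)" unfolding s by (simp add: mult.assoc)
    qed
  qed
qed

section \<open>Normal form on the right of a power of \<open>N\<close>\<close>

lemma F_Fprod:
  assumes "i \<in> {1..n}" "set js \<subseteq> {1..n}"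
  shows "prod_list (map (\<lambda>i. gF i ^ m i) js) * gF i \<approx> gF i * prod_list (map (\<lambda>i. gF i ^ m i) js)"
  using assms(2)
proof (induction js)
  case Nil then show ?case by simp
next
  case (Cons a js)
  let ?P = "prod_list (map (\<lambda>i. gF i ^ m i) js) :: 'k free"
  have p: "gF a ^ e * gF i \<approx> gF i * gF a ^ e" for e
  proof (induction e)
    case 0 then show ?case by simp
  next
    case (Suc e)
    have "gF a ^ Suc e * gF i = gF a * (gF a ^ e * gF i)" by (simp add: mult.assoc)
    also have "\<dots> \<approx> gF a * (gF i * gF a ^ e)" by (intro c_l Suc)
    also have "\<dots> = (gF a * gF i) * gF a ^ e" by (simp add: mult.assoc)
    also have "\<dots> \<approx> (gF i * gF a) * gF a ^ e" using Cons.prems assms(1) by (intro c_r FF) auto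
    finally show ?case by (simp add: mult.assoc)
  qed
  have IH: "?P * gF i \<approx> gF i * ?P" using Cons by simp
  have "prod_list (map (\<lambda>i. gF i ^ m i) (a # js)) * gF i = gF a ^ m a * (?P * gF i)" by (simp add: mult.assoc)
  also have "\<dots> \<approx> gF a ^ m a * (gF i * ?P)" by (intro c_l IH)
  also have "\<dots> = (gF a ^ m a * gF i) * ?P" by (simp add: mult.assoc)
  also have "\<dots> \<approx> (gF i * gF a ^ m a) * ?P" by (intro c_r p)
  finally show ?case by (simp add: mult.assoc)
qed

lemma F_pow_mod:
  assumes "i \<in> {1..n}" shows "gF i ^ e \<approx> gF i ^ (e mod d)"
proof -
  have "gF i ^ e = (gF i ^ d) ^ (e div d) * (gF i ^ (e mod d) :: 'k free)"
    by (metis mult_div_mod_eq power_add power_mult)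
  also have "\<dots> \<approx> 1 ^ (e div d) * gF i ^ (e mod d)" by (intro c_r c_pow F_pow assms)
  finally show ?thesis by simp
qed

lemma Fm_step:
  assumes i: "i \<in> {k+1..n}" and m: "m \<in> {k+1..n} \<rightarrow>\<^sub>E {0..<d}"
  shows "\<exists>m'\<in>{k+1..n} \<rightarrow>\<^sub>E {0..<d}. Fm n k m * gF i \<approx> Fm n k m'"
proof
  let ?m = "m(i := Suc (m i) mod d)"
  show "?m \<in> {k+1..n} \<rightarrow>\<^sub>E {0..<d}"
    using m i d1 by (auto simp: PiE_iff extensional_def)
  have "[k+1..<n+1] = [k+1..<i] @ [i..<n+1]" using i upt_add_eq_append[of "k+1" i "n + 1 - i"] by simp
  then have sp: "[k+1..<n+1] = [k+1..<i] @ i # [i+1..<n+1]" using i by (simp add: upt_conv_Cons)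
  let ?P = "\<lambda>js. prod_list (map (\<lambda>i. gF i ^ m i) js) :: 'k free"
  have l: "map (\<lambda>l. gF l ^ ?m l) [k+1..<i] = map (\<lambda>l. gF l ^ m l :: 'k free) [k+1..<i]"
    and r: "map (\<lambda>l. gF l ^ ?m l) [i+1..<n+1] = map (\<lambda>l. gF l ^ m l :: 'k free) [i+1..<n+1]"
    by (auto intro!: map_cong)
  have "Fm n k m * gF i = ?P [k+1..<i] * gF i ^ m i * (?P [i+1..<n+1] * gF i)"
    unfolding Fm_def sp by (simp add: mult.assoc)
  also have "\<dots> \<approx> ?P [k+1..<i] * gF i ^ m i * (gF i * ?P [i+1..<n+1])"
    using i by (intro c_l F_Fprod) auto
  also have "\<dots> = ?P [k+1..<i] * gF i ^ Suc (m i) * ?P [i+1..<n+1]"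
    by (simp add: mult.assoc power_Suc2 del: power_Suc)
  also have "\<dots> \<approx> ?P [k+1..<i] * gF i ^ (Suc (m i) mod d) * ?P [i+1..<n+1]"
    using i by (intro c_r c_l F_pow_mod) auto
  also have "\<dots> = Fm n k ?m"
    unfolding Fm_def sp map_append list.map l r by (simp add: mult.assoc)
  finally show "Fm n k m * gF i \<approx> Fm n k ?m" .
qed

definition Rset :: "nat \<Rightarrow> nat \<Rightarrow> 'k free set" where
  "Rset k t = {gN ^ k * Fm n k m * Rch k t b |m b. m \<in> {k+1..n} \<rightarrow>\<^sub>E {0..<d} \<and> b \<in> (\<Pi>\<^sub>E i\<in>{1..t}. {1..k+i})}"

text \<open>From the right, \<open>N^k\<close> absorbs \<open>F_1, ..., F_k\<close> and, up to a
  scalar, \<open>T_1, ..., T_{k-1}\<close>. The surviving \<open>F\<close>s sit in positions above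
  \<open>k\<close>, which these \<open>T\<close>s leave alone, so the generators commute past them
  to reach \<open>N^k\<close>.\<close>

lemma right_base:
  assumes k: "k \<le> n" and y: "y \<in> alg (G_upto k)"
  shows "gN ^ k * y \<in> spn {gN ^ k * Fm n k m |m. m \<in> {k+1..n} \<rightarrow>\<^sub>E {0..<d}}" (is "_ \<in> spn ?S")
proof (rule right_closed[OF _ _ y])
  let ?z = "\<lambda>i\<in>{k+1..n}. 0 :: nat"
  have "Fm n k ?z = (1 :: 'k free)"
  proof -
    have e: "map (\<lambda>i. gF i ^ ?z i) [k+1..<n+1] = map (\<lambda>i. 1 :: 'k free) [k+1..<n+1]" by (rule map_cong) auto
    have "prod_list (map (\<lambda>i. 1 :: 'k free) js) = 1" for js :: "nat list" by (induction js) auto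
    then show ?thesis unfolding Fm_def e by blast
  qed
  moreover have "?z \<in> {k+1..n} \<rightarrow>\<^sub>E {0..<d}" using d1 by auto
  ultimately have "gN ^ k \<in> ?S" by (metis (mono_tags, lifting) mem_Collect_eq mult_1_right)
  then show "gN ^ k \<in> spn ?S" by (rule spn_base)
next
  fix g s assume g: "g \<in> G_upto k" and "s \<in> ?S"
  then obtain m where m: "m \<in> {k+1..n} \<rightarrow>\<^sub>E {0..<d}" and s: "s = gN ^ k * Fm n k m" by blast
  have mem: "gN ^ k * Fm n k m \<in> spn ?S" if "m \<in> {k+1..n} \<rightarrow>\<^sub>E {0..<d}" for m using that by (intro spn_base) blast
  consider i where "g = GF i" "i \<in> {1..n}" "i \<le> k" | i where "g = GF i" "i \<in> {k+1..n}" | i where "g = GT i" "i \<in> {1..<k}"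
    using g unfolding G_upto_def GFs_def by auto (metis not_less_eq_eq)
  then show "s * wd [g] \<in> spn ?S"
  proof cases
    case 1
    have "s * gF i = gN ^ k * (Fm n k m * gF i)" unfolding s by (simp add: mult.assoc)
    also have "\<dots> \<approx> gN ^ k * (gF i * Fm n k m)" unfolding Fm_def using 1 by (intro c_l F_Fprod) auto
    also have "\<dots> = (gN ^ k * gF i) * Fm n k m" by (simp add: mult.assoc)
    also have "\<dots> \<approx> gN ^ k * Fm n k m" using 1 k by (intro c_r F_absorb_right) auto
    finally show ?thesis unfolding 1 wd_gens by (rule spn_cong) (rule mem[OF m])
  next
    case 2
    obtain m' where m': "m' \<in> {k+1..n} \<rightarrow>\<^sub>E {0..<d}" "Fm n k m * gF i \<approx> Fm n k m'" using Fm_step[OF 2(2) m] by blast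
    have "s * gF i \<approx> gN ^ k * Fm n k m'" unfolding s mult.assoc by (intro c_l m')
    then show ?thesis unfolding 2 wd_gens by (rule spn_cong) (rule mem[OF m'(1)])
  next
    case 3
    have ik: "i < k" "1 \<le> i" using 3 by auto
    have c: "gF l * gT i \<approx> gT i * gF l" if "l \<in> {k+1..n}" for l
    proof -
      have "tp i (i + 1) l = l" using that 3 by (auto simp: transpose_def)
      then show ?thesis using FT[of i l] that 3 k by auto
    qed
    have cp: "gF l ^ e * gT i \<approx> gT i * gF l ^ e" if l: "l \<in> {k+1..n}" for l e
    proof (induction e)
      case 0 then show ?case by simp
    next
      case (Suc e)
      have "gF l ^ Suc e * gT i = gF l * (gF l ^ e * gT i)" by (simp add: mult.assoc)
      also have "\<dots> \<approx> gF l * (gT i * gF l ^ e)" by (intro c_l Suc)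
      also have "\<dots> = (gF l * gT i) * gF l ^ e" by (simp add: mult.assoc)
      also have "\<dots> \<approx> (gT i * gF l) * gF l ^ e" by (intro c_r c l)
      finally show ?case by (simp add: mult.assoc)
    qed
    have comm: "prod_list (map (\<lambda>i. gF i ^ m i) js) * gT i \<approx> gT i * prod_list (map (\<lambda>i. gF i ^ m i) js)"
      if "set js \<subseteq> {k+1..n}" for js
      using that
    proof (induction js)
      case Nil then show ?case by simp
    next
      case (Cons l js)
      let ?P = "prod_list (map (\<lambda>i. gF i ^ m i) js) :: 'k free"
      have IH: "?P * gT i \<approx> gT i * ?P" using Cons by simp
      have "prod_list (map (\<lambda>i. gF i ^ m i) (l # js)) * gT i = gF l ^ m l * (?P * gT i)" by (simp add: mult.assoc)
      also have "\<dots> \<approx> gF l ^ m l * (gT i * ?P)" by (intro c_l IH)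
      also have "\<dots> = (gF l ^ m l * gT i) * ?P" by (simp add: mult.assoc)
      also have "\<dots> \<approx> (gT i * gF l ^ m l) * ?P" using Cons.prems by (intro c_r cp) auto
      finally show ?case by (simp add: mult.assoc)
    qed
    have "s * gT i = gN ^ k * (Fm n k m * gT i)" unfolding s by (simp add: mult.assoc)
    also have "\<dots> \<approx> gN ^ k * (gT i * Fm n k m)" unfolding Fm_def by (intro c_l comm) auto
    also have "\<dots> = (gN ^ k * gT i) * Fm n k m" by (simp add: mult.assoc)
    also have "\<dots> \<approx> (scal uvar * gN ^ k) * Fm n k m" using ik k by (intro c_r T_absorb_right) auto
    also have "\<dots> = scal uvar * (gN ^ k * Fm n k m)" by (simp add: mult.assoc)
    finally show ?thesis unfolding 3 wd_gens by (rule spn_cong) (intro spn_scal mem[OF m])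
  qed
qed

text \<open>\<open>coset_right\<close> splits off one chain after another, for
  \<open>m = k + t\<close> down to \<open>k + 1\<close>, until only \<open>alg (G_upto k)\<close>
  remains next to \<open>N^k\<close>.\<close>

lemma right_normal:
  assumes k: "k \<le> n"
  shows "k + t \<le> n \<Longrightarrow> y \<in> alg (G_upto (k + t)) \<Longrightarrow> gN ^ k * y \<in> spn (Rset k t)"
proof (induction t arbitrary: y)
  case 0
  have "gN ^ k * y \<in> spn {gN ^ k * Fm n k m |m. m \<in> {k+1..n} \<rightarrow>\<^sub>E {0..<d}}"
    by (rule right_base[OF k]) (use 0 in simp)
  then show ?case
  proof (rule spn_mono[rotated])
    fix x :: "'k free" assume "x \<in> {gN ^ k * Fm n k m |m. m \<in> {k+1..n} \<rightarrow>\<^sub>E {0..<d}}"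
    then obtain m where m: "m \<in> {k+1..n} \<rightarrow>\<^sub>E {0..<d}" "x = gN ^ k * Fm n k m" by blast
    have "x = gN ^ k * Fm n k m * Rch k 0 (\<lambda>_. undefined)" unfolding m(2) by (simp add: Rch_def)
    moreover have "(\<lambda>_. undefined) \<in> (\<Pi>\<^sub>E i\<in>{1..0::nat}. {1..k+i})" by simp
    ultimately show "x \<in> spn (Rset k 0)" unfolding Rset_def using m(1) by (intro spn_base) blast
  qed
next
  case (Suc t)
  have le: "1 \<le> k + Suc t" "k + Suc t \<le> n" "k + t \<le> n" using Suc.prems by auto
  show ?case
  proof (rule spn_map_left[OF _ coset_right[OF le(1,2) Suc.prems(2)]])
    fix s assume "s \<in> {y * T_down (k + Suc t) b |b y. b \<in> {1..k + Suc t} \<and> y \<in> alg (G_upto (k + Suc t - 1))}"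
    then obtain c z where c: "c \<in> {1..k + Suc t}" and z: "z \<in> alg (G_upto (k + t))" and s: "s = z * T_down (k + Suc t) c" by auto
    have "gN ^ k * z * T_down (k + Suc t) c \<in> spn (Rset k (Suc t))"
    proof (rule spn_map_right[OF _ Suc.IH[OF le(3) z]])
      fix v assume "v \<in> Rset k t"
      then obtain m b where m: "m \<in> {k+1..n} \<rightarrow>\<^sub>E {0..<d}" and b: "b \<in> (\<Pi>\<^sub>E i\<in>{1..t}. {1..k+i})"
        and v: "v = gN ^ k * Fm n k m * Rch k t b" unfolding Rset_def by blast
      let ?b = "b(Suc t := c)"
      have e: "map (\<lambda>i. T_down (k + i) (?b i)) [1..<t+1] = map (\<lambda>i. T_down (k + i) (b i) :: 'k free) [1..<t+1]"
        by (rule map_cong) auto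
      have u: "[1..<Suc t + 1] = [1..<t+1] @ [Suc t]" by simp
      have "Rch k (Suc t) ?b = Rch k t b * (T_down (k + Suc t) c :: 'k free)"
        by (simp only: Rch_def u map_append e list.map prod_list.append prod_list.Cons prod_list.Nil mult_1_right fun_upd_same)
      then have "v * T_down (k + Suc t) c = gN ^ k * Fm n k m * Rch k (Suc t) ?b" unfolding v by (simp add: mult.assoc)
      moreover have "?b \<in> (\<Pi>\<^sub>E i\<in>{1..Suc t}. {1..k+i})"
        using b c by (auto simp: PiE_iff extensional_def le_Suc_eq)
      ultimately show "v * T_down (k + Suc t) c \<in> spn (Rset k (Suc t))"
        unfolding Rset_def using m by (intro spn_base) blast
    qed
    then show "gN ^ k * s \<in> spn (Rset k (Suc t))" unfolding s by (simp add: mult.assoc)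
  qed
qed

text \<open>An element \<open>x N^k y\<close> is first sorted on the left into multiples
  \<open>T_A N^k z\<close>, and then \<open>N^k z\<close> is expanded on the right; the rank is
  \<open>r = n - k\<close>.\<close>

theorem spanning: "x \<in> spn (GX n ` Gidx d n)"
proof (rule spn_mono[OF _ span_HNH])
  fix s assume "s \<in> {x * gN ^ k * y |x k y. x \<in> H \<and> k \<le> n \<and> y \<in> H}"
  then obtain x k y where x: "x \<in> H" and k: "k \<le> n" and y: "y \<in> H" and s: "s = x * (gN ^ k * y)"
    by (auto simp: mult.assoc)
  have "x * (gN ^ k * y) \<in> spn (Lset k 1)" using left_normal[OF k, of 1] x y by auto
  then show "s \<in> spn (GX n ` Gidx d n)" unfolding s
  proof (rule spn_mono[rotated])
    fix v assume "v \<in> Lset k 1"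
    then obtain as z where as: "sorted_wrt (<) as" "set as \<subseteq> {1..n}" "1 + length as = n - k + 1"
      and z: "z \<in> H" and v: "v = Tch 1 as * (gN ^ k * z)" unfolding Lset_def by blast
    let ?r = "n - k"
    have A: "set as \<in> subs n ?r" using as by (simp add: subs_def distinct_card strict_sorted_iff)
    have kr: "n - ?r = k" "k + ?r = n" using k by auto
    have "gN ^ k * z \<in> spn (Rset k ?r)"
      by (rule right_normal[OF k]) (use z kr G_from_1 in auto)
    then show "v \<in> spn (GX n ` Gidx d n)" unfolding v
    proof (rule spn_map_left[rotated])
      fix t assume "t \<in> Rset k ?r"
      then obtain m b where m: "m \<in> {k+1..n} \<rightarrow>\<^sub>E {0..<d}" and b: "b \<in> (\<Pi>\<^sub>E i\<in>{1..?r}. {1..k+i})"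
        and t: "t = gN ^ k * Fm n k m * Rch k ?r b" unfolding Rset_def by blast
      have "(?r, set as, m, b) \<in> Gidx d n" unfolding Gidx_def using A m b by (simp add: kr)
      moreover have "Tch 1 as * t = GX n (?r, set as, m, b)"
        unfolding GX_def t Tch_T_set[OF as(1)] by (simp add: kr mult.assoc)
      ultimately show "Tch 1 as * t \<in> spn (GX n ` Gidx d n)" by (intro spn_base) (rule image_eqI)
    qed
  qed
qed

end

section \<open>Cardinalities\<close>

lemma card_subs: "card (subs n r) = n choose r"
  using n_subsets[of "{1..n}" r] by (simp add: subs_def)

lemma prod_fact: "k + r = n \<Longrightarrow> (\<Prod>i\<in>{1..r}. k + i) = (n choose r) * fact r"
proof (induction r arbitrary: n)
  case (Suc r)
  have "(\<Prod>i\<in>{1..Suc r}. k + i) = ((n - 1) choose r) * fact r * n"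
    using Suc.IH[of "n - 1"] Suc.prems by simp
  also have "\<dots> = fact r * (n * ((n - 1) choose r))" by simp
  also have "n * ((n - 1) choose r) = Suc r * (n choose Suc r)"
    using Suc_times_binomial_eq[of "n - 1" r] Suc.prems by (cases n) auto
  finally show ?case by (simp only: fact_Suc of_nat_id mult_ac)
qed simp

lemma card_Gidx: "card (Gidx d n) = (\<Sum>r=0..n. d ^ r * (n choose r)\<^sup>2 * fact r)"
proof -
  have "card (Gidx d n) = (\<Sum>r\<in>{0..n}. card (subs n r \<times> ({n-r+1..n} \<rightarrow>\<^sub>E {0..<d}) \<times> (\<Pi>\<^sub>E i\<in>{1..r}. {1..n-r+i})))"
    unfolding Gidx_def by (rule card_SigmaI) (auto intro!: finite_cartesian_product finite_subs finite_PiE)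
  also have "\<dots> = (\<Sum>r=0..n. d ^ r * (n choose r)\<^sup>2 * fact r)"
  proof (rule sum.cong[OF refl])
    fix r assume r: "r \<in> {0..n}"
    have 1: "card ({n-r+1..n} \<rightarrow>\<^sub>E {0..<d}) = d ^ r"
      using r by (simp add: card_PiE)
    have "card (\<Pi>\<^sub>E i\<in>{1..r}. {1..n-r+i}) = (\<Prod>i\<in>{1..r}. (n - r) + i)" by (simp add: card_PiE)
    also have "\<dots> = (n choose r) * fact r" using r by (intro prod_fact) auto
    finally show "card (subs n r \<times> ({n-r+1..n} \<rightarrow>\<^sub>E {0..<d}) \<times> (\<Pi>\<^sub>E i\<in>{1..r}. {1..n-r+i})) = d ^ r * (n choose r)\<^sup>2 * fact r"
      unfolding card_cartesian_product 1 card_subs by (simp add: power2_eq_square)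
  qed
  finally show ?thesis .
qed

lemma finite_Gidx: "finite (Gidx d n)"
  unfolding Gidx_def by (intro finite_SigmaI finite_cartesian_product finite_subs finite_PiE) auto

lemma card_Cidx: "card (Cidx d n) = (\<Sum>r=0..n. d ^ r * (n choose r)\<^sup>2 * fact r)"
proof -
  have "card (Cidx d n) = (\<Sum>r\<in>{0..n}. card (subs n r \<times> subs n r \<times> ({1..r} \<rightarrow>\<^sub>E {0..<d}) \<times> {p. p permutes {1..r}}))"
    unfolding Cidx_def by (rule card_SigmaI) (auto intro!: finite_cartesian_product finite_subs finite_PiE finite_permutations)
  also have "\<dots> = (\<Sum>r=0..n. d ^ r * (n choose r)\<^sup>2 * fact r)"
  proof (rule sum.cong[OF refl])
    fix r
    have 1: "card ({1..r} \<rightarrow>\<^sub>E {0..<d}) = d ^ r" by (simp add: card_PiE)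
    have 2: "card {p. p permutes {1..r}} = fact r" by (rule card_permutations) auto
    show "card (subs n r \<times> subs n r \<times> ({1..r} \<rightarrow>\<^sub>E {0..<d}) \<times> {p. p permutes {1..r}}) = d ^ r * (n choose r)\<^sup>2 * fact r"
      unfolding card_cartesian_product 1 2 card_subs by (simp add: power2_eq_square)
  qed
  finally show ?thesis .
qed

section \<open>The quotient algebra\<close>

lemma free_alg_simps [simp]:
  "carrier (free_alg n) = carr n" "monoid.mult (free_alg n) = (*)" "monoid.one (free_alg n) = 1"
  "ring.zero (free_alg n) = 0" "ring.add (free_alg n) = (+)"
  by (simp_all add: free_alg_def carr_def)

lemma free_alg_ring: "ring (free_alg n :: 'k::field_char_0 free ring)"
proof (rule ringI)
  show "abelian_group (free_alg n :: 'k free ring)"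
  proof (rule abelian_groupI)
    fix x :: "'k free" assume "x \<in> carrier (free_alg n)"
    then show "\<exists>y\<in>carrier (free_alg n). y \<oplus>\<^bsub>free_alg n\<^esub> x = \<zero>\<^bsub>free_alg n\<^esub>"
      by (intro bexI[of _ "- x"]) (simp_all add: carr_minus)
  qed (simp_all add: carr_add carr_0 add.assoc add.commute)
  show "Group.monoid (free_alg n :: 'k free ring)"
    by (rule monoidI) (simp_all add: carr_mult carr_1 mult.assoc)
qed (simp_all add: distrib_left distrib_right)

lemma relators_carr:
  assumes n: "1 \<le> n" and x: "x \<in> relators d n"
  shows "x \<in> carr n"
  using x
proof cases
  case (T_F i k)
  then show ?thesis
    using tp_range[OF T_F(2,3)] by (simp only: T_F(1)) (intro carr_diff carr_mult carr_gT carr_gF, auto)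
next
  case (quadratic i)
  then show ?thesis unfolding gE_def
    by (simp only:) (intro carr_diff carr_add carr_mult carr_gT carr_gF carr_pow carr_scal carr_sum, auto)
next
  case (N_T_N)
  then show ?thesis
    by (simp only:) (intro carr_diff carr_mult carr_gN carr_scal carr_T_word, auto)
qed (use n in \<open>auto intro!: carr_diff carr_mult carr_gT carr_gF carr_gN carr_pow carr_scal carr_1\<close>)

text \<open>The algebra projection that sends the generators outside \<open>gens n\<close> to
  0.\<close>

definition rpi :: "nat \<Rightarrow> 'k::field_char_0 free \<Rightarrow> 'k free" where
  "rpi n x = (\<Sum>l\<in>{l \<in> Poly_Mapping.keys x. l \<in> lists (gens n)}. Poly_Mapping.single l (Poly_Mapping.lookup x l))"

lemma lookup_rpi: "Poly_Mapping.lookup (rpi n x) l = (if l \<in> lists (gens n) then Poly_Mapping.lookup x l else 0)"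
  by (auto simp: rpi_def lookup_sum lookup_single when_def in_keys_iff sum.delta' sum.If_cases
      intro!: sum.neutral)

lemma rpi_add: "rpi n (x + y) = rpi n x + rpi n y"
  by (rule poly_mapping_eqI) (simp add: lookup_rpi lookup_add)
lemma rpi_0: "rpi n 0 = 0"
  by (rule poly_mapping_eqI) (simp add: lookup_rpi)
lemma rpi_sum: "rpi n (sum f A) = (\<Sum>a\<in>A. rpi n (f a))"
  by (induction A rule: infinite_finite_induct) (simp_all add: rpi_0 rpi_add)
lemma rpi_single: "rpi n (Poly_Mapping.single l c) = (if l \<in> lists (gens n) then Poly_Mapping.single l c else 0)"
  by (rule poly_mapping_eqI) (auto simp: lookup_rpi lookup_single when_def)
lemma rpi_carr: "rpi n x \<in> carr n"
  unfolding carr_def by (auto simp: in_keys_iff lookup_rpi split: if_splits)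
lemma rpi_id: "x \<in> carr n \<Longrightarrow> rpi n x = x"
  unfolding carr_def by (intro poly_mapping_eqI) (auto simp: lookup_rpi in_keys_iff subset_iff)

text \<open>A concatenation avoids foreign generators exactly when both parts do. Multiplicativity
  is what makes the preimage of the relation ideal an ideal of the whole free algebra.\<close>

lemma rpi_mult: "rpi n (x * y) = rpi n x * rpi n y"
proof -
  have s: "rpi n (Poly_Mapping.single l c * Poly_Mapping.single l' c') = rpi n (Poly_Mapping.single l c) * rpi n (Poly_Mapping.single l' c')" for l l' c c'
    by (auto simp: mult_single rpi_single plus_list_def)
  have "x * y = (\<Sum>l\<in>Poly_Mapping.keys x. \<Sum>l'\<in>Poly_Mapping.keys y.
      Poly_Mapping.single l (Poly_Mapping.lookup x l) * Poly_Mapping.single l' (Poly_Mapping.lookup y l'))"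
    by (subst (1) pm_single_split[of x], subst (1) pm_single_split[of y]) (rule sum_product)
  then have "rpi n (x * y) = (\<Sum>l\<in>Poly_Mapping.keys x. rpi n (Poly_Mapping.single l (Poly_Mapping.lookup x l)))
      * (\<Sum>l'\<in>Poly_Mapping.keys y. rpi n (Poly_Mapping.single l' (Poly_Mapping.lookup y l')))"
    by (simp only: rpi_sum s sum_product)
  also have "\<dots> = rpi n x * rpi n y"
    by (simp only: rpi_sum[symmetric] pm_single_split[symmetric])
  finally show ?thesis .
qed

section \<open>The quotient as a vector space over the rational functions\<close>

locale RYquot =
  fixes d n :: nat and ty :: "'k::field_char_0 itself"
  assumes n1: "1 \<le> n" and d1: "1 \<le> d"
begin

abbreviation I :: "'k free set" where "I \<equiv> RY_ideal d n"

abbreviation cls :: "'k free \<Rightarrow> 'k free set" where "cls \<equiv> RY_class d n"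

lemma I_ideal: "ideal I (free_alg n)"
  unfolding RY_ideal_def
  by (rule ring.genideal_ideal[OF free_alg_ring]) (use relators_carr[OF n1] in auto)

lemma I_0: "0 \<in> I"
  using additive_subgroup.zero_closed[OF ideal.axioms(1)[OF I_ideal]] by simp
lemma I_add: "x \<in> I \<Longrightarrow> y \<in> I \<Longrightarrow> x + y \<in> I"
  using additive_subgroup.a_closed[OF ideal.axioms(1)[OF I_ideal]] by simp
lemma I_left: "x \<in> I \<Longrightarrow> a \<in> carr n \<Longrightarrow> a * x \<in> I"
  using ideal.I_l_closed[OF I_ideal] by simp
lemma I_right: "x \<in> I \<Longrightarrow> a \<in> carr n \<Longrightarrow> x * a \<in> I"
  using ideal.I_r_closed[OF I_ideal] by simp
lemma I_minus: "x \<in> I \<Longrightarrow> - x \<in> I"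
proof -
  assume "x \<in> I"
  moreover have "- 1 \<in> (carr n :: 'k free set)" by (rule carr_minus[OF carr_1])
  ultimately show ?thesis using I_left[of x "-1"] by simp
qed
lemma I_diff: "x \<in> I \<Longrightarrow> y \<in> I \<Longrightarrow> x - y \<in> I"
  using I_add[of x "- y"] I_minus[of y] by simp
lemma I_rel: "relators d n \<subseteq> I"
  unfolding RY_ideal_def by (rule ring.genideal_self[OF free_alg_ring]) (use relators_carr[OF n1] in auto)

text \<open>The elements of \<open>carr n\<close> with property \<open>P\<close> form an ideal
  containing the relators, and the generated ideal is the smallest such ideal.\<close>

lemma I_min:
  assumes "\<And>x. x \<in> relators d n \<Longrightarrow> P x" "P 0" "\<And>x y. P x \<Longrightarrow> P y \<Longrightarrow> P (x + y)"
    "\<And>x a. P x \<Longrightarrow> x \<in> carr n \<Longrightarrow> a \<in> carr n \<Longrightarrow> P (a * x) \<and> P (x * a)" "\<And>x. P x \<Longrightarrow> P (- x)" "x \<in> I"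
  shows "P x"
proof -
  interpret F: ring "free_alg n :: 'k free ring" by (rule free_alg_ring)
  let ?K = "{x \<in> carr n. P x}"
  have inv: "\<ominus>\<^bsub>free_alg n\<^esub> x = - x" if "x \<in> carr n" for x :: "'k free"
    by (rule F.minus_equality) (use that carr_minus in auto)
  have "ideal ?K (free_alg n)"
  proof (rule idealI[OF free_alg_ring])
    show "subgroup ?K (add_monoid (free_alg n))"
    proof (rule F.add.subgroupI)
      show "?K \<noteq> {}" using assms(2) carr_0 by blast
      fix a assume "a \<in> ?K"
      then show "\<ominus>\<^bsub>free_alg n\<^esub> a \<in> ?K" using assms(5) carr_minus[of a] inv by auto
    qed (use assms(3) carr_add in auto)
  qed (use assms(4) carr_mult in auto)
  then have "I \<subseteq> ?K"
    unfolding RY_ideal_def by (rule F.genideal_minimal) (use assms(1) relators_carr[OF n1] in auto)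
  then show ?thesis using assms(6) by blast
qed

lemma cls_eq: "x \<in> carr n \<Longrightarrow> y \<in> carr n \<Longrightarrow> cls x = cls y \<longleftrightarrow> x - y \<in> I"
proof -
  assume xy: "x \<in> carr n" "y \<in> carr n"
  have c: "z \<in> cls v \<longleftrightarrow> z - v \<in> I" for z v
  proof
    assume "z \<in> cls v"
    then obtain h where "h \<in> I" "z = h + v"
      unfolding RY_class_def a_r_coset_def r_coset_def by auto
    then show "z - v \<in> I" by (simp only: add_diff_cancel)
  next
    assume "z - v \<in> I"
    moreover have "z = (z - v) + v" by simp
    ultimately show "z \<in> cls v"
      unfolding RY_class_def a_r_coset_def r_coset_def by (simp only: monoid.simps free_alg_simps ring.simps UN_iff singleton_iff) blast
  qed
  show ?thesis
  proof
    assume e: "cls x = cls y"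
    have "x \<in> cls x" unfolding c by (simp only: diff_self I_0)
    then show "x - y \<in> I" unfolding e c .
  next
    assume h: "x - y \<in> I"
    show "cls x = cls y"
    proof (rule Set.set_eqI)
      fix z
      show "z \<in> cls x \<longleftrightarrow> z \<in> cls y" unfolding c
      proof
        assume "z - x \<in> I"
        from I_add[OF this h] show "z - y \<in> I" by (simp only: diff_add_cancel add_diff_eq)
      next
        assume "z - y \<in> I"
        from I_diff[OF this h] show "z - x \<in> I" by simp
      qed
    qed
  qed
qed

abbreviation A :: "('k ratfun, 'k free set) module" where "A \<equiv> RY d n"

lemma A_carrier: "carrier A = cls ` carr n"
  by (auto simp: RY_def Let_def FactRing_def A_RCOSETS_defs RY_class_def a_r_coset_def)

lemma A_mem: "x \<in> carr n \<Longrightarrow> cls x \<in> carrier A"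
  by (simp add: A_carrier)

lemma A_zero: "ring.zero A = cls 0"
proof -
  have "cls 0 = I" unfolding RY_class_def a_r_coset_def r_coset_def by auto
  then show ?thesis by (simp add: RY_def Let_def FactRing_def)
qed
lemma A_one: "monoid.one A = cls 1"
  by (simp add: RY_def Let_def FactRing_def RY_class_def)
lemma A_add: "x \<in> carr n \<Longrightarrow> y \<in> carr n \<Longrightarrow> cls x \<oplus>\<^bsub>A\<^esub> cls y = cls (x + y)"
proof -
  assume xy: "x \<in> carr n" "y \<in> carr n"
  have "abelian_group (free_alg n :: 'k free ring)" by (rule ring.is_abelian_group[OF free_alg_ring])
  from abelian_subgroup.a_rcos_sum[OF abelian_subgroupI3[OF ideal.axioms(1)[OF I_ideal] this], of x y]
  show ?thesis using xy by (simp add: RY_def Let_def FactRing_def RY_class_def)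
qed
lemma A_mult: "x \<in> carr n \<Longrightarrow> y \<in> carr n \<Longrightarrow> cls x \<otimes>\<^bsub>A\<^esub> cls y = cls (x * y)"
  using ideal.rcoset_mult_add[OF I_ideal, of x y] by (simp add: RY_def Let_def FactRing_def RY_class_def)
lemma A_smult: "x \<in> carr n \<Longrightarrow> c \<odot>\<^bsub>A\<^esub> cls x = cls (scal c * x)"
  using ideal.rcoset_mult_add[OF I_ideal, of "scal c" x] carr_scal[of c n] by (simp add: RY_def Let_def FactRing_def RY_class_def)

lemma A_abelian: "abelian_group A"
proof (rule abelian_groupI)
  fix P Q assume "P \<in> carrier A" "Q \<in> carrier A"
  then obtain x y where "x \<in> carr n" "P = cls x" "y \<in> carr n" "Q = cls y" unfolding A_carrier by blast
  then show "P \<oplus>\<^bsub>A\<^esub> Q \<in> carrier A" using A_mem[OF carr_add[of x n y]] by (simp add: A_add)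
next
  show "\<zero>\<^bsub>A\<^esub> \<in> carrier A" unfolding A_zero by (rule A_mem[OF carr_0])
next
  fix P Q R assume "P \<in> carrier A" "Q \<in> carrier A" "R \<in> carrier A"
  then show "P \<oplus>\<^bsub>A\<^esub> Q \<oplus>\<^bsub>A\<^esub> R = P \<oplus>\<^bsub>A\<^esub> (Q \<oplus>\<^bsub>A\<^esub> R)"
    unfolding A_carrier by (auto simp: A_add carr_add add.assoc)
next
  fix P Q assume "P \<in> carrier A" "Q \<in> carrier A"
  then show "P \<oplus>\<^bsub>A\<^esub> Q = Q \<oplus>\<^bsub>A\<^esub> P" unfolding A_carrier by (auto simp: A_add add.commute)
next
  fix P assume "P \<in> carrier A"
  then show "\<zero>\<^bsub>A\<^esub> \<oplus>\<^bsub>A\<^esub> P = P" unfolding A_carrier A_zero by (auto simp: A_add carr_0)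
next
  fix P assume "P \<in> carrier A"
  then obtain x where x: "x \<in> carr n" "P = cls x" unfolding A_carrier by blast
  then show "\<exists>Q\<in>carrier A. Q \<oplus>\<^bsub>A\<^esub> P = \<zero>\<^bsub>A\<^esub>"
    using A_mem[OF carr_minus[OF x(1)]] A_add[OF carr_minus[OF x(1)] x(1)] by (intro bexI[of _ "cls (- x)"]) (auto simp: A_zero)
qed

lemma A_module: "Module.module class_ring A"
proof (rule moduleI)
  show "cring (class_ring :: 'k ratfun ring)" by unfold_locales (auto simp: field_simps Units_def exI[of _ "- _"])
qed (auto simp: A_abelian A_carrier A_smult A_add carr_mult carr_scal carr_add scal_add scal_mult scal_1
      distrib_left distrib_right mult.assoc)

lemma A_vs: "vectorspace class_ring A"
  by (intro vectorspace.intro A_module class_field.field_axioms)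

lemma lincomb_cls:
  assumes "finite S" "\<And>v. v \<in> S \<Longrightarrow> R v \<in> carr n \<and> cls (R v) = v"
  shows "LinearCombinations.module.lincomb A a S = cls (\<Sum>v\<in>S. scal (a v) * R v)"
proof -
  interpret V: vectorspace class_ring A by (rule A_vs)
  show ?thesis using assms
  proof (induction S rule: finite_induct)
    case empty
    then show ?case by (simp add: V.lincomb_def A_zero)
  next
    case (insert v S)
    have vS: "v \<in> carrier A" "S \<subseteq> carrier A" using insert.prems A_mem by (metis insertI1, metis insertI2 subsetI)
    have "V.lincomb a (insert v S) = a v \<odot>\<^bsub>A\<^esub> v \<oplus>\<^bsub>A\<^esub> V.lincomb a S"
      unfolding V.lincomb_def using insert.hyps vS
      by (intro V.M.finsum_insert) (auto intro!: V.smult_closed)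
    also have "\<dots> = cls (scal (a v) * R v) \<oplus>\<^bsub>A\<^esub> cls (\<Sum>v\<in>S. scal (a v) * R v)"
      using insert.IH insert.prems A_smult[of "R v" "a v"] by auto
    also have "\<dots> = cls (\<Sum>v\<in>insert v S. scal (a v) * R v)"
      using insert by (subst A_add) (auto intro!: carr_mult carr_scal carr_sum)
    finally show ?case .
  qed
qed

text \<open>The preimage of the relation ideal under the projection; it provides the instance of the
  rewriting locale.\<close>

definition J :: "'k free set" where "J = {x. rpi n x \<in> I}"

sublocale RYmod d n J
proof
  show "0 \<in> J" by (simp add: J_def rpi_0 I_0)
  show "x + y \<in> J" if "x \<in> J" "y \<in> J" for x y using that by (simp add: J_def rpi_add I_add)
  show "a * x \<in> J" "x * a \<in> J" if "x \<in> J" for x a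
    using that unfolding J_def mem_Collect_eq rpi_mult by (auto intro: I_left I_right rpi_carr)
  show "x \<in> J" if "x \<in> relators d n" for x
    using I_rel that rpi_id[OF relators_carr[OF n1 that]] by (auto simp: J_def)
  show "wd [g] \<in> J" if "g \<notin> gens n" for g
    using that by (simp add: J_def wd_def rpi_single I_0)
qed (use n1 d1 in auto)

text \<open>Passing through \<open>rpi\<close> places the representatives in \<open>carr n\<close>
  and fits the form \<open>cls (rpi n x)\<close> in which spanning modulo \<open>J\<close> is
  transported to the quotient.\<close>

definition gset :: "'k free set set" where "gset = (\<lambda>\<alpha>. cls (rpi n (GX n \<alpha>))) ` Gidx d n"

lemma gset_carrier: "gset \<subseteq> carrier A"
  unfolding gset_def using A_mem[OF rpi_carr] by blast

lemma gset_spans: "LinearCombinations.module.span class_ring A gset = carrier A"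
proof -
  interpret V: vectorspace class_ring A by (rule A_vs)
  have sub: "LinearCombinations.submodule class_ring (V.span gset) A" by (rule V.span_is_submodule[OF gset_carrier])
  have own: "gset \<subseteq> V.span gset" by (rule V.in_own_span[OF gset_carrier])
  have "cls (rpi n x) \<in> V.span gset" for x
    using spanning[of x]
  proof (induction rule: spn.induct)
    case (spn_base x)
    then show ?case using own unfolding gset_def by blast
  next
    case (spn_J x)
    then have "cls (rpi n x) = cls 0" using cls_eq[OF rpi_carr carr_0] by (simp add: J_def)
    then have "cls (rpi n x) = \<zero>\<^bsub>A\<^esub>" by (simp add: A_zero)
    then show ?case using sub by (simp add: submodule_def)
  next
    case (spn_add x y)
    then have "cls (rpi n x) \<oplus>\<^bsub>A\<^esub> cls (rpi n y) \<in> V.span gset" using sub by (simp add: submodule_def)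
    then show ?case by (simp add: A_add rpi_carr rpi_add)
  next
    case (spn_scal x c)
    then have "c \<odot>\<^bsub>A\<^esub> cls (rpi n x) \<in> V.span gset" using sub by (simp add: submodule_def)
    moreover have "rpi n (scal c) = (scal c :: 'k free)" by (rule rpi_id[OF carr_scal])
    ultimately show ?case by (simp add: A_smult rpi_carr rpi_mult)
  qed
  then have "carrier A \<subseteq> V.span gset" unfolding A_carrier using rpi_id by (metis image_subsetI)
  moreover have "V.span gset \<subseteq> carrier A" using V.span_is_subset2[OF gset_carrier] .
  ultimately show ?thesis by blast
qed

lemma CX_carr: "\<alpha> \<in> Cidx d n \<Longrightarrow> CX n \<alpha> \<in> carr n"
  by (cases \<alpha>) (auto simp: Cidx_def CX_def intro!: carr_Cel)

lemma T_perm_0: "T_perm 0 id = 1"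
proof -
  have "(SOME js. reduced_word 0 id js) = []"
    using reduced_wordD(1)[of id 0] permutes_id by auto
  then show ?thesis by (simp add: T_perm_def)
qed

lemma C_set_eq: "C_set d n = (\<lambda>\<alpha>. cls (CX n \<alpha>)) ` Cidx d n"
proof -
  have "C_level d n r = {cls (Cel n r B B' m p) |B B' m p. B \<in> subs n r \<and> B' \<in> subs n r \<and>
     m \<in> {1..r} \<rightarrow>\<^sub>E {0..<d} \<and> p permutes {1..r}}" (is "_ = ?R r") for r
  proof (cases "r = 0")
    \<comment> \<open>For \<open>r = 0\<close> the general expression has a single index, and all
      its factors except \<open>N^n\<close> are empty products.\<close>
    case True
    have s0: "subs n 0 = {{}}" using finite_subset[of _ "{1..n}"] by (auto simp: subs_def)
    have p0: "p permutes {1..0::nat} \<longleftrightarrow> p = id" for p by simp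
    have "(Cel n 0 {} {} m id :: 'k free) = gN ^ n" for m
      by (simp add: Cel_def T_set_def F_mono_def T_perm_0 T_set_bar_def)
    moreover have "(\<lambda>_. undefined) \<in> {1..0::nat} \<rightarrow>\<^sub>E {0..<d}" by simp
    ultimately have "?R 0 = {cls (gN ^ n)}" unfolding s0 p0 by auto
    then show ?thesis using True by (simp add: C_level_def)
  next
    case False
    then show ?thesis by (auto simp: C_level_def Cel_def subs_def)
  qed
  then have "C_set d n = (\<Union>r\<in>{0..n}. ?R r)" by (simp add: C_set_def)
  also have "\<dots> = (\<lambda>\<alpha>. cls (CX n \<alpha>)) ` Cidx d n"
  proof (intro equalityI subsetI)
    fix v assume "v \<in> (\<Union>r\<in>{0..n}. ?R r)"
    then obtain r B B' m p where v: "v = cls (Cel n r B B' m p)" and "r \<in> {0..n}" "B \<in> subs n r" "B' \<in> subs n r"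
      "m \<in> {1..r} \<rightarrow>\<^sub>E {0..<d}" "p permutes {1..r}" by blast
    then have "(r, B, B', m, p) \<in> Cidx d n" unfolding Cidx_def by blast
    then show "v \<in> (\<lambda>\<alpha>. cls (CX n \<alpha>)) ` Cidx d n"
      by (rule image_eqI[rotated]) (simp add: v CX_def)
  next
    fix v assume "v \<in> (\<lambda>\<alpha>. cls (CX n \<alpha>)) ` Cidx d n"
    then obtain r B B' m p where v: "v = cls (CX n (r, B, B', m, p))" and "(r, B, B', m, p) \<in> Cidx d n" by force
    then have *: "r \<in> {0..n}" "B \<in> subs n r" "B' \<in> subs n r" "m \<in> {1..r} \<rightarrow>\<^sub>E {0..<d}" "p permutes {1..r}"
      unfolding Cidx_def by auto
    have "v \<in> ?R r" unfolding v CX_def using *(2-5) by auto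
    then show "v \<in> (\<Union>r\<in>{0..n}. ?R r)" using *(1) by blast
  qed
  finally show ?thesis .
qed

end

section \<open>The relation ideal acts as zero\<close>

context tmodel
begin

sublocale Q: RYquot d n "TYPE('k)" by unfold_locales (use n1 d1 in auto)

lemma I_act:
  assumes "x \<in> RY_ideal d n" "w \<in> words d n" shows "act x f w = 0"
proof -
  have "\<forall>f. \<forall>w\<in>words d n. act x f w = 0"
  proof (rule Q.I_min[OF _ _ _ _ _ assms(1)])
    fix x :: "'k free" assume "x \<in> relators d n"
    then show "\<forall>f. \<forall>w\<in>words d n. act x f w = 0" using relators_act by blast
  next
    fix x a :: "'k free" assume h: "\<forall>f. \<forall>w\<in>words d n. act x f w = 0" "x \<in> carr n" "a \<in> carr n"
    have "act (a * x) f w = 0" if "w \<in> words d n" for f w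
      by (rule act_zero_mult[OF h(3) _ that]) (use h(1) in blast)
    moreover have "act (x * a) f w = 0" if "w \<in> words d n" for f w
      using h(1) that by (simp add: act_mult)
    ultimately show "(\<forall>f. \<forall>w\<in>words d n. act (a * x) f w = 0) \<and> (\<forall>f. \<forall>w\<in>words d n. act (x * a) f w = 0)" by blast
  qed (simp_all add: act_0 act_add act_minus)
  then show ?thesis using assms(2) by blast
qed

lemma combination_zero:
  assumes "\<And>f w. w \<in> words d n \<Longrightarrow> act (\<Sum>\<alpha>\<in>Cidx d n. scal (c \<alpha>) * CX n \<alpha>) f w = 0" "\<alpha> \<in> Cidx d n"
  shows "c \<alpha> = 0"
proof -
  have "j (c \<alpha>) = 0"
    by (rule Cel_independent[of "\<lambda>\<alpha>. j (c \<alpha>)", OF _ assms(2)]) (use assms(1) in \<open>simp add: act_sum act_scal_mult\<close>)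
  then show ?thesis by (simp add: j_eq_0)
qed

end

section \<open>Linear independence and dimension\<close>

lemma of_nat_ratfun: "of_nat k = (Fract (of_nat k) 1 :: 'k::field_char_0 ratfun)"
  by (induction k) (simp_all add: Zero_fract_def One_fract_def eq_fract add_fract add.commute)

lemma of_nat_ratfun_nz: "k \<noteq> 0 \<Longrightarrow> of_nat k \<noteq> (0 :: 'k::field_char_0 ratfun)"
  by (simp add: of_nat_ratfun Zero_fract_def eq_fract)

text \<open>\<open>X^d - 1\<close> splits into linear factors, and a multiple root would also be a
  root of the derivative \<open>d X^(d-1)\<close>, that is, 0.\<close>

lemma card_roots_of_unity:
  assumes d: "1 \<le> d" and dn: "of_nat d \<noteq> (0 :: 'f::alg_closed_field)"
  shows "card {z :: 'f. z ^ d = 1} = d"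
proof -
  let ?p = "Polynomial.monom 1 d + [:-1:] :: 'f poly"
  have deg: "Polynomial.degree ?p = d"
    using d by (subst Polynomial.degree_add_eq_left) (simp_all add: Polynomial.degree_monom_eq)
  have lc: "Polynomial.coeff ?p (Polynomial.degree ?p) = 1" unfolding deg using d by (cases d) simp_all
  have nz: "?p \<noteq> 0" using deg d by auto
  obtain M where M: "size M = Polynomial.degree ?p" "?p = Polynomial.smult (Polynomial.coeff ?p (Polynomial.degree ?p)) (\<Prod>x\<in>#M. [:-x, 1:])"
    using alg_closed_imp_factorization[OF nz] by blast
  have M2: "?p = (\<Prod>x\<in>#M. [:-x, 1:])" using M(2) unfolding lc smult_1_left .
  have root: "poly ?p z = z ^ d - 1" for z by (simp add: poly_monom)
  have cnt1: "count M z \<le> 1" for z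
  proof (rule ccontr)
    assume "\<not> count M z \<le> 1"
    then have "{#z, z#} \<subseteq># M" by (simp add: mset_subset_eqI subseteq_mset_def)
    then obtain N where "M = {#z, z#} + N" by (metis subset_mset.le_iff_add)
    then have fac: "?p = [:-z, 1:] * ([:-z, 1:] * (\<Prod>x\<in>#N. [:-x, 1:]))" using M(2) lc by simp
    have "poly ?p z = 0" by (subst fac) simp
    then have zd: "z ^ d = 1" using root by simp
    have "poly (pderiv ?p) z = 0"
    proof -
      have Lz: "poly [:-z, 1:] z = 0" by simp
      show ?thesis by (subst fac) (simp only: pderiv_mult poly_add poly_mult Lz mult_zero_left mult_zero_right add_0)
    qed
    moreover have "poly (pderiv ?p) z = of_nat d * z ^ (d - 1)" by (simp add: pderiv_add pderiv_monom poly_monom pderiv_pCons)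
    ultimately have "z = 0" using dn by simp
    then show False using zd d by (simp add: power_0_left)
  qed
  have "set_mset M = {z. z ^ d = 1}"
  proof -
    have "poly ?p z = 0 \<longleftrightarrow> z \<in># M" for z
      unfolding M2 by (auto simp: poly_prod_mset prod_mset_zero_iff)
    then show ?thesis using root by auto
  qed
  moreover have "card (set_mset M) = size M"
    using cnt1 by (metis (no_types, lifting) card_eq_sum count_greater_eq_one_iff le_antisym size_multiset_overloaded_eq sum.cong)
  ultimately show ?thesis using M(1) deg by simp
qed

lemma ex_tmodel:
  assumes n: "1 \<le> n" and d: "1 \<le> d"
  obtains q :: "('k::field_char_0 ratfun) alg_closure" and \<chi> where "tmodel n d q \<chi> (to_ac :: 'k ratfun \<Rightarrow> _)"
proof -
  have dn: "of_nat d \<noteq> (0 :: 'k ratfun alg_closure)"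
    using of_nat_ratfun_nz[of d, where 'k = 'k] d by (simp add: to_ac_of_nat[symmetric] del: to_ac_of_nat)
  obtain q :: "'k ratfun alg_closure" where q: "q ^ 2 = to_ac uvar"
    using nth_root_exists[of 2 "to_ac uvar :: 'k ratfun alg_closure"] by auto
  let ?Z = "{z :: 'k ratfun alg_closure. z ^ d = 1}"
  have card: "card ?Z = d" by (rule card_roots_of_unity[OF d dn])
  then have fin: "finite ?Z" using d by (intro card_ge_0_finite) simp
  obtain h where h: "bij_betw h {1..d} ?Z"
    using finite_same_card_bij[of "{1..d}" ?Z] fin card by auto
  have "1 \<in> ?Z" by simp
  then obtain a where a: "a \<in> {1..d}" "h a = 1" using h by (metis (no_types, lifting) bij_betw_iff_bijections)
  \<comment> \<open>The enumeration is rearranged so that the root 1 receives the colour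
    \<open>d\<close> of \<open>V0\<close>.\<close>
  define \<chi> where "\<chi> = h \<circ> tp a d"
  have tp: "bij_betw (tp a d) {1..d} {1..d}"
    using permutes_imp_bij[OF permutes_swap_id[of a "{1..d}" d]] a d by auto
  have b: "bij_betw \<chi> {1..d} ?Z" unfolding \<chi>_def by (rule bij_betw_trans[OF tp h])
  have "tmodel n d q \<chi> (to_ac :: 'k ratfun \<Rightarrow> _)"
  proof
    show "q \<noteq> 0"
    proof
      assume "q = 0"
      then have "to_ac (uvar :: 'k ratfun) = 0" using q by simp
      then show False by (simp add: uvar_def Zero_fract_def eq_fract)
    qed
    show "\<chi> s ^ d = 1" if "s \<in> {1..d}" for s using b that by (auto simp: bij_betw_def)
    show "inj_on \<chi> {1..d}" using b by (simp add: bij_betw_def)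
    show "\<chi> d = 1" using a by (simp add: \<chi>_def)
  qed (use n d dn q in auto)
  then show ?thesis by (rule that)
qed

context RYquot
begin

lemma C_independent:
  assumes "(\<Sum>\<alpha>\<in>Cidx d n. scal (c \<alpha>) * CX n \<alpha>) \<in> I" "\<alpha> \<in> Cidx d n"
  shows "c \<alpha> = 0"
proof -
  obtain q :: "('k ratfun) alg_closure" and \<chi> where "tmodel n d q \<chi> (to_ac :: 'k ratfun \<Rightarrow> _)"
    using ex_tmodel[OF n1 d1] by blast
  then interpret tm: tmodel n d q \<chi> "to_ac :: 'k ratfun \<Rightarrow> _" .
  show ?thesis by (rule tm.combination_zero[OF tm.I_act[OF assms(1)] assms(2)])
qed

text \<open>Two indices with the same class would give a vanishing combination with coefficients 1
  and -1.\<close>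

lemma cls_CX_inj: "inj_on (\<lambda>\<alpha>. cls (CX n \<alpha>)) (Cidx d n)"
proof (rule inj_onI, rule ccontr)
  fix \<alpha> \<beta> assume ab: "\<alpha> \<in> Cidx d n" "\<beta> \<in> Cidx d n" "cls (CX n \<alpha>) = cls (CX n \<beta>)" "\<alpha> \<noteq> \<beta>"
  then have "CX n \<alpha> - CX n \<beta> \<in> I" using cls_eq CX_carr by blast
  define c :: "_ \<Rightarrow> 'k ratfun" where "c \<gamma> = (if \<gamma> = \<alpha> then 1 else if \<gamma> = \<beta> then - 1 else 0)" for \<gamma>
  have "(\<Sum>\<gamma>\<in>Cidx d n. scal (c \<gamma>) * CX n \<gamma>) = (\<Sum>\<gamma>\<in>{\<alpha>, \<beta>}. scal (c \<gamma>) * (CX n \<gamma> :: 'k free))"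
    using ab by (intro sum.mono_neutral_right finite_Cidx) (auto simp: c_def scal_0)
  also have "\<dots> = CX n \<alpha> - CX n \<beta>"
    using ab(4) scal_1[where 'a = "'k ratfun" and 'x = gen] by (simp add: c_def scal_def single_uminus)
  finally have "(\<Sum>\<gamma>\<in>Cidx d n. scal (c \<gamma>) * CX n \<gamma>) \<in> I" using \<open>CX n \<alpha> - CX n \<beta> \<in> I\<close> by simp
  then have "c \<alpha> = 0" using C_independent ab(1) by blast
  then show False by (simp add: c_def)
qed

lemma card_C_set: "card (C_set d n :: 'k free set set) = (\<Sum>r=0..n. d ^ r * (n choose r)\<^sup>2 * fact r)"
  unfolding C_set_eq card_image[OF cls_CX_inj] by (rule card_Cidx)

lemma finite_C_set: "finite (C_set d n :: 'k free set set)"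
  unfolding C_set_eq using finite_Cidx by blast

lemma C_set_carrier: "C_set d n \<subseteq> carrier A"
  unfolding C_set_eq using A_mem CX_carr by blast

definition \<iota> where "\<iota> = the_inv_into (Cidx d n) (\<lambda>\<alpha>. cls (CX n \<alpha>))"

lemma \<iota>: "v \<in> C_set d n \<Longrightarrow> \<iota> v \<in> Cidx d n \<and> cls (CX n (\<iota> v)) = v"
proof
  assume "v \<in> C_set d n"
  then have v: "v \<in> (\<lambda>\<alpha>. cls (CX n \<alpha>)) ` Cidx d n" unfolding C_set_eq .
  show "\<iota> v \<in> Cidx d n" unfolding \<iota>_def by (rule the_inv_into_into[OF cls_CX_inj v subset_refl])
  show "cls (CX n (\<iota> v)) = v" unfolding \<iota>_def by (rule f_the_inv_into_f[OF cls_CX_inj v])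
qed

text \<open>A combination over some of the classes becomes one over the whole index set, with
  coefficient 0 at the missing classes, which is the form in which independence is
  available.\<close>

lemma lincomb_C:
  assumes S: "finite S" "S \<subseteq> C_set d n"
  obtains c where "LinearCombinations.module.lincomb A a S = cls (\<Sum>\<alpha>\<in>Cidx d n. scal (c \<alpha>) * CX n \<alpha>)"
    "\<And>v. v \<in> S \<Longrightarrow> a v = c (\<iota> v)"
proof
  define c where "c \<alpha> = (if cls (CX n \<alpha>) \<in> S then a (cls (CX n \<alpha>)) else 0)" for \<alpha>
  show "a v = c (\<iota> v)" if "v \<in> S" for v using \<iota>[of v] S(2) that by (auto simp: c_def)
  have "LinearCombinations.module.lincomb A a S = cls (\<Sum>v\<in>S. scal (a v) * CX n (\<iota> v))"
  proof (rule lincomb_cls[OF S(1)])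
    fix v assume "v \<in> S"
    then show "CX n (\<iota> v) \<in> carr n \<and> cls (CX n (\<iota> v)) = v" using \<iota>[of v] S(2) CX_carr[of "\<iota> v"] by blast
  qed
  also have "(\<Sum>v\<in>S. scal (a v) * CX n (\<iota> v)) = (\<Sum>\<alpha>\<in>\<iota> ` S. scal (c \<alpha>) * (CX n \<alpha> :: 'k free))"
  proof -
    have "inj_on \<iota> S" by (rule inj_on_inverseI[of _ "\<lambda>\<alpha>. cls (CX n \<alpha>)"]) (use \<iota> S(2) in auto)
    then show ?thesis
      using \<open>\<And>v. v \<in> S \<Longrightarrow> a v = c (\<iota> v)\<close> by (simp add: sum.reindex)
  qed
  also have "\<dots> = (\<Sum>\<alpha>\<in>Cidx d n. scal (c \<alpha>) * CX n \<alpha>)"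
  proof (rule sum.mono_neutral_left[OF finite_Cidx])
    show "\<iota> ` S \<subseteq> Cidx d n" using \<iota> S(2) by blast
    show "\<forall>\<alpha>\<in>Cidx d n - \<iota> ` S. scal (c \<alpha>) * (CX n \<alpha> :: 'k free) = 0"
    proof
      fix \<alpha> assume \<alpha>: "\<alpha> \<in> Cidx d n - \<iota> ` S"
      have "cls (CX n \<alpha>) \<notin> S"
      proof
        assume "cls (CX n \<alpha>) \<in> S"
        moreover have "\<iota> (cls (CX n \<alpha>)) = \<alpha>" unfolding \<iota>_def using \<alpha> by (intro the_inv_into_f_f[OF cls_CX_inj]) simp
        ultimately show False using \<alpha> by (metis DiffD2 imageI)
      qed
      then show "scal (c \<alpha>) * (CX n \<alpha> :: 'k free) = 0" by (simp add: c_def scal_0)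
    qed
  qed
  finally show "LinearCombinations.module.lincomb A a S = cls (\<Sum>\<alpha>\<in>Cidx d n. scal (c \<alpha>) * CX n \<alpha>)" .
qed

lemma comb_carr: "(\<Sum>\<alpha>\<in>Cidx d n. scal (c \<alpha>) * CX n \<alpha>) \<in> carr n"
  by (intro carr_sum carr_mult carr_scal CX_carr)

lemma C_set_indep: "\<not> LinearCombinations.module.lin_dep class_ring A (C_set d n)"
proof -
  interpret V: vectorspace class_ring A by (rule A_vs)
  show ?thesis
  proof
    assume "V.lin_dep (C_set d n)"
    then obtain S a v where S: "finite S" "S \<subseteq> C_set d n" "V.lincomb a S = \<zero>\<^bsub>A\<^esub>" "v \<in> S" "a v \<noteq> \<zero>\<^bsub>class_ring\<^esub>"
      unfolding V.lin_dep_def by blast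
    obtain c where c: "V.lincomb a S = cls (\<Sum>\<alpha>\<in>Cidx d n. scal (c \<alpha>) * CX n \<alpha>)" "\<And>v. v \<in> S \<Longrightarrow> a v = c (\<iota> v)"
      by (rule lincomb_C[OF S(1,2), where a = a]) blast
    have "(\<Sum>\<alpha>\<in>Cidx d n. scal (c \<alpha>) * CX n \<alpha>) \<in> I"
      using S(3) cls_eq[OF comb_carr carr_0] unfolding c(1) A_zero by simp
    moreover have "\<iota> v \<in> Cidx d n" using \<iota>[of v] S(2,4) by blast
    ultimately have "c (\<iota> v) = 0" by (rule C_independent)
    then show False using c(2)[OF S(4)] S(5) by simp
  qed
qed

text \<open>The generating set bounds the dimension from above even if some of its indices share a
  class, the independent set bounds it from below. Since the two bounds agree, \<open>C_set\<close>
  is also a basis.\<close>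

lemma dimension:
  "vectorspace.fin_dim class_ring A" "vectorspace.dim class_ring A = card (C_set d n :: 'k free set set)"
  "LinearCombinations.module.span class_ring A (C_set d n) = carrier A"
proof -
  interpret V: vectorspace class_ring A by (rule A_vs)
  have fg: "finite gset" unfolding gset_def using finite_Gidx by blast
  show fd: "V.fin_dim" unfolding V.fin_dim_def using fg gset_carrier gset_spans by blast
  have "V.dim \<le> card gset" by (rule V.gen_ge_dim[OF fg gset_carrier gset_spans])
  also have "\<dots> \<le> card (Gidx d n)" unfolding gset_def by (rule card_image_le[OF finite_Gidx])
  also have "\<dots> = card (C_set d n :: 'k free set set)" unfolding card_Gidx card_C_set ..
  finally have le: "V.dim \<le> card (C_set d n :: 'k free set set)" .
  moreover have "card (C_set d n :: 'k free set set) \<le> V.dim"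
    by (rule V.li_le_dim(2)[OF fd C_set_carrier C_set_indep])
  ultimately show "V.dim = card (C_set d n :: 'k free set set)" by simp
  have "V.basis (C_set d n)" by (rule V.dim_li_is_basis[OF fd finite_C_set C_set_carrier C_set_indep le])
  then show "V.span (C_set d n) = carrier A" by (simp add: V.basis_def)
qed

lemma C_spans:
  assumes "x \<in> carr n"
  obtains c where "x - (\<Sum>\<alpha>\<in>Cidx d n. scal (c \<alpha>) * CX n \<alpha>) \<in> I"
proof -
  interpret V: vectorspace class_ring A by (rule A_vs)
  have "cls x \<in> V.span (C_set d n)" unfolding dimension(3) by (rule A_mem[OF assms])
  then obtain a S where S: "finite S" "S \<subseteq> C_set d n" "cls x = V.lincomb a S" unfolding V.span_def by blast
  obtain c where "V.lincomb a S = cls (\<Sum>\<alpha>\<in>Cidx d n. scal (c \<alpha>) * CX n \<alpha>)"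
    by (rule lincomb_C[OF S(1,2), where a = a]) blast
  then have "cls x = cls (\<Sum>\<alpha>\<in>Cidx d n. scal (c \<alpha>) * CX n \<alpha>)" using S(3) by simp
  then have "x - (\<Sum>\<alpha>\<in>Cidx d n. scal (c \<alpha>) * CX n \<alpha>) \<in> I"
    by (rule iffD1[OF cls_eq[OF assms comb_carr]])
  then show ?thesis by (rule that)
qed

end

section \<open>The tensor representation\<close>

lemma Fract_cases_ratfun: obtains p q where "q \<noteq> 0" "r = Fract p (q :: 'k::field_char_0 poly)"
  by (cases r) auto

lemma pcompose_sq_nz: "q \<noteq> 0 \<Longrightarrow> pcompose q [:0, 0, 1:] \<noteq> (0 :: 'k::field_char_0 poly)"
  by (simp add: pcompose_eq_0_iff)

lemma incl_add: "incl (x + y) = incl x + incl (y :: 'k::field_char_0 ratfun)"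
proof -
  obtain p q where x: "q \<noteq> 0" "x = Fract p q" by (rule Fract_cases_ratfun)
  obtain r s where y: "s \<noteq> 0" "y = Fract r s" by (rule Fract_cases_ratfun)
  show ?thesis using x y pcompose_sq_nz[OF x(1)] pcompose_sq_nz[OF y(1)]
    by (simp add: incl_Fract pcompose_add pcompose_mult)
qed

lemma incl_mult: "incl (x * y) = incl x * incl (y :: 'k::field_char_0 ratfun)"
proof -
  obtain p q where x: "q \<noteq> 0" "x = Fract p q" by (rule Fract_cases_ratfun)
  obtain r s where y: "s \<noteq> 0" "y = Fract r s" by (rule Fract_cases_ratfun)
  show ?thesis using x y by (simp add: incl_Fract pcompose_mult)
qed

lemma incl_1: "incl 1 = (1 :: 'k::field_char_0 ratfun)"
  unfolding One_fract_def by (simp add: incl_Fract pcompose_1)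

abbreviation cst :: "'k::field_char_0 \<Rightarrow> 'k ratfun" where "cst c \<equiv> Fract [:c:] 1"

lemma cst_mult: "cst (a * b) = cst a * cst b" by (simp add: mult.commute)
lemma cst_1: "cst 1 = 1" by (simp add: One_fract_def one_pCons)
lemma cst_pow: "cst (a ^ k) = cst a ^ k"
proof (induction k)
  case 0
  show ?case by (simp add: cst_1)
next
  case (Suc k)
  show ?case by (simp only: power_Suc cst_mult Suc.IH)
qed
lemma cst_eq: "cst a = cst b \<longleftrightarrow> a = b" by (simp add: eq_fract)
lemma cst_minus: "cst (- a) = - cst a" by simp

text \<open>For \<open>d = 2 m\<close> the exponent is \<open>m (d - 1)\<close> and
  \<open>\<xi>^m\<close> is the square root of 1 other than 1. For odd \<open>d\<close> the exponent
  is a multiple of \<open>d\<close>.\<close>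

lemma primitive_root_half:
  assumes "primitive_root d \<xi>" "d \<ge> 1"
  shows "\<xi> ^ ((d\<^sup>2 - d) div 2) = (- 1 :: 'k::field_char_0) ^ (d - 1)"
proof (cases "even d")
  case True
  then obtain m where m: "d = 2 * m" by blast
  have m1: "m \<in> {1..<d}" using m assms(2) by auto
  have "(\<xi> ^ m) ^ 2 = 1" using assms(1) m by (simp add: primitive_root_def power_mult[symmetric] mult.commute)
  moreover have "\<xi> ^ m \<noteq> 1" using assms(1) m1 unfolding primitive_root_def by blast
  ultimately have "\<xi> ^ m = - 1" by (simp add: power2_eq_1_iff)
  moreover have "(d\<^sup>2 - d) div 2 = m * (d - 1)" unfolding m by (simp add: power2_eq_square algebra_simps)
  ultimately show ?thesis by (simp add: power_mult)
next
  case False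
  then obtain m where m: "d = 2 * m + 1" by (metis oddE)
  have "d\<^sup>2 - d = 2 * (d * m)" unfolding m by (simp add: power2_eq_square algebra_simps)
  then have e: "(d\<^sup>2 - d) div 2 = d * m" by simp
  have x: "\<xi> ^ d = 1" using assms(1) by (simp add: primitive_root_def)
  have "(- 1 :: 'k) ^ (d - 1) = 1" unfolding m by simp
  then show ?thesis unfolding e power_mult x by simp
qed

locale tensor_model =
  fixes n d :: nat and \<xi> :: "'k::field_char_0"
  assumes n_pos: "1 \<le> n" and d_pos: "1 \<le> d" and prim: "primitive_root d \<xi>"
begin

definition \<chi> :: "nat \<Rightarrow> 'k ratfun" where "\<chi> s = cst (\<xi> ^ s)"

lemma xi_pow: "\<xi> ^ d = 1" using prim by (simp add: primitive_root_def)

lemma xi_nz: "\<xi> \<noteq> 0"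
  using xi_pow d_pos by (auto simp: power_0_left)

lemma sqrt_u_nz: "sqrt_u \<noteq> (0 :: 'k ratfun)"
  by (simp add: sqrt_u_def Zero_fract_def eq_fract)

sublocale tm: tmodel n d sqrt_u \<chi> "incl :: 'k ratfun \<Rightarrow> 'k ratfun"
proof
  show "1 \<le> n" by (rule n_pos)
  show "1 \<le> d" by (rule d_pos)
  show "of_nat d \<noteq> (0 :: 'k ratfun)" using d_pos by (intro of_nat_ratfun_nz) simp
  show "\<chi> s ^ d = 1" for s
  proof -
    have "\<chi> s ^ d = cst ((\<xi> ^ s) ^ d)" unfolding \<chi>_def by (rule cst_pow[symmetric])
    also have "(\<xi> ^ s) ^ d = 1" by (metis mult.commute power_mult power_one xi_pow)
    finally show ?thesis by (simp add: cst_1)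
  qed
  show "inj_on \<chi> {1..d}"
  proof (rule linorder_inj_onI)
    fix s t assume st: "s < t" "s \<in> {1..d}" "t \<in> {1..d}"
    show "\<chi> s \<noteq> \<chi> t"
    proof
      assume "\<chi> s = \<chi> t"
      then have "\<xi> ^ s = \<xi> ^ t" unfolding \<chi>_def cst_eq .
      also have "\<dots> = \<xi> ^ s * \<xi> ^ (t - s)" using st(1) by (simp add: power_add[symmetric])
      finally have "\<xi> ^ (t - s) = 1" using xi_nz by simp
      moreover have "t - s \<in> {1..<d}" using st by auto
      ultimately show False using prim unfolding primitive_root_def by blast
    qed
  qed auto
  show "\<chi> d = 1" by (simp add: \<chi>_def xi_pow cst_1)
qed (simp_all add: incl_add incl_mult incl_1 incl_uvar sqrt_u_nz)

lemma ep_eps: "tm.ep s = eps d s"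
proof -
  have "tm.ep s = cst ((\<xi> ^ s) ^ ((d\<^sup>2 - d) div 2))" unfolding tm.ep_def \<chi>_def by (rule cst_pow[symmetric])
  also have "(\<xi> ^ s) ^ ((d\<^sup>2 - d) div 2) = (\<xi> ^ ((d\<^sup>2 - d) div 2)) ^ s" by (metis mult.commute power_mult)
  also have "\<dots> = (- 1) ^ ((d - 1) * s)" unfolding primitive_root_half[OF prim d_pos] by (simp add: power_mult)
  also have "cst ((- 1) ^ ((d - 1) * s)) = eps d s" unfolding cst_pow eps_def cst_minus cst_1 ..
  finally show ?thesis .
qed

lemma eig: "F_eigenvalue \<xi> y = \<chi> (col d y)"
  by (cases y) (simp_all add: \<chi>_def xi_pow cst_1)

text \<open>The amending summand is exactly the diagonal coefficient of \<open>ca\<close> at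
  \<open>V0, V j d\<close>, where the colours agree and the indices 0 and \<open>j\<close>
  increase.\<close>

lemma T_amended_eq:
  assumes "x \<in> ubasis d n" "y \<in> ubasis d n"
  shows "T_amended d x y = Poly_Mapping.single [x, y] (tm.ca x y) + Poly_Mapping.single [y, x] (tm.cb x y)"
proof -
  have e: "eps d d = (1 :: 'k ratfun)" using tm.ep_d ep_eps[of d] by simp
  show ?thesis
    using assms unfolding ubasis_def
    by (cases x; cases y) (auto simp: T_amended_def tm.ca_def tm.cb_def ep_eps e incl_uvar single_add)
qed

section \<open>Tensors as functions on words\<close>

abbreviation TP :: "('k ratfun, 'k tensor) module" where "TP \<equiv> tensor_power d n"

abbreviation Lw :: "ubas list set" where "Lw \<equiv> {l. length l = n \<and> set l \<subseteq> ubasis d n}"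

text \<open>\<open>lw\<close> and \<open>wl\<close> translate between words as functions, used by
  the model, and words as lists, used by the tensor power; \<open>fn\<close> takes the coefficient
  function of a tensor.\<close>

definition lw :: "(nat \<Rightarrow> ubas) \<Rightarrow> ubas list" where "lw w = map w [1..<n+1]"

definition wl :: "ubas list \<Rightarrow> nat \<Rightarrow> ubas" where "wl l k = (if k \<in> {1..n} then l ! (k - 1) else V0)"

definition fn :: "'k tensor \<Rightarrow> (nat \<Rightarrow> ubas) \<Rightarrow> 'k ratfun" where "fn t w = Poly_Mapping.lookup t (lw w)"

lemma TP_carrier: "t \<in> carrier TP \<longleftrightarrow> Poly_Mapping.keys t \<subseteq> Lw"
  by (auto simp: tensor_power_def)

lemma length_lw [simp]: "length (lw w) = n" by (simp add: lw_def)

lemma nth_lw: "k < n \<Longrightarrow> lw w ! k = w (k + 1)" by (simp add: lw_def del: upt_Suc)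

lemma lw_in: "w \<in> words d n \<Longrightarrow> lw w \<in> Lw"
  by (auto simp: lw_def words_def simp del: upt_Suc)

lemma wl_in: assumes "l \<in> Lw" shows "wl l \<in> words d n"
proof -
  have "wl l k \<in> ubasis d n" if k: "k \<in> {1..n}" for k
  proof -
    have "l ! (k - 1) \<in> set l" using k assms by (intro nth_mem) auto
    then show ?thesis using assms k by (auto simp: wl_def)
  qed
  then show ?thesis unfolding words_def by (auto simp: wl_def)
qed

lemma lw_wl: assumes "l \<in> Lw" shows "lw (wl l) = l"
  by (rule nth_equalityI) (use assms in \<open>auto simp: nth_lw wl_def\<close>)

lemma tensor_ext:
  assumes "t \<in> carrier TP" "t' \<in> carrier TP" "\<And>w. w \<in> words d n \<Longrightarrow> fn t w = fn t' w"
  shows "t = t'"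
proof (rule poly_mapping_eqI)
  fix l
  show "Poly_Mapping.lookup t l = Poly_Mapping.lookup t' l"
  proof (cases "l \<in> Lw")
    case True
    then show ?thesis using assms(3)[OF wl_in[OF True]] lw_wl[OF True] by (simp add: fn_def)
  next
    case False
    then have "l \<notin> Poly_Mapping.keys t" "l \<notin> Poly_Mapping.keys t'" using assms(1,2) unfolding TP_carrier by blast+
    then show ?thesis by (simp add: in_keys_iff)
  qed
qed

lemma TP_add: "t \<in> carrier TP \<Longrightarrow> t' \<in> carrier TP \<Longrightarrow> t + t' \<in> carrier TP"
  unfolding TP_carrier using Poly_Mapping.keys_add[of t t'] by blast
lemma TP_0: "0 \<in> carrier TP" by (simp add: TP_carrier)
lemma TP_scal: "t \<in> carrier TP \<Longrightarrow> scal c * t \<in> carrier TP"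
  unfolding TP_carrier by (auto simp: in_keys_iff subset_iff)
lemma TP_sum: "(\<And>a. a \<in> S \<Longrightarrow> f a \<in> carrier TP) \<Longrightarrow> sum f S \<in> carrier TP"
  by (induction S rule: infinite_finite_induct) (simp_all add: TP_0 TP_add)
lemma TP_single: "l \<in> Lw \<Longrightarrow> Poly_Mapping.single l c \<in> carrier TP"
  unfolding TP_carrier by (auto split: if_splits)

lemma fn_add: "fn (t + t') w = fn t w + fn t' w" by (simp add: fn_def lookup_add)
lemma fn_scal: "fn (scal c * t) w = c * fn t w" by (simp add: fn_def)
lemma fn_sum: "fn (sum f S) w = (\<Sum>a\<in>S. fn (f a) w)" by (simp add: fn_def lookup_sum)

text \<open>There are finitely many words, so a function on them is the coefficient function of a
  tensor. Thus testing an element on tensors is as strong as testing it on functions.\<close>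

lemma fn_surj: obtains t where "t \<in> carrier TP" "\<And>w. w \<in> words d n \<Longrightarrow> fn t w = f w"
proof
  have "ubasis d n = insert V0 ((\<lambda>(i, s). V i s) ` ({1..n} \<times> {1..d}))" by (auto simp: ubasis_def)
  then have "finite (ubasis d n)" by simp
  then have fin: "finite Lw" using finite_lists_length_eq[of "ubasis d n" n] by (simp add: conj_commute)
  let ?t = "\<Sum>l\<in>Lw. Poly_Mapping.single l (f (wl l)) :: 'k tensor"
  show "?t \<in> carrier TP" by (intro TP_sum TP_single)
  fix w assume w: "w \<in> words d n"
  have "fn ?t w = (\<Sum>l\<in>Lw. if l = lw w then f (wl l) else 0)"
    by (simp add: fn_def lookup_sum lookup_single when_def)
  also have "\<dots> = f (wl (lw w))" using fin lw_in[OF w] by (subst sum.delta) auto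
  also have "wl (lw w) = w"
  proof
    fix k show "wl (lw w) k = w k"
      using tm.words_0[OF w, of k] nth_lw[of "k - 1" w] by (cases "k \<in> {1..n}") (auto simp: wl_def)
  qed
  finally show "fn ?t w = f w" .
qed

lemma lookup_lin_ext:
  "Poly_Mapping.lookup (lin_ext f t) l = (\<Sum>v\<in>Poly_Mapping.keys t. Poly_Mapping.lookup t v * Poly_Mapping.lookup (f v) l)"
  by (simp add: lin_ext_def lookup_sum)

lemma sum_pick:
  "(\<Sum>v\<in>Poly_Mapping.keys t. Poly_Mapping.lookup t v * (if v = u then c else 0)) = Poly_Mapping.lookup t u * (c :: 'k ratfun)"
  by (cases "u \<in> Poly_Mapping.keys t") (auto simp: in_keys_iff sum.delta if_distrib[of "(*) _"] cong: if_cong)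

lemma lin_ext_single: "lin_ext f (Poly_Mapping.single v c) = scal c * (f v :: 'k tensor)"
  by (cases "c = 0") (simp_all add: lin_ext_def scal_0)

lemma lin_ext_closed:
  assumes "t \<in> carrier TP" "\<And>v. v \<in> Lw \<Longrightarrow> f v \<in> carrier TP"
  shows "lin_ext f t \<in> carrier TP"
  unfolding lin_ext_def using assms by (intro TP_sum TP_scal) (auto simp: TP_carrier)

text \<open>Lists are counted from 0, so the tensor factors \<open>i\<close> and
  \<open>i + 1\<close> are the entries \<open>i - 1\<close> and \<open>i\<close>.\<close>

definition sw :: "nat \<Rightarrow> ubas list \<Rightarrow> ubas list" where
  "sw i v = take (i - 1) v @ [v ! i, v ! (i - 1)] @ drop (i + 1) v"

lemma length_sw: "1 \<le> i \<Longrightarrow> i < length v \<Longrightarrow> length (sw i v) = length v"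
  by (simp add: sw_def)

lemma nth_sw:
  assumes "1 \<le> i" "i < length v" "k < length v"
  shows "sw i v ! k = v ! (tp (i - 1) i k)"
proof -
  consider "k < i - 1" | "k = i - 1" | "k = i" | "i < k" by linarith
  then show ?thesis
  proof cases
    case 1
    then have "tp (i - 1) i k = k" by (auto simp: transpose_def)
    then show ?thesis using 1 assms by (simp add: sw_def nth_append)
  next
    case 2
    then show ?thesis using assms by (simp add: sw_def nth_append)
  next
    case 3
    have "\<not> i < i - Suc 0" by simp
    then show ?thesis using 3 assms by (simp add: sw_def nth_append nth_Cons')
  next
    case 4
    then have "tp (i - 1) i k = k" by (simp add: transpose_def)
    moreover have "sw i v ! k = drop (i + 1) v ! (k - (i + 1))"
      using 4 assms by (auto simp: sw_def nth_append nth_Cons')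
    ultimately show ?thesis using 4 assms by simp
  qed
qed

lemma sw_sw:
  assumes "1 \<le> i" "i < length v" shows "sw i (sw i v) = v"
proof (rule nth_equalityI)
  show "length (sw i (sw i v)) = length v" using assms by (simp add: length_sw)
  fix k assume "k < length (sw i (sw i v))"
  then have k: "k < length v" using assms by (simp add: length_sw)
  then have "tp (i - 1) i k < length v" using assms by (auto simp: transpose_def)
  then show "sw i (sw i v) ! k = v ! k" using assms k by (simp add: nth_sw length_sw)
qed

lemma sw_lw:
  assumes i: "i \<in> {1..<n}" shows "sw i (lw w) = lw (w \<circ> tp i (i + 1))"
proof (rule nth_equalityI)
  show "length (sw i (lw w)) = length (lw (w \<circ> tp i (i + 1)))" using i by (simp add: length_sw)
  fix k assume "k < length (sw i (lw w))"
  then have k: "k < n" using i by (simp add: length_sw)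
  then have t: "tp (i - 1) i k < n" using i by (auto simp: transpose_def)
  have "tp i (i + 1) (k + 1) = tp (i - 1) i k + 1" using i by (auto simp: transpose_def)
  then show "sw i (lw w) ! k = lw (w \<circ> tp i (i + 1)) ! k"
    using i k t by (simp add: nth_sw nth_lw)
qed

lemma split_pair:
  assumes "1 \<le> i" "i < length v"
  shows "take (i - 1) v @ v ! (i - 1) # v ! i # drop (Suc i) v = v"
proof -
  have "v ! i # drop (Suc i) v = drop i v" using assms by (simp add: Cons_nth_drop_Suc)
  moreover have "v ! (i - 1) # drop i v = drop (i - 1) v" using assms Cons_nth_drop_Suc[of "i - 1" v] by simp
  ultimately show ?thesis by simp
qed

lemma T_on_word:
  assumes v: "v \<in> Lw" and i: "i \<in> {1..<n}"
  shows "Poly_Mapping.single (take (i - 1) v) 1 * T_amended d (v ! (i - 1)) (v ! i) * Poly_Mapping.single (drop (i + 1) v) 1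
    = Poly_Mapping.single v (tm.ca (v ! (i - 1)) (v ! i)) + Poly_Mapping.single (sw i v) (tm.cb (v ! (i - 1)) (v ! i))"
proof -
  have "v ! (i - 1) \<in> set v" "v ! i \<in> set v" using v i by (auto intro!: nth_mem)
  then have "v ! (i - 1) \<in> ubasis d n" "v ! i \<in> ubasis d n" using v by auto
  moreover have "1 \<le> i" "i < length v" using v i by auto
  ultimately show ?thesis
    using split_pair[of i v] by (simp add: T_amended_eq distrib_left distrib_right mult_single plus_list_def sw_def)
qed

lemma sw_in: assumes "v \<in> Lw" "i \<in> {1..<n}" shows "sw i v \<in> Lw"
proof -
  have "v = lw (wl v)" using lw_wl[OF assms(1)] by simp
  then have "sw i v = lw (wl v \<circ> tp i (i + 1))" using sw_lw[OF assms(2), of "wl v"] by simp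
  then show ?thesis using lw_in[OF tm.words_swap[OF wl_in[OF assms(1)] assms(2)]] by simp
qed

section \<open>Comparison of the tensor operators with the model\<close>

fun opL :: "gen \<Rightarrow> 'k tensor \<Rightarrow> 'k tensor" where
  "opL (GT i) = op_T (T_amended d) i"
| "opL (GF i) = op_F \<xi> i"
| "opL GN = op_N"

lemma opL_closed:
  assumes g: "g \<in> gens n" and t: "t \<in> carrier TP" shows "opL g t \<in> carrier TP"
proof (cases g)
  case (GT i)
  then have i: "i \<in> {1..<n}" using g by (auto simp: gens_def)
  have "lin_ext (\<lambda>w. Poly_Mapping.single (take (i - 1) w) 1 * T_amended d (w ! (i - 1)) (w ! i) *
                           Poly_Mapping.single (drop (i + 1) w) 1) t \<in> carrier TP"
  proof (rule lin_ext_closed[OF t])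
    fix v assume v: "v \<in> Lw"
    show "Poly_Mapping.single (take (i - 1) v) 1 * T_amended d (v ! (i - 1)) (v ! i) * Poly_Mapping.single (drop (i + 1) v) 1 \<in> carrier TP"
      unfolding T_on_word[OF v i] by (intro TP_add TP_single v sw_in i)
  qed
  then show ?thesis unfolding GT opL.simps op_T_def .
next
  case (GF i)
  show ?thesis unfolding GF opL.simps op_F_def by (rule lin_ext_closed[OF t]) (rule TP_single)
next
  case GN
  have V0: "V0 \<in> ubasis d n" by (simp add: ubasis_def)
  show ?thesis unfolding GN opL.simps op_N_def
  proof (rule lin_ext_closed[OF t])
    fix v assume v: "v \<in> Lw"
    then have "tl v @ [V0] \<in> Lw" using V0 n_pos by (cases v) auto
    then show "(if hd v = V0 then Poly_Mapping.single (tl v @ [V0]) (sqrt_u ^ length (filter (\<lambda>x. x \<noteq> V0) v)) else 0) \<in> carrier TP"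
      using TP_single TP_0 by simp
  qed
qed

lemma filter_cnt: "length (filter (\<lambda>x. x \<noteq> V0) (lw w)) = cnt n w"
proof -
  have "length (filter (\<lambda>x. x \<noteq> V0) (lw w)) = length (filter (\<lambda>k. w k \<noteq> V0) [1..<n+1])"
    by (simp add: lw_def filter_map o_def del: upt_Suc)
  also have "\<dots> = card (set (filter (\<lambda>k. w k \<noteq> V0) [1..<n+1]))"
    by (rule distinct_card[symmetric]) simp
  also have "set (filter (\<lambda>k. w k \<noteq> V0) [1..<n+1]) = {k \<in> {1..n}. w k \<noteq> V0}" by auto
  finally show ?thesis by (simp add: cnt_def)
qed

text \<open>The coefficient of the image at \<open>w\<close> is a sum over the words that can
  contribute: \<open>w\<close> itself for \<open>F_i\<close>, \<open>w\<close> and its swap for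
  \<open>T_i\<close>, and one shifted word for \<open>N\<close>, provided that \<open>w\<close> ends
  in \<open>V0\<close>.\<close>

lemma opL_opr:
  assumes g: "g \<in> gens n" and t: "t \<in> carrier TP" and w: "w \<in> words d n"
  shows "fn (opL g t) w = tm.opr g (fn t) w"
proof (cases g)
  case (GF i)
  then have i: "i \<in> {1..n}" using g by (auto simp: gens_def)
  have at: "lw w ! (i - 1) = w i" using nth_lw[of "i - 1" w] i by auto
  have "fn (opL g t) w = (\<Sum>v\<in>Poly_Mapping.keys t. Poly_Mapping.lookup t v * (if v = lw w then F_eigenvalue \<xi> (lw w ! (i - 1)) else 0))"
    unfolding GF opL.simps op_F_def fn_def lookup_lin_ext by (intro sum.cong) (auto simp: lookup_single when_def)
  also have "\<dots> = fn t w * \<chi> (col d (w i))"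
    unfolding at using i by (simp add: sum_pick eig fn_def)
  finally show ?thesis by (simp add: GF mult.commute)
next
  case (GT i)
  then have i: "i \<in> {1..<n}" using g by (auto simp: gens_def)
  let ?w = "w \<circ> tp i (i + 1)"
  have at: "lw w ! (i - 1) = w i" "lw w ! i = w (i + 1)" "lw ?w ! (i - 1) = w (i + 1)" "lw ?w ! i = w i"
    using nth_lw[of "i - 1" w] nth_lw[of i w] nth_lw[of "i - 1" ?w] nth_lw[of i ?w] i by auto
  have "fn (opL g t) w = (\<Sum>v\<in>Poly_Mapping.keys t. Poly_Mapping.lookup t v * (if v = lw w then tm.ca (w i) (w (i + 1)) else 0)
      + Poly_Mapping.lookup t v * (if v = lw ?w then tm.cb (w i) (w (i + 1)) else 0))"
    unfolding GT opL.simps op_T_def fn_def lookup_lin_ext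
  proof (rule sum.cong[OF refl])
    fix v assume "v \<in> Poly_Mapping.keys t"
    then have v: "v \<in> Lw" using t by (auto simp: TP_carrier)
    have iff: "sw i v = lw w \<longleftrightarrow> v = lw ?w"
    proof
      assume e: "sw i v = lw w"
      have "v = sw i (sw i v)" using sw_sw[of i v] v i by simp
      then show "v = lw ?w" unfolding e sw_lw[OF i] .
    next
      assume e: "v = lw ?w"
      have "?w \<circ> tp i (i + 1) = w" by (simp add: comp_assoc)
      then show "sw i v = lw w" unfolding e sw_lw[OF i] by (rule arg_cong)
    qed
    have ca: "(if v = lw w then tm.ca (v ! (i - 1)) (v ! i) else 0) = (if v = lw w then tm.ca (w i) (w (i + 1)) else 0)"
      by (rule if_cong) (simp_all only: at)
    have cb: "(if v = lw ?w then tm.cb (v ! (i - 1)) (v ! i) else 0) = (if v = lw ?w then tm.cb (w i) (w (i + 1)) else 0)"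
      by (rule if_cong) (simp_all only: at tm.cb_sym[of "w (i + 1)" "w i"])
    have "Poly_Mapping.lookup (Poly_Mapping.single v (tm.ca (v ! (i - 1)) (v ! i)) + Poly_Mapping.single (sw i v) (tm.cb (v ! (i - 1)) (v ! i))) (lw w)
      = (if v = lw w then tm.ca (w i) (w (i + 1)) else 0) + (if v = lw ?w then tm.cb (w i) (w (i + 1)) else 0)"
      unfolding lookup_add lookup_single when_def iff ca cb ..
    then show "Poly_Mapping.lookup t v * Poly_Mapping.lookup (Poly_Mapping.single (take (i - 1) v) 1 * T_amended d (v ! (i - 1)) (v ! i) *
                           Poly_Mapping.single (drop (i + 1) v) 1) (lw w)
      = Poly_Mapping.lookup t v * (if v = lw w then tm.ca (w i) (w (i + 1)) else 0)
      + Poly_Mapping.lookup t v * (if v = lw ?w then tm.cb (w i) (w (i + 1)) else 0)"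
      unfolding T_on_word[OF v i] by (simp only: distrib_left)
  qed
  also have "\<dots> = fn t w * tm.ca (w i) (w (i + 1)) + fn t ?w * tm.cb (w i) (w (i + 1))"
    by (simp only: sum.distrib sum_pick fn_def)
  finally show ?thesis unfolding GT by (simp only: tm.opr.simps mult.commute)
next
  case GN
  let ?w = "\<lambda>k. w (k - 1)"
  have up: "[1..<n+1] = [1..<n] @ [n]" "[1..<n+1] = 1 # [Suc 1..<Suc n]" using n_pos by (simp_all add: upt_conv_Cons)
  have l1: "lw w = map w [1..<n] @ [w n]" unfolding lw_def up(1) by simp
  have l2: "lw ?w = V0 # map w [1..<n]"
  proof -
    have "map ?w [Suc 1..<Suc n] = map w [1..<n]" by (simp add: map_Suc_upt[symmetric] o_def del: map_Suc_upt upt_Suc)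
    then show ?thesis unfolding lw_def up(2) using tm.words_0[OF w, of 0] by simp
  qed
  show ?thesis
  proof (cases "w n = V0")
    case True
    have "fn (opL g t) w = (\<Sum>v\<in>Poly_Mapping.keys t. Poly_Mapping.lookup t v * (if v = lw ?w then sqrt_u ^ cnt n w else 0))"
      unfolding GN opL.simps op_N_def fn_def lookup_lin_ext
    proof (rule sum.cong[OF refl])
      fix v assume "v \<in> Poly_Mapping.keys t"
      then have "v \<noteq> []" using t n_pos by (auto simp: TP_carrier)
      then have "(hd v = V0 \<and> tl v @ [V0] = lw w) \<longleftrightarrow> v = lw ?w"
        unfolding l1 l2 True by (cases v) auto
      moreover have "length (filter (\<lambda>x. x \<noteq> V0) v) = cnt n w" if "v = lw ?w"
        unfolding that filter_cnt by (rule tm.cnt_shift[OF w True])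
      ultimately have "Poly_Mapping.lookup (if hd v = V0 then Poly_Mapping.single (tl v @ [V0]) (sqrt_u ^ length (filter (\<lambda>x. x \<noteq> V0) v)) else 0) (lw w)
         = (if v = lw ?w then sqrt_u ^ cnt n w else 0 :: 'k ratfun)"
        by (auto simp: lookup_single when_def)
      then show "Poly_Mapping.lookup t v * Poly_Mapping.lookup (if hd v = V0 then Poly_Mapping.single (tl v @ [V0]) (sqrt_u ^ length (filter (\<lambda>x. x \<noteq> V0) v)) else 0) (lw w)
        = Poly_Mapping.lookup t v * (if v = lw ?w then sqrt_u ^ cnt n w else 0)" by (simp only:)
    qed
    also have "\<dots> = fn t ?w * sqrt_u ^ cnt n w" unfolding sum_pick fn_def ..
    finally show ?thesis unfolding GN tm.opr_N if_P[OF True] by (simp only: mult.commute)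
  next
    case False
    have "fn (opL g t) w = (\<Sum>v\<in>Poly_Mapping.keys t. 0)"
      unfolding GN opL.simps op_N_def fn_def lookup_lin_ext
    proof (rule sum.cong[OF refl])
      fix v
      have "tl v @ [V0] \<noteq> lw w" unfolding l1 using False by simp
      then show "Poly_Mapping.lookup t v * Poly_Mapping.lookup (if hd v = V0 then Poly_Mapping.single (tl v @ [V0]) (sqrt_u ^ length (filter (\<lambda>x. x \<noteq> V0) v)) else 0) (lw w) = 0"
        by (simp add: lookup_single when_def)
    qed
    then show ?thesis unfolding GN tm.opr_N if_not_P[OF False] by simp
  qed
qed

definition opw :: "gen list \<Rightarrow> 'k tensor \<Rightarrow> 'k tensor" where "opw l t = foldr opL l t"

lemma opw_props:
  assumes "l \<in> lists (gens n)" "t \<in> carrier TP"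
  shows "opw l t \<in> carrier TP \<and> (\<forall>w\<in>words d n. fn (opw l t) w = tm.actw l (fn t) w)"
  using assms(1)
proof (induction l)
  case Nil then show ?case using assms(2) by (simp add: opw_def tm.actw_def)
next
  case (Cons g l)
  have g: "g \<in> gens n" using Cons.hyps by simp
  have c: "opw l t \<in> carrier TP" and e: "\<And>w. w \<in> words d n \<Longrightarrow> fn (opw l t) w = tm.actw l (fn t) w" using Cons.IH by auto
  have eq: "opw (g # l) t = opL g (opw l t)" by (simp add: opw_def)
  have "fn (opL g (opw l t)) w = tm.actw (g # l) (fn t) w" if w: "w \<in> words d n" for w
  proof -
    have "fn (opL g (opw l t)) w = tm.opr g (fn (opw l t)) w" by (rule opL_opr[OF g c w])
    also have "\<dots> = tm.opr g (tm.actw l (fn t)) w" by (rule tm.opr_local[OF g e w])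
    finally show ?thesis by (simp add: tm.actw_def)
  qed
  then show ?case unfolding eq using opL_closed[OF g c] by blast
qed

section \<open>Existence of the tensor representation\<close>

definition actL :: "'k free \<Rightarrow> 'k tensor \<Rightarrow> 'k tensor" where
  "actL x t = (\<Sum>l\<in>Poly_Mapping.keys x. scal (incl (Poly_Mapping.lookup x l)) * opw l t)"

lemma actL_closed: "x \<in> carr n \<Longrightarrow> t \<in> carrier TP \<Longrightarrow> actL x t \<in> carrier TP"
  unfolding actL_def carr_def using opw_props by (intro TP_sum TP_scal) blast

lemma fn_actL:
  assumes "x \<in> carr n" "t \<in> carrier TP" "w \<in> words d n"
  shows "fn (actL x t) w = tm.act x (fn t) w"
  unfolding actL_def tm.act_def fn_sum fn_scal
proof (rule sum.cong[OF refl])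
  fix l assume "l \<in> Poly_Mapping.keys x"
  then have l: "l \<in> lists (gens n)" using assms(1) unfolding carr_def by blast
  then have "fn (opw l t) w = tm.actw l (fn t) w" using opw_props[OF l assms(2)] assms(3) by blast
  then show "incl (Poly_Mapping.lookup x l) * fn (opw l t) w = incl (Poly_Mapping.lookup x l) * tm.actw l (fn t) w"
    by (simp only:)
qed

lemma actL_eqI:
  assumes "x \<in> carr n" "t \<in> carrier TP" "s \<in> carrier TP" "\<And>w. w \<in> words d n \<Longrightarrow> tm.act x (fn t) w = fn s w"
  shows "actL x t = s"
  by (rule tensor_ext[OF actL_closed[OF assms(1,2)] assms(3)]) (use fn_actL[OF assms(1,2)] assms(4) in simp)

lemma actL_add_left: "\<lbrakk>x \<in> carr n; y \<in> carr n; t \<in> carrier TP\<rbrakk> \<Longrightarrow> actL (x + y) t = actL x t + actL y t"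
  by (rule actL_eqI) (auto intro!: carr_add TP_add actL_closed simp: tm.act_add fn_add fn_actL)
lemma actL_scal_left: "\<lbrakk>x \<in> carr n; t \<in> carrier TP\<rbrakk> \<Longrightarrow> actL (scal c * x) t = scal (incl c) * actL x t"
  by (rule actL_eqI) (auto intro!: carr_mult carr_scal TP_scal actL_closed simp: tm.act_scal_mult fn_scal fn_actL)
lemma actL_mult:
  assumes "x \<in> carr n" "y \<in> carr n" "t \<in> carrier TP" shows "actL (x * y) t = actL x (actL y t)"
proof (rule actL_eqI)
  fix w assume w: "w \<in> words d n"
  have k: "Poly_Mapping.keys x \<subseteq> lists (gens n)" using assms(1) by (simp add: carr_def)
  have "tm.act x (fn (actL y t)) w = tm.act x (tm.act y (fn t)) w"
    by (rule tm.act_local[OF k fn_actL[OF assms(2,3)] w])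
  then show "tm.act (x * y) (fn t) w = fn (actL x (actL y t)) w"
    using fn_actL[OF assms(1) actL_closed[OF assms(2,3)] w] by (simp add: tm.act_mult)
qed (use assms carr_mult actL_closed in auto)
lemma actL_1: "t \<in> carrier TP \<Longrightarrow> actL 1 t = t"
  by (rule actL_eqI) (auto intro: carr_1 simp: tm.act_1)
lemma actL_add_right:
  assumes "x \<in> carr n" "t \<in> carrier TP" "s \<in> carrier TP" shows "actL x (t + s) = actL x t + actL x s"
proof (rule actL_eqI)
  have e: "fn (t + s) = (\<lambda>w. fn t w + fn s w)" by (rule ext) (rule fn_add)
  show "tm.act x (fn (t + s)) w = fn (actL x t + actL x s) w" if "w \<in> words d n" for w
    unfolding e tm.act_f_add fn_add using that assms by (simp add: fn_actL)
qed (use assms TP_add actL_closed in auto)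
lemma actL_scal_right:
  assumes "x \<in> carr n" "t \<in> carrier TP" shows "actL x (scal c * t) = scal c * actL x t"
proof (rule actL_eqI)
  have e: "fn (scal c * t) = (\<lambda>w. c * fn t w)" by (rule ext) (rule fn_scal)
  show "tm.act x (fn (scal c * t)) w = fn (scal c * actL x t) w" if "w \<in> words d n" for w
    unfolding e tm.act_f_mult fn_scal using that assms by (simp add: fn_actL)
qed (use assms TP_scal actL_closed in auto)

lemma actL_gen: "actL (wd [g]) t = opL g t"
  by (simp add: actL_def wd_def incl_1 scal_1 opw_def)

lemma TP_ops: "s \<oplus>\<^bsub>TP\<^esub> t = s + t" "c \<odot>\<^bsub>TP\<^esub> t = scal (incl c) * t"
  by (simp_all add: tensor_power_def)

text \<open>The choice of a representative is harmless: two representatives differ by an element of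
  the ideal, which acts as zero.\<close>

definition \<rho>0 :: "'k free set \<Rightarrow> 'k tensor \<Rightarrow> 'k tensor" where
  "\<rho>0 c = (\<lambda>t\<in>carrier TP. actL (SOME x. x \<in> carr n \<and> RY_class d n x = c) t)"

lemma \<rho>0_cls:
  assumes x: "x \<in> carr n" shows "\<rho>0 (RY_class d n x) = (\<lambda>t\<in>carrier TP. actL x t)"
proof -
  let ?r = "SOME y. y \<in> carr n \<and> RY_class d n y = RY_class d n x"
  have r: "?r \<in> carr n \<and> RY_class d n ?r = RY_class d n x" by (rule someI[of _ x]) (simp add: x)
  then have I: "?r - x \<in> RY_ideal d n" using tm.Q.cls_eq x by blast
  have "actL ?r t = actL x t" if t: "t \<in> carrier TP" for t
  proof (rule actL_eqI)
    fix w assume w: "w \<in> words d n"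
    have "tm.act (?r - x) (fn t) w = 0" by (rule tm.I_act[OF I w])
    then show "tm.act ?r (fn t) w = fn (actL x t) w" using fn_actL[OF x t w] by (simp add: tm.act_diff)
  qed (use r t actL_closed[OF x t] in auto)
  then show ?thesis unfolding \<rho>0_def by (intro restrict_ext)
qed

lemma restrict_End:
  assumes x: "x \<in> carr n" shows "(\<lambda>t\<in>carrier TP. actL x t) \<in> carrier (End_tensor d n)"
proof -
  have "t \<oplus>\<^bsub>TP\<^esub> s \<in> carrier TP" "c \<odot>\<^bsub>TP\<^esub> t \<in> carrier TP" if "t \<in> carrier TP" "s \<in> carrier TP" for t s c
    using that by (auto simp: TP_ops intro: TP_add TP_scal)
  then show ?thesis
    unfolding End_alg_def LinearCombinations.module_hom_def
    using actL_closed[OF x] actL_add_right[OF x] actL_scal_right[OF x]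
    by (auto simp: TP_ops)
qed

lemma End_ops:
  "f \<otimes>\<^bsub>End_tensor d n\<^esub> g = compose (carrier TP) f g"
  "\<one>\<^bsub>End_tensor d n\<^esub> = (\<lambda>t\<in>carrier TP. t)"
  "f \<oplus>\<^bsub>End_tensor d n\<^esub> g = (\<lambda>t\<in>carrier TP. f t + g t)"
  "c \<odot>\<^bsub>End_tensor d n\<^esub> f = (\<lambda>t\<in>carrier TP. scal (incl c) * f t)"
  by (simp_all add: End_alg_def TP_ops)

lemma \<rho>0_rep: "tensor_rep d n \<xi> (T_amended d) \<rho>0"
proof -
  note A = tm.Q.A_carrier
  have ring: "\<rho>0 \<in> Ring.ring_hom (RY d n) (End_tensor d n)"
  proof (rule ring_hom_memI)
    fix c assume "c \<in> carrier (RY d n :: ('k ratfun, 'k free set) module)"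
    then obtain x where x: "x \<in> carr n" "c = RY_class d n x" unfolding A by blast
    show "\<rho>0 c \<in> carrier (End_tensor d n)" unfolding x(2) \<rho>0_cls[OF x(1)] by (rule restrict_End[OF x(1)])
    fix e assume "e \<in> carrier (RY d n :: ('k ratfun, 'k free set) module)"
    then obtain y where y: "y \<in> carr n" "e = RY_class d n y" unfolding A by blast
    show "\<rho>0 (c \<otimes>\<^bsub>RY d n\<^esub> e) = \<rho>0 c \<otimes>\<^bsub>End_tensor d n\<^esub> \<rho>0 e"
      unfolding x(2) y(2) tm.Q.A_mult[OF x(1) y(1)] \<rho>0_cls[OF x(1)] \<rho>0_cls[OF y(1)] \<rho>0_cls[OF carr_mult[OF x(1) y(1)]] End_ops compose_def
      using actL_closed[OF y(1)] actL_mult[OF x(1) y(1)] by (intro restrict_ext) simp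
    show "\<rho>0 (c \<oplus>\<^bsub>RY d n\<^esub> e) = \<rho>0 c \<oplus>\<^bsub>End_tensor d n\<^esub> \<rho>0 e"
      unfolding x(2) y(2) tm.Q.A_add[OF x(1) y(1)] \<rho>0_cls[OF x(1)] \<rho>0_cls[OF y(1)] \<rho>0_cls[OF carr_add[OF x(1) y(1)]] End_ops
      using actL_add_left[OF x(1) y(1)] by (intro restrict_ext) simp
  next
    show "\<rho>0 \<one>\<^bsub>RY d n\<^esub> = \<one>\<^bsub>End_tensor d n\<^esub>"
      unfolding tm.Q.A_one \<rho>0_cls[OF carr_1] End_ops using actL_1 by (intro restrict_ext) simp
  qed
  have "\<rho>0 \<in> LinearCombinations.module_hom class_ring (RY d n) (End_tensor d n)"
    unfolding LinearCombinations.module_hom_def mem_Collect_eq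
  proof (intro conjI allI impI)
    show "\<rho>0 \<in> carrier (RY d n) \<rightarrow> carrier (End_tensor d n)" using ring_hom_closed[OF ring] by blast
    fix c e assume "c \<in> carrier (RY d n :: ('k ratfun, 'k free set) module) \<and> e \<in> carrier (RY d n :: ('k ratfun, 'k free set) module)"
    then show "\<rho>0 (c \<oplus>\<^bsub>RY d n\<^esub> e) = \<rho>0 c \<oplus>\<^bsub>End_tensor d n\<^esub> \<rho>0 e" using ring_hom_add[OF ring] by blast
  next
    fix a :: "'k ratfun" and c assume "a \<in> carrier class_ring \<and> c \<in> carrier (RY d n :: ('k ratfun, 'k free set) module)"
    then obtain x where x: "x \<in> carr n" "c = RY_class d n x" unfolding A by blast
    show "\<rho>0 (a \<odot>\<^bsub>RY d n\<^esub> c) = a \<odot>\<^bsub>End_tensor d n\<^esub> \<rho>0 c"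
      unfolding x(2) tm.Q.A_smult[OF x(1)] \<rho>0_cls[OF x(1)] \<rho>0_cls[OF carr_mult[OF carr_scal x(1)]] End_ops
      using actL_scal_left[OF x(1)] by (intro restrict_ext) simp
  qed
  moreover have "\<rho>0 (RY_class d n (wd [g])) = restrict (opL g) (carrier TP)" if "(wd [g] :: 'k free) \<in> carr n" for g
    unfolding \<rho>0_cls[OF that] actL_gen by (rule refl)
  ultimately show ?thesis
    unfolding tensor_rep_def using ring carr_gF carr_gT carr_gN
    by (metis opL.simps wd_gens)
qed

section \<open>Faithfulness\<close>

text \<open>The local two-letter operator is left arbitrary, so that these consequences serve both
  the amended and the printed formula.\<close>

context
  fixes T :: "ubas \<Rightarrow> ubas \<Rightarrow> 'k tensor" and \<rho> :: "'k free set \<Rightarrow> 'k tensor \<Rightarrow> 'k tensor"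
  assumes rep: "tensor_rep d n \<xi> T \<rho>"
begin

abbreviation "rh x \<equiv> \<rho> (RY_class d n x)"

lemma rep_ring: "\<rho> \<in> Ring.ring_hom (RY d n) (End_tensor d n)"
  and rep_mod: "\<rho> \<in> LinearCombinations.module_hom class_ring (RY d n) (End_tensor d n)"
  using rep by (simp_all add: tensor_rep_def)

lemma r_mult: "x \<in> carr n \<Longrightarrow> y \<in> carr n \<Longrightarrow> t \<in> carrier TP \<Longrightarrow> rh (x * y) t = rh x (rh y t)"
  using ring_hom_mult[OF rep_ring tm.Q.A_mem tm.Q.A_mem, of x y] by (simp add: tm.Q.A_mult End_ops compose_def)
lemma r_add: "x \<in> carr n \<Longrightarrow> y \<in> carr n \<Longrightarrow> t \<in> carrier TP \<Longrightarrow> rh (x + y) t = rh x t + rh y t"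
  using ring_hom_add[OF rep_ring tm.Q.A_mem tm.Q.A_mem, of x y] by (simp add: tm.Q.A_add End_ops)
lemma r_one: "t \<in> carrier TP \<Longrightarrow> rh 1 t = t"
  using ring_hom_one[OF rep_ring] by (simp add: tm.Q.A_one End_ops)
lemma r_scal: "x \<in> carr n \<Longrightarrow> t \<in> carrier TP \<Longrightarrow> rh (scal c * x) t = scal (incl c) * rh x t"
  using module_hom_smult[OF rep_mod _ tm.Q.A_mem, of c x] by (simp add: tm.Q.A_smult End_ops)
lemma r_zero: "t \<in> carrier TP \<Longrightarrow> rh 0 t = 0"
  using r_scal[of 1 t 0] carr_1[of n, where 'a = "'k ratfun"] by (simp add: scal_0 tm.j_0)
lemma r_sum: "(\<And>a. a \<in> S \<Longrightarrow> f a \<in> carr n) \<Longrightarrow> t \<in> carrier TP \<Longrightarrow> rh (sum f S) t = (\<Sum>a\<in>S. rh (f a) t)"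
  by (induction S rule: infinite_finite_induct) (simp_all add: r_zero r_add carr_sum)
lemma r_pow_fix: "x \<in> carr n \<Longrightarrow> t \<in> carrier TP \<Longrightarrow> rh x t = t \<Longrightarrow> rh (x ^ k) t = t"
  by (induction k) (simp_all add: r_one r_mult carr_pow)

lemma r_F: "i \<in> {1..n} \<Longrightarrow> t \<in> carrier TP \<Longrightarrow> rh (gF i) t = op_F \<xi> i t"
  using rep by (simp add: tensor_rep_def del: atLeastAtMost_iff)
lemma r_T: "i \<in> {1..<n} \<Longrightarrow> t \<in> carrier TP \<Longrightarrow> rh (gT i) t = op_T T i t"
  using rep by (simp add: tensor_rep_def del: atLeastLessThan_iff)
lemma r_N: "t \<in> carrier TP \<Longrightarrow> rh gN t = op_N t"
  using rep by (simp add: tensor_rep_def)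

end

text \<open>A homomorphism is determined by its values on the generators, so every representation
  with the amended operators is the model action.\<close>

lemma rep_act:
  assumes rep: "tensor_rep d n \<xi> (T_amended d) \<rho>" and x: "x \<in> carr n" and t: "t \<in> carrier TP"
  shows "\<rho> (RY_class d n x) t = actL x t"
proof -
  have g: "\<rho> (RY_class d n (wd [g])) s = opL g s" if "g \<in> gens n" "s \<in> carrier TP" for g s
  proof (cases g)
    case (GT i)
    then have "i \<in> {1..<n}" using that(1) by (auto simp: gens_def)
    then show ?thesis unfolding GT wd_gens opL.simps by (rule r_T[OF rep _ that(2)])
  next
    case (GF i)
    then have "i \<in> {1..n}" using that(1) by (auto simp: gens_def)
    then show ?thesis unfolding GF wd_gens opL.simps by (rule r_F[OF rep _ that(2)])
  next
    case GN
    show ?thesis unfolding GN wd_gens opL.simps by (rule r_N[OF rep that(2)])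
  qed
  have wc: "wd l \<in> carr n" if "l \<in> lists (gens n)" for l
    unfolding wd_def using that by (rule carr_single)
  have w: "\<rho> (RY_class d n (wd l)) t = opw l t" if "l \<in> lists (gens n)" for l
    using that
  proof (induction l)
    case Nil
    show ?case using r_one[OF rep t] by (simp add: wd_Nil opw_def)
  next
    case (Cons a l)
    have "wd (a # l) = wd [a] * (wd l :: 'k free)" by (rule wd_Cons)
    then have "\<rho> (RY_class d n (wd (a # l))) t = \<rho> (RY_class d n (wd [a])) (opw l t)"
      using r_mult[OF rep wc wc t, of "[a]" l] Cons by simp
    also have "\<dots> = opL a (opw l t)" using Cons.hyps opw_props[of l t] t by (intro g) auto
    finally show ?case by (simp add: opw_def)
  qed
  have keys: "l \<in> lists (gens n)" if "l \<in> Poly_Mapping.keys x" for l using x that unfolding carr_def by blast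
  have "x = (\<Sum>l\<in>Poly_Mapping.keys x. scal (Poly_Mapping.lookup x l) * wd l)"
    by (subst (1) pm_single_split[of x]) (simp add: wd_def)
  then have "\<rho> (RY_class d n x) t = \<rho> (RY_class d n (\<Sum>l\<in>Poly_Mapping.keys x. scal (Poly_Mapping.lookup x l) * wd l)) t"
    by (rule arg_cong)
  also have "\<dots> = (\<Sum>l\<in>Poly_Mapping.keys x. \<rho> (RY_class d n (scal (Poly_Mapping.lookup x l) * wd l)) t)"
    by (rule r_sum[OF rep _ t]) (intro carr_mult carr_scal wc keys)
  also have "\<dots> = actL x t"
    unfolding actL_def by (rule sum.cong[OF refl]) (simp add: r_scal[OF rep wc t] w keys)
  finally show ?thesis .
qed

text \<open>Elements with equal images act equally on all functions, by \<open>fn_surj\<close>.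
  Their difference is a combination of \<open>C_n\<close> modulo the ideal, and a combination acting
  as zero has zero coefficients.\<close>

lemma rep_faithful:
  assumes rep: "tensor_rep d n \<xi> (T_amended d) \<rho>"
  shows "faithful d n \<rho>"
  unfolding faithful_def
proof (rule inj_onI)
  fix a b assume "a \<in> carrier (RY d n :: ('k ratfun, 'k free set) module)" "b \<in> carrier (RY d n :: ('k ratfun, 'k free set) module)"
    and eq: "\<rho> a = \<rho> b"
  then obtain x y where x: "x \<in> carr n" "a = RY_class d n x" and y: "y \<in> carr n" "b = RY_class d n y"
    unfolding tm.Q.A_carrier by blast
  have k: "Poly_Mapping.keys x \<subseteq> lists (gens n)" "Poly_Mapping.keys y \<subseteq> lists (gens n)" using x y by (auto simp: carr_def)
  have same: "tm.act x f w = tm.act y f w" if w: "w \<in> words d n" for f w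
  proof -
    obtain t where t: "t \<in> carrier TP" "\<And>w. w \<in> words d n \<Longrightarrow> fn t w = f w" using fn_surj[of f] by blast
    have "actL x t = actL y t" using rep_act[OF rep x(1) t(1)] rep_act[OF rep y(1) t(1)] eq x(2) y(2) by simp
    then have "tm.act x (fn t) w = tm.act y (fn t) w" using fn_actL[OF x(1) t(1) w] fn_actL[OF y(1) t(1) w] by simp
    then show ?thesis using tm.act_local[OF k(1) t(2) w] tm.act_local[OF k(2) t(2) w] by simp
  qed
  have z: "x - y \<in> carr n" by (rule carr_diff[OF x(1) y(1)])
  obtain c where c: "(x - y) - (\<Sum>\<alpha>\<in>Cidx d n. scal (c \<alpha>) * CX n \<alpha>) \<in> RY_ideal d n"
    by (rule tm.Q.C_spans[OF z])
  have "c \<alpha> = 0" if "\<alpha> \<in> Cidx d n" for \<alpha>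
  proof (rule tm.combination_zero[OF _ that])
    fix f w assume w: "w \<in> words d n"
    show "tm.act (\<Sum>\<alpha>\<in>Cidx d n. scal (c \<alpha>) * CX n \<alpha>) f w = 0"
      using tm.I_act[OF c w, of f] same[OF w, of f] by (simp add: tm.act_diff)
  qed
  then have "(\<Sum>\<alpha>\<in>Cidx d n. scal (c \<alpha>) * CX n \<alpha>) = (0 :: 'k free)" by (intro sum.neutral) (simp add: scal_0)
  then have "x - y \<in> RY_ideal d n" using c by simp
  then show "a = b" unfolding x(2) y(2) using tm.Q.cls_eq[OF x(1) y(1)] by blast
qed

text \<open>On \<open>v\<^sub>0 \<otimes> v\<^sub>1\<^sup>d \<otimes> v\<^sub>0 \<otimes> \<cdots>\<close> the printed operator violates the quadratic relation, so it can only
  define a representation when there is no \<open>T\<^sub>i\<close> at all.\<close>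

lemma printed_n1:
  assumes rep: "tensor_rep d n \<xi> (T_printed d) \<rho>"
  shows "n = 1"
proof (rule ccontr)
  assume "n \<noteq> 1"
  then have n2: "2 \<le> n" using n_pos by simp
  let ?rest = "replicate (n - 2) V0"
  let ?v = "V0 # V 1 d # ?rest" and ?w = "V 1 d # V0 # ?rest"
  have vw: "?v \<in> Lw" "?w \<in> Lw" using n2 d_pos by (auto simp: ubasis_def)
  let ?s = "Poly_Mapping.single ?w sqrt_u :: 'k tensor"
  have v: "Poly_Mapping.single ?v 1 \<in> carrier TP" and s: "?s \<in> carrier TP" using vw by (simp_all only: TP_single)
  have i: "1 \<in> {1..<n}" and j: "1 \<in> {1..n}" "2 \<in> {1..n}" using n2 by auto
  note m = r_mult[OF rep] and cT = carr_gT[OF i, where 'a = 'k] and cF1 = carr_gF[OF j(1), where 'a = 'k] and cF2 = carr_gF[OF j(2), where 'a = 'k]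
  have T1: "\<rho> (RY_class d n (gT 1)) (Poly_Mapping.single ?v 1) = ?s"
    unfolding r_T[OF rep i v] op_T_def lin_ext_single by (simp add: mult_single plus_list_def scal_1)
  have T2: "\<rho> (RY_class d n (gT 1)) ?s = Poly_Mapping.single ?v (incl uvar)"
    unfolding r_T[OF rep i s] op_T_def lin_ext_single by (simp add: mult_single plus_list_def incl_uvar power2_eq_square)
  \<comment> \<open>Both letters in question have eigenvalue 1, as \<open>\<xi> ^ d = 1\<close>.
    Hence all monomials in \<open>gF 1\<close> and \<open>gF 2\<close> fix \<open>?s\<close>, and so
    does their average \<open>E_1\<close>.\<close>
  have F1: "\<rho> (RY_class d n (gF 1)) ?s = ?s" unfolding r_F[OF rep j(1) s] op_F_def lin_ext_single by (simp add: xi_pow cst_1)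
  have F2: "\<rho> (RY_class d n (gF 2)) ?s = ?s" unfolding r_F[OF rep j(2) s] op_F_def lin_ext_single by simp
  have cE: "(gE d 1 :: 'k free) \<in> carr n" unfolding gE_def using cF1 cF2 by (intro carr_mult carr_scal carr_sum carr_pow) (simp_all add: numeral_2_eq_2)
  have E: "\<rho> (RY_class d n (gE d 1)) ?s = ?s"
  proof -
    have a: "(gF 1 ^ k * gF (1 + 1) ^ (d - k) :: 'k free) \<in> carr n" for k using carr_mult[OF carr_pow[OF cF1] carr_pow[OF cF2]] by (simp add: numeral_2_eq_2)
    have b: "\<rho> (RY_class d n (gF 1 ^ k * gF (1 + 1) ^ (d - k))) ?s = ?s" for k
      using m[OF carr_pow[OF cF1] carr_pow[OF cF2] s] r_pow_fix[OF rep cF1 s F1] r_pow_fix[OF rep cF2 s F2] by (simp add: numeral_2_eq_2)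
    have "\<rho> (RY_class d n (gE d 1)) ?s = scal (incl (1 / of_nat d)) * (\<Sum>k<d. ?s)"
    proof -
      have "\<rho> (RY_class d n (gE d 1)) ?s = scal (incl (1 / of_nat d)) * \<rho> (RY_class d n (\<Sum>k<d. gF 1 ^ k * gF (1 + 1) ^ (d - k))) ?s"
        unfolding gE_def by (rule r_scal[OF rep carr_sum s]) (rule a)
      also have "\<rho> (RY_class d n (\<Sum>k<d. gF 1 ^ k * gF (1 + 1) ^ (d - k))) ?s = (\<Sum>k<d. \<rho> (RY_class d n (gF 1 ^ k * gF (1 + 1) ^ (d - k))) ?s)"
        by (rule r_sum[OF rep a s])
      finally show ?thesis unfolding b .
    qed
    also have "\<dots> = ?s"
    proof (rule poly_mapping_eqI)
      fix l
      have "incl (1 / of_nat d) * (of_nat d * z) = z" for z :: "'k ratfun"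
        using tm.dn0 tm.j_inverse[of "of_nat d"] by (simp add: divide_inverse tm.j_mult tm.j_1 tm.j_of_nat)
      moreover have "(\<Sum>k<d. Poly_Mapping.lookup ?s l) = of_nat d * Poly_Mapping.lookup ?s l" by simp
      ultimately have "incl (1 / of_nat d) * (\<Sum>k<d. Poly_Mapping.lookup ?s l) = Poly_Mapping.lookup ?s l" by metis
      then show "Poly_Mapping.lookup (scal (incl (1 / of_nat d)) * (\<Sum>k<d. ?s)) l = Poly_Mapping.lookup ?s l"
        by (simp add: lookup_sum del: sum_constant)
    qed
    finally show ?thesis .
  qed
  let ?R = "scal uvar + scal (uvar - 1) * gF 1 ^ ((d\<^sup>2 - d) div 2) * gE d 1 * gT 1 :: 'k free"
  have c2: "(gF 1 ^ ((d\<^sup>2 - d) div 2) * gE d 1 * gT 1 :: 'k free) \<in> carr n" by (intro carr_mult carr_pow cF1 cE cT)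
  have cR: "?R \<in> carr n" unfolding mult.assoc by (intro carr_add carr_scal carr_mult carr_pow cF1 cE cT)
  have "gT 1 ^ 2 - ?R \<in> RY_ideal d n"
    using subsetD[OF tm.Q.I_rel relators.quadratic[OF i]] .
  then have "RY_class d n (gT 1 ^ 2) = RY_class d n ?R" using tm.Q.cls_eq[OF carr_pow[OF cT] cR] by blast
  then have eq: "\<rho> (RY_class d n (gT 1 ^ 2)) (Poly_Mapping.single ?v 1) = \<rho> (RY_class d n ?R) (Poly_Mapping.single ?v 1)" by simp
  have L: "\<rho> (RY_class d n (gT 1 ^ 2)) (Poly_Mapping.single ?v 1) = Poly_Mapping.single ?v (incl uvar)"
    unfolding power2_eq_square m[OF cT cT v] T1 T2 ..
  have "\<rho> (RY_class d n ?R) (Poly_Mapping.single ?v 1)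
     = \<rho> (RY_class d n (scal uvar * 1)) (Poly_Mapping.single ?v 1)
       + \<rho> (RY_class d n (scal (uvar - 1) * (gF 1 ^ ((d\<^sup>2 - d) div 2) * gE d 1 * gT 1))) (Poly_Mapping.single ?v 1)"
    using r_add[OF rep carr_scal carr_mult[OF carr_scal c2] v, of uvar "uvar - 1"] by (simp add: mult.assoc)
  also have "\<dots> = scal (incl uvar) * Poly_Mapping.single ?v 1 + scal (incl (uvar - 1)) * ?s"
    unfolding r_scal[OF rep carr_1 v] r_scal[OF rep c2 v] r_one[OF rep v]
      m[OF carr_mult[OF carr_pow[OF cF1] cE] cT v] T1 m[OF carr_pow[OF cF1] cE s] E r_pow_fix[OF rep cF1 s F1] ..
  \<comment> \<open>Comparison of coefficients at \<open>?w\<close>: the square of the printed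
    operator contributes nothing there, the right-hand side of the relation contributes
    \<open>(u - 1) u^(1/2)\<close>.\<close>
  finally have "Poly_Mapping.lookup (Poly_Mapping.single ?v (incl uvar)) ?w
      = Poly_Mapping.lookup (scal (incl uvar) * Poly_Mapping.single ?v 1 + scal (incl (uvar - 1)) * ?s) ?w"
    using eq L by simp
  then have "incl (uvar - 1) * sqrt_u = (0 :: 'k ratfun)" by (simp add: lookup_add lookup_single)
  then have "uvar - 1 = (0 :: 'k ratfun)" using sqrt_u_nz tm.j_eq_0 by simp
  then show False by (simp add: uvar_def One_fract_def Zero_fract_def eq_fract one_pCons)
qed

text \<open>With \<open>n = 1\<close> there are no operators \<open>T_i\<close>, so the printed and
  the amended conditions on a representation coincide.\<close>

lemma printed_faithful:
  assumes rep: "tensor_rep d n \<xi> (T_printed d) \<rho>"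
  shows "faithful d n \<rho>"
proof -
  have "{1..<n} = {}" using printed_n1[OF rep] by simp
  then have "tensor_rep d n \<xi> (T_amended d) \<rho>" using rep by (simp add: tensor_rep_def)
  then show ?thesis by (rule rep_faithful)
qed

end

text \<open>For \<open>n \<ge> 2\<close> no representation takes the printed values, by
  \<open>printed_n1\<close>; there the faithfulness claim is carried by the clauses on the amended
  operators, which include existence.\<close>

theorem theorem4p14:
  fixes n d :: nat
  assumes "n \<ge> 1" and "d \<ge> 1"
  shows "\<not> LinearCombinations.module.lin_dep class_ring (RY d n)
             (C_set d n :: 'k::field_char_0 free set set) \<and>
         vectorspace.fin_dim class_ring (RY d n :: ('k ratfun, 'k free set) module) \<and>
         vectorspace.dim class_ring (RY d n :: ('k ratfun, 'k free set) module) =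
           card (C_set d n :: 'k free set set) \<and>
         card (C_set d n :: 'k free set set) = (\<Sum>r=0..n. d ^ r * (n choose r)\<^sup>2 * fact r) \<and>
         (n \<le> d \<longrightarrow> (\<forall>\<xi> :: 'k. primitive_root d \<xi> \<longrightarrow>
           (\<forall>\<rho>. tensor_rep d n \<xi> (T_printed d) \<rho> \<longrightarrow> faithful d n \<rho>) \<and>
           (\<exists>\<rho>. tensor_rep d n \<xi> (T_amended d) \<rho>) \<and>
           (\<forall>\<rho>. tensor_rep d n \<xi> (T_amended d) \<rho> \<longrightarrow> faithful d n \<rho>)))"
proof -
  interpret Q: RYquot d n "TYPE('k)" by unfold_locales (use assms in auto)
  have "(\<forall>\<rho>. tensor_rep d n \<xi> (T_printed d) \<rho> \<longrightarrow> faithful d n \<rho>) \<and>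
           (\<exists>\<rho>. tensor_rep d n \<xi> (T_amended d) \<rho>) \<and>
           (\<forall>\<rho>. tensor_rep d n \<xi> (T_amended d) \<rho> \<longrightarrow> faithful d n \<rho>)"
    if "primitive_root d \<xi>" for \<xi> :: 'k
  proof -
    interpret tensor_model n d \<xi> by unfold_locales (use assms that in auto)
    show ?thesis using printed_faithful \<rho>0_rep rep_faithful by blast
  qed
  then show ?thesis
    using Q.C_set_indep Q.dimension(1,2) Q.card_C_set by blast
qed

end
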